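(* Assume that conditions $\mathcal{C}_2(\boldsymbol{\gamma},\boldsymbol{\rho},\boldsymbol{A})$ and $\mathcal{J}(\boldsymbol{R})$ (stated in the context) hold. Suppose, without loss of generality, that $n_1\leq n_2\leq\cdots\leq n_m$, and then that, for any $j\in\{1,\ldots,m\}$, as $n\to\infty$: $k_j=k_j(n)\to\infty$ with $k_j/n_j\to 0$, $n_1/n_j\to b_j\in(0,1]$, $k_1/k_j\to c_j\in(0,\infty)$ (with $c_1=1$ and $b_m\leq b_{m-1}\leq\cdots\leq b_1=1$) and $\sqrt{k_j}A_j(n_j/k_j)\to\lambda_j\in\mathbb{R}$. Let the weight vector $\boldsymbol{\omega}=(\omega_1,\ldots,\omega_m)^\top$ be such that $\boldsymbol{\omega}^\top\boldsymbol{1}=1$ and define a vector $\boldsymbol{B}$ and a symmetric matrix $\mathbf{V}$ by $$\boldsymbol{B}=\left(\frac{\lambda_1}{1-\rho_1},\ldots,\frac{\lambda_m}{1-\rho_m}\right)^\top,\quad \mathbf{V}_{j,\ell}=\begin{cases}\gamma_j^2 & \text{if } j=\ell,\\ \gamma_j\gamma_\ell\sqrt{c_j/c_\ell}\,R_{j,\ell}(c_\ell/c_j,b_\ell/b_j) & \text{if } j<\ell.\end{cases}$$ Then $(\sqrt{k_1}(\widehat{\gamma}_1(k_1)-\gamma_1),\ldots,\sqrt{k_m}(\widehat{\gamma}_m(k_m)-\gamma_m))^\top\stackrel{d}{\longrightarrow}\mathcal{N}(\boldsymbol{B},\mathbf{V})$. In particular, if $\boldsymbol{\gamma}=\gamma\boldsymbol{1}$,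 then, with $k=\sum_{j=1}^m k_j$, $\sqrt{k}(\widehat{\gamma}_n(\boldsymbol{\omega})-\gamma)\stackrel{d}{\longrightarrow}\mathcal{N}(\boldsymbol{\omega}^\top\boldsymbol{B}_{\boldsymbol{c}},\boldsymbol{\omega}^\top\mathbf{V}_{\boldsymbol{c}}\boldsymbol{\omega})$, where $$\boldsymbol{B}_{\boldsymbol{c}}=\sqrt{\sum_{i=1}^m c_i^{-1}}\left(\sqrt{c_1}\frac{\lambda_1}{1-\rho_1},\ldots,\sqrt{c_m}\frac{\lambda_m}{1-\rho_m}\right)^\top$$ and $\mathbf{V}_{\boldsymbol{c}}$ is the symmetric matrix with $$[\mathbf{V}_{\boldsymbol{c}}]_{j,\ell}=\left(\sum_{i=1}^m c_i^{-1}\right)\begin{cases}\gamma^2c_j & \text{if } j=\ell,\\ \gamma^2c_jR_{j,\ell}(c_\ell/c_j,b_\ell/b_j) & \text{if } j<\ell.\end{cases}$$ The matrix $\mathbf{V}$ is positive definite if and only if $\mathbf{V}_{\boldsymbol{c}}$ is so, and hence we have the following results on optimal weights: 1. (Variance-optimal weights) There is a unique solution to the minimization problem of $\boldsymbol{\omega}^\top\mathbf{V}_{\boldsymbol{c}}\boldsymbol{\omega}$ subject to the constraint $\boldsymbol{\omega}^\top\boldsymbol{1}=1$, which is $\boldsymbol{\omega}^{(\mathrm{Var})}=\dfrac{\mathbf{V}_{\boldsymbol{c}}^{-1}\boldsymbol{1}}{\boldsymbol{1}^\top\mathbf{V}_{\boldsymbol{c}}^{-1}\boldsymbol{1}}$,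 and then $$\sqrt{k}(\widehat{\gamma}_n(\boldsymbol{\omega}^{(\mathrm{Var})})-\gamma)\stackrel{d}{\longrightarrow}\mathcal{N}\left(\frac{\boldsymbol{1}^\top\mathbf{V}_{\boldsymbol{c}}^{-1}\boldsymbol{B}_{\boldsymbol{c}}}{\boldsymbol{1}^\top\mathbf{V}_{\boldsymbol{c}}^{-1}\boldsymbol{1}},\frac{1}{\boldsymbol{1}^\top\mathbf{V}_{\boldsymbol{c}}^{-1}\boldsymbol{1}}\right).$$ 2. (AMSE-optimal weights) There is a unique solution to the minimization problem of $\mathrm{AMSE}(\boldsymbol{\omega})=(\boldsymbol{\omega}^\top\boldsymbol{B}_{\boldsymbol{c}})^2+\boldsymbol{\omega}^\top\mathbf{V}_{\boldsymbol{c}}\boldsymbol{\omega}$ subject to the constraint $\boldsymbol{\omega}^\top\boldsymbol{1}=1$, which is $$\boldsymbol{\omega}^{(\mathrm{AMSE})}=\frac{(1+\boldsymbol{B}_{\boldsymbol{c}}^\top\mathbf{V}_{\boldsymbol{c}}^{-1}\boldsymbol{B}_{\boldsymbol{c}})\mathbf{V}_{\boldsymbol{c}}^{-1}\boldsymbol{1}-(\boldsymbol{1}^\top\mathbf{V}_{\boldsymbol{c}}^{-1}\boldsymbol{B}_{\boldsymbol{c}})\mathbf{V}_{\boldsymbol{c}}^{-1}\boldsymbol{B}_{\boldsymbol{c}}}{(1+\boldsymbol{B}_{\boldsymbol{c}}^\top\mathbf{V}_{\boldsymbol{c}}^{-1}\boldsymbol{B}_{\boldsymbol{c}})(\boldsymbol{1}^\top\mathbf{V}_{\boldsymbol{c}}^{-1}\boldsymbol{1})-(\boldsymbol{1}^\top\mathbf{V}_{\boldsymbol{c}}^{-1}\boldsymbol{B}_{\boldsymbol{c}})^2}.$$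 The optimal value of $\mathrm{AMSE}(\boldsymbol{\omega})$ is $$\mathrm{AMSE}(\boldsymbol{\omega}^{(\mathrm{AMSE})})=\frac{1+\boldsymbol{B}_{\boldsymbol{c}}^\top\mathbf{V}_{\boldsymbol{c}}^{-1}\boldsymbol{B}_{\boldsymbol{c}}}{(1+\boldsymbol{B}_{\boldsymbol{c}}^\top\mathbf{V}_{\boldsymbol{c}}^{-1}\boldsymbol{B}_{\boldsymbol{c}})(\boldsymbol{1}^\top\mathbf{V}_{\boldsymbol{c}}^{-1}\boldsymbol{1})-(\boldsymbol{1}^\top\mathbf{V}_{\boldsymbol{c}}^{-1}\boldsymbol{B}_{\boldsymbol{c}})^2}.$$ Finally, if $\widehat{\boldsymbol{\omega}}_n^\top\boldsymbol{1}=1$ with $\widehat{\boldsymbol{\omega}}_n\stackrel{\mathbb{P}}{\longrightarrow}\boldsymbol{\omega}$, then the composite estimator $\widehat{\gamma}_n(\widehat{\boldsymbol{\omega}}_n)$ is $\sqrt{k}$-asymptotically equivalent to $\widehat{\gamma}_n(\boldsymbol{\omega})$ in the sense that $\sqrt{k}(\widehat{\gamma}_n(\widehat{\boldsymbol{\omega}}_n)-\widehat{\gamma}_n(\boldsymbol{\omega}))=\operatorname{o}_{\mathbb{P}}(1)$.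
   Context: Setting: $m$ is a fixed integer, $\boldsymbol{X}=(X_1,\ldots,X_m)^\top$ is a random vector and $\boldsymbol{X}_i=(X_{i,1},\ldots,X_{i,m})^\top$, $i\geq1$, are independent copies of $\boldsymbol{X}$. The data are the $X_{i,j}$ for $1\leq j\leq m$, $1\leq i\leq n_j=n_j(n)$, with $n=\sum_{j=1}^m n_j$ and $n_j\to\infty$ as $n\to\infty$. Each $X_j$ has a continuous distribution function $F_j$, $\overline{F}_j=1-F_j$, and tail quantile function $U_j(t)=\inf\{x\in\mathbb{R}:1/\overline{F}_j(x)\geq t\}$. Condition $\mathcal{C}_2(\boldsymbol{\gamma},\boldsymbol{\rho},\boldsymbol{A})$: for every $j$, condition $\mathcal{C}_2(\gamma_j,\rho_j,A_j)$ holds, i.e. $\gamma_j>0$, $\rho_j\leq0$, $A_j$ has constant sign and converges to $0$ at infinity, and for all $x>0$, $\lim_{t\to\infty}\frac{1}{A_j(t)}\left[\frac{U_j(tx)}{U_j(t)}-x^{\gamma_j}\right]=x^{\gamma_j}\frac{x^{\rho_j}-1}{\rho_j}$ (read as $x^{\gamma_j}\log x$ if $\rho_j=0$). Condition $\mathcal{J}(\boldsymbol{R})$: with $\overline{C}_{j,\ell}(u,v)=\mathbb{P}(\overline{F}_j(X_j)\leq u,\overline{F}_\ell(X_\ell)\leq v)$, for any $j\neq\ell$ there is a function $R_{j,\ell}$ on $[0,\infty]^2\setminus\{(\infty,\infty)\}$ such that $\lim_{s\to\infty}s\,\overline{C}_{j,\ell}(x_j/s,x_\ell/s)=R_{j,\ell}(x_j,x_\ell)$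 for all $(x_j,x_\ell)$ in this set. Estimators: $X_{1:n_j,j}\leq\cdots\leq X_{n_j:n_j,j}$ are the order statistics of the $j$th sample, and the Hill estimators are $\widehat{\gamma}_j(k_j)=k_j^{-1}\sum_{i=1}^{k_j}\log(X_{n_j-i+1:n_j,j}/X_{n_j-k_j:n_j,j})$ with $k_j\geq 1$ an integer. For $\boldsymbol{\omega}\in\mathbb{R}^m$, $\widehat{\gamma}_n(\boldsymbol{\omega})=\sum_{j=1}^m\omega_j\widehat{\gamma}_j(k_j)$; it is used as an estimator of the common value $\gamma$ when $\boldsymbol{\gamma}=\gamma\boldsymbol{1}$. $\boldsymbol{1}$ is the vector of ones in $\mathbb{R}^m$, and $\widehat{\boldsymbol{\omega}}_n$ denotes a possibly random weight vector. *)

theory Defs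
  imports "HOL-Probability.Probability"
begin

text \<open>The quotient is taken in the extended reals, so that it is infinite where the survival
  function vanishes.\<close>

definition tail_quantile :: "real measure \<Rightarrow> real \<Rightarrow> real" where
  "tail_quantile D t = Inf {x. 1 / ereal (1 - cdf D x) \<ge> ereal t}"

text \<open>Only the behaviour of the auxiliary function \<open>A\<close> at infinity matters, hence its
  constant sign is required on a neighbourhood of infinity.\<close>

definition second_order_cond :: "real measure \<Rightarrow> real \<Rightarrow> real \<Rightarrow> (real \<Rightarrow> real) \<Rightarrow> bool" where
  "second_order_cond D \<gamma> \<rho> A \<longleftrightarrow>
     \<gamma> > 0 \<and> \<rho> \<le> 0 \<and>
     ((\<forall>\<^sub>F t in at_top. A t > 0) \<or> (\<forall>\<^sub>F t in at_top. A t < 0)) \<and>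
     (A \<longlongrightarrow> 0) at_top \<and>
     (\<forall>x>0. ((\<lambda>t. (1 / A t) *
                 (tail_quantile D (t * x) / tail_quantile D t - x powr \<gamma>))
        \<longlongrightarrow> x powr \<gamma> * (if \<rho> = 0 then ln x else (x powr \<rho> - 1) / \<rho>)) at_top)"

definition margin :: "'a measure \<Rightarrow> ('a \<Rightarrow> real ^ 'm) \<Rightarrow> 'm \<Rightarrow> real measure" where
  "margin M X j = distr M borel (\<lambda>w. X w $ j)"

definition survival_copula ::
  "'a measure \<Rightarrow> ('a \<Rightarrow> real ^ 'm) \<Rightarrow> 'm \<Rightarrow> 'm \<Rightarrow> ennreal \<Rightarrow> ennreal \<Rightarrow> real" where
  "survival_copula M X j l u v =
     measure M {w \<in> space M. ennreal (1 - cdf (margin M X j) (X w $ j)) \<le> u \<and>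
                             ennreal (1 - cdf (margin M X l) (X w $ l)) \<le> v}"

definition tail_dependence_cond ::
  "'a measure \<Rightarrow> ('a \<Rightarrow> real ^ 'm) \<Rightarrow> ('m \<Rightarrow> 'm \<Rightarrow> ennreal \<Rightarrow> ennreal \<Rightarrow> real) \<Rightarrow> bool" where
  "tail_dependence_cond M X R \<longleftrightarrow>
     (\<forall>j l x y. j \<noteq> l \<longrightarrow> (x, y) \<noteq> (\<infinity>, \<infinity>) \<longrightarrow>
        ((\<lambda>s::real. s * survival_copula M X j l (x / ennreal s) (y / ennreal s))
           \<longlongrightarrow> R j l x y) at_top)"

text \<open>The \<open>i\<close>-th smallest among \<open>x 1, \<dots>, x n\<close>, for \<open>1 \<le> i \<le> n\<close>.\<close>

definition order_stat :: "(nat \<Rightarrow> real) \<Rightarrow> nat \<Rightarrow> nat \<Rightarrow> real" where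
  "order_stat x n i = sort (map x [1..<Suc n]) ! (i - 1)"

text \<open>Meaningful for \<open>1 \<le> k < n\<close>.\<close>

definition hill :: "(nat \<Rightarrow> real) \<Rightarrow> nat \<Rightarrow> nat \<Rightarrow> real" where
  "hill x n k =
     (1 / real k) * (\<Sum>i = 1..k. ln (order_stat x n (n - i + 1) / order_stat x n (n - k)))"

definition hill_vec ::
  "(nat \<Rightarrow> 'a \<Rightarrow> real ^ 'm) \<Rightarrow> ('m \<Rightarrow> nat) \<Rightarrow> ('m \<Rightarrow> nat) \<Rightarrow> 'a \<Rightarrow> real ^ 'm" where
  "hill_vec Xs N k w = (\<chi> j. hill (\<lambda>i. Xs i w $ j) (N j) (k j))"

definition pooled_hill ::
  "(nat \<Rightarrow> 'a \<Rightarrow> real ^ 'm) \<Rightarrow> ('m \<Rightarrow> nat) \<Rightarrow> ('m \<Rightarrow> nat) \<Rightarrow> real ^ 'm \<Rightarrow> 'a \<Rightarrow> real" where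
  "pooled_hill Xs N k \<omega> w = (\<Sum>j\<in>UNIV. \<omega> $ j * hill_vec Xs N k w $ j)"

text \<open>The normal law with mean \<open>\<mu>\<close> and variance \<open>v \<ge> 0\<close>, a point mass if \<open>v = 0\<close>.\<close>

definition normal_law :: "real \<Rightarrow> real \<Rightarrow> real measure" where
  "normal_law \<mu> v =
     (if v = 0 then return borel \<mu> else density lborel (normal_density \<mu> (sqrt v)))"

text \<open>\<open>N\<close> is the (possibly degenerate) multivariate normal law: every linear functional is
  univariate normal. This determines \<open>N\<close>, by the Cramer-Wold device.\<close>

definition is_multivariate_normal ::
  "(real ^ 'm) measure \<Rightarrow> real ^ 'm \<Rightarrow> real ^ 'm ^ 'm \<Rightarrow> bool" where
  "is_multivariate_normal N \<mu> S \<longleftrightarrow>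
     prob_space N \<and> sets N = sets borel \<and>
     transpose S = S \<and> (\<forall>a. a \<bullet> (S *v a) \<ge> 0) \<and>
     (\<forall>a. distr N borel (\<lambda>x. a \<bullet> x) = normal_law (a \<bullet> \<mu>) (a \<bullet> (S *v a)))"

definition weak_conv_vec :: "(nat \<Rightarrow> (real ^ 'm) measure) \<Rightarrow> (real ^ 'm) measure \<Rightarrow> bool" where
  "weak_conv_vec P Q \<longleftrightarrow>
     (\<forall>f::real ^ 'm \<Rightarrow> real. continuous_on UNIV f \<longrightarrow> bounded (range f) \<longrightarrow>
        (\<lambda>n. \<integral>x. f x \<partial>P n) \<longlonglongrightarrow> (\<integral>x. f x \<partial>Q))"

definition conv_in_prob ::
  "'a measure \<Rightarrow> (nat \<Rightarrow> 'a \<Rightarrow> 'b::metric_space) \<Rightarrow> 'b \<Rightarrow> bool" where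
  "conv_in_prob M Y y \<longleftrightarrow>
     (\<forall>\<epsilon>>0. (\<lambda>n. measure M {w \<in> space M. dist (Y n w) y > \<epsilon>}) \<longlonglongrightarrow> 0)"

definition pos_def_mat :: "real ^ 'm ^ 'm \<Rightarrow> bool" where
  "pos_def_mat S \<longleftrightarrow> transpose S = S \<and> (\<forall>x. x \<noteq> 0 \<longrightarrow> x \<bullet> (S *v x) > 0)"

definition bias_vec :: "real ^ 'm \<Rightarrow> real ^ 'm \<Rightarrow> real ^ 'm" where
  "bias_vec \<rho> lam = (\<chi> j. lam $ j / (1 - \<rho> $ j))"

text \<open>Below, \<open>p < q\<close> are the two indices in increasing order, so that the entries above the
  diagonal are copied to those below.\<close>

definition cov_mat ::
  "real ^ ('m::{finite,linorder})
   \<Rightarrow> real ^ ('m::{finite,linorder})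
   \<Rightarrow> real ^ ('m::{finite,linorder})
   \<Rightarrow> ('m \<Rightarrow> 'm \<Rightarrow> ennreal \<Rightarrow> ennreal \<Rightarrow> real)
   \<Rightarrow> real ^ ('m::{finite,linorder}) ^ ('m::{finite,linorder})" where
  "cov_mat \<gamma> b c R = (\<chi> j l.
     if j = l then (\<gamma> $ j)\<^sup>2
     else let p = min j l; q = max j l in
       \<gamma> $ p * \<gamma> $ q * sqrt (c $ p / c $ q) *
       R p q (ennreal (c $ q / c $ p)) (ennreal (b $ q / b $ p)))"

definition pooled_bias_vec :: "real ^ 'm \<Rightarrow> real ^ 'm \<Rightarrow> real ^ 'm \<Rightarrow> real ^ 'm" where
  "pooled_bias_vec \<rho> lam c =
     sqrt (\<Sum>i\<in>UNIV. inverse (c $ i)) *\<^sub>R (\<chi> j. sqrt (c $ j) * (lam $ j / (1 - \<rho> $ j)))"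

definition pooled_cov_mat ::
  "real
   \<Rightarrow> real ^ ('m::{finite,linorder})
   \<Rightarrow> real ^ ('m::{finite,linorder})
   \<Rightarrow> ('m \<Rightarrow> 'm \<Rightarrow> ennreal \<Rightarrow> ennreal \<Rightarrow> real)
   \<Rightarrow> real ^ ('m::{finite,linorder}) ^ ('m::{finite,linorder})" where
  "pooled_cov_mat g b c R = (\<chi> j l.
     (\<Sum>i\<in>UNIV. inverse (c $ i)) *
     (if j = l then g\<^sup>2 * c $ j
      else let p = min j l; q = max j l in
        g\<^sup>2 * c $ p * R p q (ennreal (c $ q / c $ p)) (ennreal (b $ q / b $ p))))"

definition var_weights :: "real ^ 'm ^ 'm \<Rightarrow> real ^ 'm" where
  "var_weights S = (matrix_inv S *v 1) /\<^sub>R (1 \<bullet> (matrix_inv S *v 1))"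

definition AMSE :: "real ^ 'm \<Rightarrow> real ^ 'm ^ 'm \<Rightarrow> real ^ 'm \<Rightarrow> real" where
  "AMSE B S \<omega> = (\<omega> \<bullet> B)\<^sup>2 + \<omega> \<bullet> (S *v \<omega>)"

definition amse_weights :: "real ^ 'm \<Rightarrow> real ^ 'm ^ 'm \<Rightarrow> real ^ 'm" where
  "amse_weights B S =
     ((1 + B \<bullet> (matrix_inv S *v B)) *\<^sub>R (matrix_inv S *v 1)
        - (1 \<bullet> (matrix_inv S *v B)) *\<^sub>R (matrix_inv S *v B))
     /\<^sub>R ((1 + B \<bullet> (matrix_inv S *v B)) * (1 \<bullet> (matrix_inv S *v 1))
          - (1 \<bullet> (matrix_inv S *v B))\<^sup>2)"

end

(* The transforms E_j = - ln (1 - F_j(X_j)) are standard exponential and X_j = U_j (exp E_j) almost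
   surely. At the level T = ln (n_j / k_j), the excesses over the random threshold of a Hill estimator
   may be replaced by those over T: the Bahadur expansion of the intermediate order statistic turns
   the difference into the centring of the sum of (E_j - T - 1) 1{E_j > T}. The second order condition
   enters through locally uniform convergence of extended regular variation and Potter-type bounds,
   and contributes the bias. What remains is a sum of independent vectors, one for each observation,
   to which Lyapunov's central limit theorem applies; its covariances converge because s times the
   joint tail probability converges to R, which is homogeneous. The Cramer-Wold device is obtained by
   approximating continuous functions on compact sets by trigonometric polynomials. *)

theory Submission
  imports Defs
begin

section \<open>Optimal weights\<close>

text \<open>Two features of the setting shape the argument. The second-order condition is pointwise
  in \<open>x\<close> and its auxiliary function \<open>A\<close> may be non-measurable, whereas
  random thresholds and integration ask for more. \<open>A\<close> is therefore traded for an
  equivalent measurable function, a normalised unit increment of the logarithmic remainder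
  \<open>G\<close>, and measurability then forces local uniformity, as for regularly varying
  functions. The thresholds are order statistics, so the sums in question are not sums of
  independent variables and their errors are small in probability only; a filter of events of high
  probability lets such errors obey the usual limit rules.

  The exponential scale is chosen for its lack of memory: excesses over a fixed level are again
  standard exponential, so that subtracting one centres them, and the factor
  \<open>1 / (1 - \<rho>)\<close> of the bias is the exponential mean of the second-order limit
  function. In the product of two centred excesses the mixed and one-sided moments cancel in the
  limit, and only the joint tail probability, hence \<open>R\<close>, survives in the
  covariances.\<close>

lemma pos_def_mat_invertible:
  fixes S :: "real ^ 'm ^ 'm"
  assumes "pos_def_mat S"
  shows "invertible S"
proof -
  have "x = 0" if "S *v x = 0" for x
    using assms that unfolding pos_def_mat_def by fastforce
  then show ?thesis
    by (simp add: invertible_left_inverse matrix_left_invertible_ker)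
qed

lemma pos_def_mat_inv_vec:
  assumes "pos_def_mat S"
  shows "S *v (matrix_inv S *v x) = x"
proof -
  have "S ** matrix_inv S = mat 1"
    using someI_ex[OF pos_def_mat_invertible[OF assms, unfolded invertible_def]]
    by (simp add: matrix_inv_def)
  then show ?thesis by (simp add: matrix_vector_mul_assoc)
qed

lemma symmetric_inner_mat:
  fixes S :: "real ^ 'm ^ 'm"
  assumes "transpose S = S"
  shows "x \<bullet> (S *v y) = y \<bullet> (S *v x)"
  by (metis assms dot_lmul_matrix inner_commute transpose_matrix_vector)

lemma pos_def_mat_inv_sym:
  assumes "pos_def_mat S"
  shows "x \<bullet> (matrix_inv S *v y) = y \<bullet> (matrix_inv S *v x)"
  using symmetric_inner_mat[of S "matrix_inv S *v x" "matrix_inv S *v y"] assms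
  by (simp add: pos_def_mat_inv_vec pos_def_mat_def inner_commute)

lemma pos_def_mat_inv_pos:
  assumes "pos_def_mat S" "x \<noteq> 0"
  shows "x \<bullet> (matrix_inv S *v x) > 0"
proof -
  have "matrix_inv S *v x \<noteq> 0"
    using pos_def_mat_inv_vec[OF assms(1), of x] assms(2) by auto
  then show ?thesis
    using assms(1) pos_def_mat_inv_vec[OF assms(1), of x]
    by (metis inner_commute pos_def_mat_def)
qed

text \<open>The equation \<open>S *v w0 = t *\<^sub>R 1\<close> is the Lagrange condition. It
  removes the cross term on the constraint plane, so that the form at \<open>w\<close> exceeds that
  at \<open>w0\<close> by the form at \<open>w - w0\<close>. Both kinds of optimal weights are
  instances.\<close>

lemma quadratic_arg_min_iff:
  fixes S :: "real ^ 'm ^ 'm"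
  assumes S: "pos_def_mat S" and w0: "w0 \<bullet> 1 = 1" and eq: "S *v w0 = t *\<^sub>R 1"
  shows "is_arg_min (\<lambda>w. w \<bullet> (S *v w)) (\<lambda>w. w \<bullet> 1 = 1) w \<longleftrightarrow> w = w0"
proof -
  have *: "w \<bullet> (S *v w) = w0 \<bullet> (S *v w0) + (w - w0) \<bullet> (S *v (w - w0))" if "w \<bullet> 1 = 1" for w
  proof -
    have "w0 \<bullet> (S *v w) = t"
      using symmetric_inner_mat[of S w0 w] S eq that by (simp add: pos_def_mat_def)
    moreover have "w \<bullet> (S *v w0) = t" "w0 \<bullet> (S *v w0) = t" using eq that w0 by auto
    ultimately show ?thesis
      by (simp add: matrix_vector_mult_diff_distrib inner_diff_left inner_diff_right)
  qed
  have pos: "(w - w0) \<bullet> (S *v (w - w0)) > 0" if "w \<noteq> w0" for w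
    using S that by (simp add: pos_def_mat_def)
  have "w0 \<bullet> (S *v w0) < w \<bullet> (S *v w)" if "w \<bullet> 1 = 1" "w \<noteq> w0" for w
    using *[OF that(1)] pos[OF that(2)] by linarith
  then show ?thesis
    using w0 unfolding is_arg_min_def by (metis less_asym)
qed

lemma vec_one_neq_0: "(1 :: real ^ 'm) \<noteq> 0"
  by (simp add: vec_eq_iff)

lemma
  fixes S :: "real ^ 'm ^ 'm"
  assumes S: "pos_def_mat S"
  shows var_weights_sum: "var_weights S \<bullet> 1 = 1"
    and var_weights_arg_min:
      "is_arg_min (\<lambda>w. w \<bullet> (S *v w)) (\<lambda>w. w \<bullet> 1 = 1) w \<longleftrightarrow> w = var_weights S"
    and var_weights_inner: "var_weights S \<bullet> u = (1 \<bullet> (matrix_inv S *v u)) / (1 \<bullet> (matrix_inv S *v 1))"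
    and var_weights_variance:
      "var_weights S \<bullet> (S *v var_weights S) = 1 / (1 \<bullet> (matrix_inv S *v 1))"
proof -
  let ?p = "1 \<bullet> (matrix_inv S *v (1 :: real ^ 'm))"
  have p: "?p > 0" by (rule pos_def_mat_inv_pos[OF S vec_one_neq_0])
  show inner: "var_weights S \<bullet> u = (1 \<bullet> (matrix_inv S *v u)) / ?p" for u
    using pos_def_mat_inv_sym[OF S, of u 1]
    by (simp add: var_weights_def inner_commute divide_inverse_commute)
  show sum: "var_weights S \<bullet> 1 = 1" using p by (simp add: inner)
  have eq: "S *v var_weights S = (1 / ?p) *\<^sub>R 1"
    by (simp add: var_weights_def matrix_vector_mult_scaleR pos_def_mat_inv_vec[OF S]
        inverse_eq_divide)
  show "is_arg_min (\<lambda>w. w \<bullet> (S *v w)) (\<lambda>w. w \<bullet> 1 = 1) w \<longleftrightarrow> w = var_weights S"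
    by (rule quadratic_arg_min_iff[OF S sum eq])
  show "var_weights S \<bullet> (S *v var_weights S) = 1 / ?p"
    by (simp add: eq sum)
qed

text \<open>The AMSE is itself the quadratic form of a rank-one update \<open>T\<close> of
  \<open>S\<close> by \<open>B\<close>, so the same criterion applies. The stated weights are the
  Sherman-Morrison inverse of \<open>T\<close> applied to \<open>1\<close>, normalised; it is enough
  to check the Lagrange condition for them.\<close>

lemma
  fixes S :: "real ^ 'm ^ 'm" and B :: "real ^ 'm"
  assumes S: "pos_def_mat S"
  shows amse_weights_arg_min:
      "is_arg_min (AMSE B S) (\<lambda>w. w \<bullet> 1 = 1) w \<longleftrightarrow> w = amse_weights B S"
    and AMSE_amse_weights: "AMSE B S (amse_weights B S) =
      (1 + B \<bullet> (matrix_inv S *v B)) /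
      ((1 + B \<bullet> (matrix_inv S *v B)) * (1 \<bullet> (matrix_inv S *v 1)) - (1 \<bullet> (matrix_inv S *v B))\<^sup>2)"
proof -
  define T where "T = (\<chi> i j. S $ i $ j + B $ i * B $ j)"
  have T_vec: "T *v w = S *v w + (B \<bullet> w) *\<^sub>R B" for w
    by (simp add: T_def vec_eq_iff matrix_vector_mult_def inner_vec_def algebra_simps
        sum.distrib sum_distrib_left)
  have AMSE_eq: "AMSE B S = (\<lambda>w. w \<bullet> (T *v w))"
    by (simp add: fun_eq_iff AMSE_def T_vec inner_add_right inner_commute power2_eq_square)
  have T: "pos_def_mat T"
    unfolding pos_def_mat_def
  proof safe
    show "transpose T = T"
      using S by (simp add: T_def pos_def_mat_def transpose_def vec_eq_iff mult.commute)
    fix x :: "real ^ 'm" assume "x \<noteq> 0"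
    then have "x \<bullet> (S *v x) > 0" using S by (simp add: pos_def_mat_def)
    moreover have "(x \<bullet> B)\<^sup>2 \<ge> 0" by simp
    moreover have "x \<bullet> (T *v x) = x \<bullet> (S *v x) + (x \<bullet> B)\<^sup>2"
      by (simp add: T_vec inner_add_right inner_commute power2_eq_square)
    ultimately show "0 < x \<bullet> (T *v x)" by linarith
  qed
  define Iv where "Iv = (\<lambda>x. matrix_inv S *v x)"
  define p q r where "p = 1 \<bullet> Iv 1" and "q = 1 \<bullet> Iv B" and "r = B \<bullet> Iv B"
  define D where "D = (1 + r) * p - q\<^sup>2"
  have Iv_sym: "x \<bullet> Iv y = y \<bullet> Iv x" for x y
    unfolding Iv_def by (rule pos_def_mat_inv_sym[OF S])
  have S_Iv: "S *v Iv x = x" for x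
    unfolding Iv_def by (rule pos_def_mat_inv_vec[OF S])
  have p: "p > 0" unfolding p_def Iv_def by (rule pos_def_mat_inv_pos[OF S vec_one_neq_0])
  have Iv_nn: "x \<bullet> Iv x \<ge> 0" for x
    using pos_def_mat_inv_pos[OF S, of x] by (cases "x = 0") (auto simp: Iv_def)
  \<comment> \<open>Cauchy-Schwarz for the inner product of the inverse,
    \<open>q\<^sup>2 \<le> p * r\<close>, read off at the vector that makes the discriminant appear.
    It gives \<open>D \<ge> p > 0\<close>.\<close>
  have "(p *\<^sub>R B - q *\<^sub>R 1) \<bullet> Iv (p *\<^sub>R B - q *\<^sub>R 1) = p * (p * r - q\<^sup>2)"
  proof -
    have "Iv (p *\<^sub>R B - q *\<^sub>R 1) = p *\<^sub>R Iv B - q *\<^sub>R Iv 1"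
      by (simp add: Iv_def matrix_vector_mult_diff_distrib matrix_vector_mult_scaleR)
    moreover have "B \<bullet> Iv 1 = q" using Iv_sym[of B 1] by (simp add: q_def)
    ultimately show ?thesis
      by (simp only:) (simp add: inner_diff_left inner_diff_right p_def[symmetric] q_def[symmetric]
          r_def[symmetric] power2_eq_square algebra_simps)
  qed
  with Iv_nn[of "p *\<^sub>R B - q *\<^sub>R 1"] p have "p * r - q\<^sup>2 \<ge> 0"
    by (simp add: zero_le_mult_iff)
  with p have D: "D > 0" by (simp add: D_def algebra_simps)
  have w: "amse_weights B S = ((1 + r) *\<^sub>R Iv 1 - q *\<^sub>R Iv B) /\<^sub>R D"
    by (simp add: amse_weights_def p_def q_def r_def D_def Iv_def)
  have B1: "B \<bullet> Iv 1 = q" using Iv_sym[of B 1] by (simp add: q_def)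
  have Bw: "B \<bullet> amse_weights B S = q / D"
    by (simp add: w inner_diff_right B1 r_def[symmetric]) (simp add: algebra_simps divide_inverse_commute)
  have sum: "amse_weights B S \<bullet> 1 = 1"
  proof -
    have "1 \<bullet> amse_weights B S = ((1 + r) * p - q * q) / D"
      by (simp add: w inner_diff_right p_def[symmetric] q_def[symmetric] divide_inverse_commute)
    then show ?thesis using D by (simp add: D_def power2_eq_square inner_commute)
  qed
  have eq: "T *v amse_weights B S = ((1 + r) / D) *\<^sub>R 1"
  proof -
    have "S *v amse_weights B S = ((1 + r) *\<^sub>R 1 - q *\<^sub>R B) /\<^sub>R D"
      by (simp add: w matrix_vector_mult_diff_distrib matrix_vector_mult_scaleR S_Iv)
    then show ?thesis
      unfolding T_vec Bw by (simp add: scaleR_diff_right divide_inverse_commute mult.commute)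
  qed
  show "is_arg_min (AMSE B S) (\<lambda>w. w \<bullet> 1 = 1) w \<longleftrightarrow> w = amse_weights B S"
    unfolding AMSE_eq by (rule quadratic_arg_min_iff[OF T sum eq])
  have "AMSE B S (amse_weights B S) = (1 + r) / D"
    by (simp add: AMSE_eq eq sum)
  then show "AMSE B S (amse_weights B S) =
      (1 + B \<bullet> (matrix_inv S *v B)) /
      ((1 + B \<bullet> (matrix_inv S *v B)) * (1 \<bullet> (matrix_inv S *v 1)) - (1 \<bullet> (matrix_inv S *v B))\<^sup>2)"
    by (simp add: D_def p_def q_def r_def Iv_def)
qed

text \<open>\<open>T\<close> is congruent to \<open>S\<close> by the diagonal matrix of
  \<open>d\<close>. The pooled covariance matrix arises in this way from that of the individual
  estimators, because the rate of each one is changed from its own \<open>k\<close> to the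
  total.\<close>

lemma quadratic_form_rescale:
  fixes S T :: "real ^ 'm ^ 'm"
  assumes "\<And>i j. T $ i $ j = d $ i * d $ j * S $ i $ j"
  shows "x \<bullet> (T *v x) = (\<chi> i. d $ i * x $ i) \<bullet> (S *v (\<chi> i. d $ i * x $ i))"
  by (simp add: assms inner_vec_def matrix_vector_mult_def sum_distrib_left ac_simps)

lemma pos_def_mat_rescale:
  fixes S T :: "real ^ 'm ^ 'm"
  assumes T: "\<And>i j. T $ i $ j = d $ i * d $ j * S $ i $ j" and d: "\<And>i. d $ i > 0"
    and S: "pos_def_mat S"
  shows "pos_def_mat T"
  unfolding pos_def_mat_def
proof safe
  have "S $ i $ j = S $ j $ i" for i j
    using S by (metis (no_types) pos_def_mat_def transpose_def vec_lambda_beta)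
  then show "transpose T = T"
    by (simp add: transpose_def vec_eq_iff T)
  fix x :: "real ^ 'm" assume "x \<noteq> 0"
  then have "(\<chi> i. d $ i * x $ i) \<noteq> 0"
    using d by (auto simp: vec_eq_iff less_le)
  then show "0 < x \<bullet> (T *v x)"
    using S unfolding quadratic_form_rescale[OF T] pos_def_mat_def by blast
qed

lemma pos_def_mat_rescale_iff:
  fixes S T :: "real ^ 'm ^ 'm"
  assumes T: "\<And>i j. T $ i $ j = d $ i * d $ j * S $ i $ j" and d: "\<And>i. d $ i > 0"
  shows "pos_def_mat S \<longleftrightarrow> pos_def_mat T"
proof
  assume "pos_def_mat T"
  moreover have "S $ i $ j = (\<chi> i. inverse (d $ i)) $ i * (\<chi> i. inverse (d $ i)) $ j * T $ i $ j" for i j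
    using d[of i] d[of j] by (simp add: T field_simps)
  ultimately show "pos_def_mat S"
    using d by (intro pos_def_mat_rescale[of S "\<chi> i. inverse (d $ i)" T]) auto
qed (rule pos_def_mat_rescale[OF T d])

section \<open>Convergence with high probability\<close>

text \<open>A filter encoding of stochastic o-symbols: convergence in probability becomes an
  ordinary limit along \<open>whp\<close>, and the limit calculus applies to random remainders.
  Measurability is asked of the exceptional events, so that properties quantifying over a whole
  sample can be used freely.\<close>

definition whp :: "'a measure \<Rightarrow> (nat \<times> 'a) filter" where
  "whp M = Abs_filter (\<lambda>P. \<forall>\<eta>>0. \<exists>A. (\<forall>n. A n \<in> sets M) \<and>
     (\<forall>\<^sub>F n in sequentially. measure M (A n) \<le> \<eta> \<and> (\<forall>w\<in>space M - A n. P (n, w))))"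

text \<open>Boundedness in probability, phrased with exceptional events so that it combines directly
  with \<open>whp\<close>.\<close>

definition tight_seq :: "'a measure \<Rightarrow> (nat \<Rightarrow> 'a \<Rightarrow> real) \<Rightarrow> bool" where
  "tight_seq M Z \<longleftrightarrow> (\<forall>\<eta>>0. \<exists>K A. (\<forall>n. A n \<in> sets M) \<and>
     (\<forall>\<^sub>F n in sequentially. measure M (A n) \<le> \<eta> \<and> (\<forall>w\<in>space M - A n. \<bar>Z n w\<bar> \<le> K)))"

lemma (in prob_space) eventually_whp:
  "eventually P (whp M) \<longleftrightarrow> (\<forall>\<eta>>0. \<exists>A. (\<forall>n. A n \<in> events) \<and>
     (\<forall>\<^sub>F n in sequentially. prob (A n) \<le> \<eta> \<and> (\<forall>w\<in>space M - A n. P (n, w))))"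
  unfolding whp_def
proof (rule eventually_Abs_filter, rule is_filter.intro)
  show "\<forall>\<eta>>0. \<exists>A. (\<forall>n. A n \<in> events) \<and>
     (\<forall>\<^sub>F n in sequentially. prob (A n) \<le> \<eta> \<and> (\<forall>w\<in>space M - A n. True))"
    by (auto intro!: exI[of _ "\<lambda>_. {}"])
next
  fix P Q :: "nat \<times> 'a \<Rightarrow> bool"
  assume P: "\<forall>\<eta>>0. \<exists>A. (\<forall>n. A n \<in> events) \<and>
     (\<forall>\<^sub>F n in sequentially. prob (A n) \<le> \<eta> \<and> (\<forall>w\<in>space M - A n. P (n, w)))"
    and Q: "\<forall>\<eta>>0. \<exists>A. (\<forall>n. A n \<in> events) \<and>
     (\<forall>\<^sub>F n in sequentially. prob (A n) \<le> \<eta> \<and> (\<forall>w\<in>space M - A n. Q (n, w)))"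
  show "\<forall>\<eta>>0. \<exists>A. (\<forall>n. A n \<in> events) \<and>
     (\<forall>\<^sub>F n in sequentially. prob (A n) \<le> \<eta> \<and> (\<forall>w\<in>space M - A n. P (n, w) \<and> Q (n, w)))"
  proof safe
    fix \<eta> :: real assume "\<eta> > 0"
    then have "\<eta> / 2 > 0" by simp
    from P[rule_format, OF this] Q[rule_format, OF this] obtain A A' where A: "\<forall>n. A n \<in> events" "\<forall>n. A' n \<in> events"
      "\<forall>\<^sub>F n in sequentially. prob (A n) \<le> \<eta> / 2 \<and> (\<forall>w\<in>space M - A n. P (n, w))"
      "\<forall>\<^sub>F n in sequentially. prob (A' n) \<le> \<eta> / 2 \<and> (\<forall>w\<in>space M - A' n. Q (n, w))"
      by blast
    show "\<exists>A. (\<forall>n. A n \<in> events) \<and>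
     (\<forall>\<^sub>F n in sequentially. prob (A n) \<le> \<eta> \<and> (\<forall>w\<in>space M - A n. P (n, w) \<and> Q (n, w)))"
    proof (intro exI conjI allI)
      show "A n \<union> A' n \<in> events" for n using A by auto
      show "\<forall>\<^sub>F n in sequentially. prob (A n \<union> A' n) \<le> \<eta> \<and>
          (\<forall>w\<in>space M - (A n \<union> A' n). P (n, w) \<and> Q (n, w))"
        using A(3,4)
      proof eventually_elim
        case (elim n)
        have "prob (A n \<union> A' n) \<le> prob (A n) + prob (A' n)"
          using A by (intro measure_Un_le) auto
        with elim show ?case by auto
      qed
    qed
  qed
next
  fix P Q :: "nat \<times> 'a \<Rightarrow> bool"
  assume PQ: "\<forall>x. P x \<longrightarrow> Q x"
    and P: "\<forall>\<eta>>0. \<exists>A. (\<forall>n. A n \<in> events) \<and>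
     (\<forall>\<^sub>F n in sequentially. prob (A n) \<le> \<eta> \<and> (\<forall>w\<in>space M - A n. P (n, w)))"
  show "\<forall>\<eta>>0. \<exists>A. (\<forall>n. A n \<in> events) \<and>
     (\<forall>\<^sub>F n in sequentially. prob (A n) \<le> \<eta> \<and> (\<forall>w\<in>space M - A n. Q (n, w)))"
  proof (intro allI impI)
    fix \<eta> :: real assume "\<eta> > 0"
    with P obtain A where "\<forall>n. A n \<in> events"
      "\<forall>\<^sub>F n in sequentially. prob (A n) \<le> \<eta> \<and> (\<forall>w\<in>space M - A n. P (n, w))" by blast
    with PQ show "\<exists>A. (\<forall>n. A n \<in> events) \<and>
     (\<forall>\<^sub>F n in sequentially. prob (A n) \<le> \<eta> \<and> (\<forall>w\<in>space M - A n. Q (n, w)))"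
      by (intro exI[of _ A]) (auto elim!: eventually_mono)
  qed
qed

context prob_space
begin

lemma eventually_whp_deterministic:
  assumes "\<forall>\<^sub>F n in sequentially. P n"
  shows "\<forall>\<^sub>F p in whp M. P (fst p)"
  unfolding eventually_whp using assms by (auto intro!: exI[of _ "\<lambda>_. {}"])

lemma filterlim_fst_whp: "filterlim fst sequentially (whp M)"
  unfolding filterlim_iff using eventually_whp_deterministic by blast

lemma tendsto_whp_deterministic:
  "(d \<longlongrightarrow> L) sequentially \<Longrightarrow> ((\<lambda>p. d (fst p)) \<longlongrightarrow> L) (whp M)"
  by (rule filterlim_compose[OF _ filterlim_fst_whp])

lemma eventually_whp_AE:
  assumes "\<And>n. AE w in M. P n w"
  shows "\<forall>\<^sub>F p in whp M. P (fst p) (snd p)"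
  unfolding eventually_whp
proof safe
  fix \<eta> :: real assume "\<eta> > 0"
  have "\<exists>N. N \<in> events \<and> prob N = 0 \<and> (\<forall>w\<in>space M - N. P n w)" for n
  proof -
    from AE_E[OF assms[of n]] obtain N where
      "{w \<in> space M. \<not> P n w} \<subseteq> N" "emeasure M N = 0" "N \<in> events" by blast
    then show ?thesis by (intro exI[of _ N]) (auto simp: measure_def)
  qed
  then obtain N where "\<And>n. N n \<in> events \<and> prob (N n) = 0 \<and> (\<forall>w\<in>space M - N n. P n w)" by metis
  then show "\<exists>A. (\<forall>n. A n \<in> events) \<and> (\<forall>\<^sub>F n in sequentially. prob (A n) \<le> \<eta> \<and>
      (\<forall>w\<in>space M - A n. P (fst (n, w)) (snd (n, w))))"
    using \<open>\<eta> > 0\<close> by (intro exI[of _ N]) auto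
qed

lemma eventually_whpI:
  assumes "\<And>n. {w \<in> space M. \<not> P n w} \<in> events"
    and "(\<lambda>n. prob {w \<in> space M. \<not> P n w}) \<longlonglongrightarrow> 0"
  shows "\<forall>\<^sub>F p in whp M. P (fst p) (snd p)"
  unfolding eventually_whp
proof safe
  fix \<eta> :: real assume "\<eta> > 0"
  have "\<forall>\<^sub>F n in sequentially. prob {w \<in> space M. \<not> P n w} < \<eta>"
    by (rule order_tendstoD(2)[OF assms(2) \<open>\<eta> > 0\<close>])
  then show "\<exists>A. (\<forall>n. A n \<in> events) \<and> (\<forall>\<^sub>F n in sequentially. prob (A n) \<le> \<eta> \<and>
      (\<forall>w\<in>space M - A n. P (fst (n, w)) (snd (n, w))))"
    using assms(1) by (intro exI[of _ "\<lambda>n. {w \<in> space M. \<not> P n w}"]) (auto elim: eventually_mono)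
qed

lemma whp_prob_tendsto_0:
  assumes "\<forall>\<^sub>F p in whp M. P (fst p) (snd p)"
  shows "(\<lambda>n. prob {w \<in> space M. \<not> P n w}) \<longlonglongrightarrow> 0"
proof (rule tendstoI)
  fix e :: real assume "e > 0"
  then have "e / 2 > 0" by simp
  from assms[unfolded eventually_whp, rule_format, OF this] obtain A where A: "\<And>n. A n \<in> events"
    "\<forall>\<^sub>F n in sequentially. prob (A n) \<le> e / 2 \<and> (\<forall>w\<in>space M - A n. P n w)"
    unfolding fst_conv snd_conv by blast
  show "\<forall>\<^sub>F n in sequentially. dist (prob {w \<in> space M. \<not> P n w}) 0 < e"
    using A(2)
  proof eventually_elim
    case (elim n)
    then have "prob {w \<in> space M. \<not> P n w} \<le> prob (A n)"
      using A(1) by (intro finite_measure_mono) auto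
    with elim \<open>e > 0\<close> show ?case by simp
  qed
qed

lemma conv_in_prob_iff_whp:
  fixes Y :: "nat \<Rightarrow> 'a \<Rightarrow> 'b :: {second_countable_topology, metric_space}"
  assumes [measurable]: "\<And>n. Y n \<in> borel_measurable M"
  shows "conv_in_prob M Y y \<longleftrightarrow> ((\<lambda>p. Y (fst p) (snd p)) \<longlongrightarrow> y) (whp M)"
proof
  assume Y: "conv_in_prob M Y y"
  show "((\<lambda>p. Y (fst p) (snd p)) \<longlongrightarrow> y) (whp M)"
  proof (rule tendstoI)
    fix e :: real assume "e > 0"
    then have "e / 2 > 0" by simp
    have "\<forall>\<^sub>F p in whp M. \<not> dist (Y (fst p) (snd p)) y > e / 2"
    proof (rule eventually_whpI)
      show "(\<lambda>n. prob {w \<in> space M. \<not> \<not> e / 2 < dist (Y n w) y}) \<longlonglongrightarrow> 0"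
        unfolding not_not using Y \<open>e / 2 > 0\<close> unfolding conv_in_prob_def by blast
    qed auto
    then show "\<forall>\<^sub>F p in whp M. dist (Y (fst p) (snd p)) y < e"
      by eventually_elim (use \<open>e > 0\<close> in simp)
  qed
next
  assume Y: "((\<lambda>p. Y (fst p) (snd p)) \<longlongrightarrow> y) (whp M)"
  show "conv_in_prob M Y y"
    unfolding conv_in_prob_def
  proof safe
    fix e :: real assume "e > 0"
    from tendstoD[OF Y this] have "\<forall>\<^sub>F p in whp M. \<not> dist (Y (fst p) (snd p)) y > e"
      by eventually_elim simp
    from whp_prob_tendsto_0[OF this] show "(\<lambda>n. prob {w \<in> space M. dist (Y n w) y > e}) \<longlonglongrightarrow> 0"
      by simp
  qed
qed

lemma prob_abs_gt_le:
  assumes [measurable]: "Z \<in> borel_measurable M" and "integrable M (\<lambda>w. (Z w)\<^sup>2)" and "K > 0"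
  shows "prob {w \<in> space M. K < \<bar>Z w\<bar>} \<le> expectation (\<lambda>w. (Z w)\<^sup>2) / K\<^sup>2"
proof -
  have "prob {w \<in> space M. K < \<bar>Z w\<bar>} \<le> prob {w \<in> space M. (Z w)\<^sup>2 \<ge> K\<^sup>2}"
    using \<open>K > 0\<close> by (intro finite_measure_mono) (auto simp: abs_le_square_iff[symmetric])
  also have "\<dots> \<le> expectation (\<lambda>w. (Z w)\<^sup>2) / K\<^sup>2"
    using assms by (intro integral_Markov_inequality_measure[where A = "{}"]) auto
  finally show ?thesis .
qed

text \<open>Chebyshev's inequality. Integrability concerns large \<open>n\<close> only, since the
  moment formulas for exceedances hold once the threshold is positive.\<close>

lemma tendsto_whp_L2:
  fixes Z :: "nat \<Rightarrow> 'a \<Rightarrow> real"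
  assumes [measurable]: "\<And>n. Z n \<in> borel_measurable M" and int: "\<forall>\<^sub>F n in sequentially. integrable M (\<lambda>w. (Z n w)\<^sup>2)"
    and lim: "(\<lambda>n. expectation (\<lambda>w. (Z n w)\<^sup>2)) \<longlonglongrightarrow> 0"
  shows "((\<lambda>p. Z (fst p) (snd p)) \<longlongrightarrow> 0) (whp M)"
proof -
  have "conv_in_prob M Z 0"
    unfolding conv_in_prob_def
  proof safe
    fix e :: real assume "e > 0"
    have lim0: "(\<lambda>n. expectation (\<lambda>w. (Z n w)\<^sup>2) / e\<^sup>2) \<longlonglongrightarrow> 0"
      using tendsto_divide[OF lim tendsto_const, of "e\<^sup>2"] \<open>e > 0\<close> by simp
    show "(\<lambda>n. prob {w \<in> space M. dist (Z n w) 0 > e}) \<longlonglongrightarrow> 0"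
      by (rule Lim_null_comparison[OF eventually_mono[OF int] lim0])
         (use prob_abs_gt_le[OF _ _ \<open>e > 0\<close>] in auto)
  qed
  then show ?thesis by (subst (asm) conv_in_prob_iff_whp) auto
qed

lemma tight_seqI_L2:
  assumes [measurable]: "\<And>n. Z n \<in> borel_measurable M"
    and int: "\<forall>\<^sub>F n in sequentially. integrable M (\<lambda>w. (Z n w)\<^sup>2) \<and> expectation (\<lambda>w. (Z n w)\<^sup>2) \<le> C"
  shows "tight_seq M Z"
  unfolding tight_seq_def
proof safe
  fix \<eta> :: real assume "\<eta> > 0"
  \<comment> \<open>Chosen so that \<open>C / K\<^sup>2 \<le> \<eta>\<close>; the absolute value and
    the added one keep \<open>K\<close> positive whatever the sign of \<open>C\<close>.\<close>
  define K where "K = sqrt ((\<bar>C\<bar> + 1) / \<eta>)"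
  have K: "K > 0" "C / K\<^sup>2 \<le> \<eta>"
  proof -
    show "K > 0" using \<open>\<eta> > 0\<close> by (simp add: K_def add_nonneg_pos)
    have "C * \<eta> \<le> (\<bar>C\<bar> + 1) * \<eta>" using \<open>\<eta> > 0\<close> by (intro mult_right_mono) auto
    moreover have "K\<^sup>2 = (\<bar>C\<bar> + 1) / \<eta>" using \<open>\<eta> > 0\<close> by (simp add: K_def)
    ultimately show "C / K\<^sup>2 \<le> \<eta>" by (simp add: divide_le_eq mult.commute)
  qed
  have "\<forall>\<^sub>F n in sequentially. prob {w \<in> space M. K < \<bar>Z n w\<bar>} \<le> \<eta>"
    using int
  proof eventually_elim
    case (elim n)
    then have "prob {w \<in> space M. K < \<bar>Z n w\<bar>} \<le> expectation (\<lambda>w. (Z n w)\<^sup>2) / K\<^sup>2"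
      using prob_abs_gt_le[of "Z n" K] K(1) by simp
    also have "\<dots> \<le> C / K\<^sup>2" using elim by (intro divide_right_mono) auto
    finally show ?case using K(2) by simp
  qed
  then show "\<exists>K A. (\<forall>n. A n \<in> events) \<and>
     (\<forall>\<^sub>F n in sequentially. prob (A n) \<le> \<eta> \<and> (\<forall>w\<in>space M - A n. \<bar>Z n w\<bar> \<le> K))"
    by (intro exI[of _ K] exI[of _ "\<lambda>n. {w \<in> space M. K < \<bar>Z n w\<bar>}"]) (auto elim: eventually_mono)
qed

text \<open>Localisation: \<open>K\<close> is fixed before the exceptional events of
  \<open>P\<close> are chosen, so \<open>P\<close> may be proved by arguments whose size depends on
  \<open>K\<close>, such as a finite grid covering the interval from \<open>-K\<close> to
  \<open>K\<close>.\<close>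

lemma eventually_whp_tight:
  assumes Z: "tight_seq M Z"
    and P: "\<And>K. \<forall>\<^sub>F p in whp M. \<bar>Z (fst p) (snd p)\<bar> \<le> K \<longrightarrow> P p"
  shows "\<forall>\<^sub>F p in whp M. P p"
  unfolding eventually_whp
proof safe
  fix \<eta> :: real assume "\<eta> > 0"
  then have \<eta>: "\<eta> / 2 > 0" by simp
  from Z \<eta> obtain K A where A: "\<And>n. A n \<in> events"
    "\<forall>\<^sub>F n in sequentially. prob (A n) \<le> \<eta> / 2 \<and> (\<forall>w\<in>space M - A n. \<bar>Z n w\<bar> \<le> K)"
    unfolding tight_seq_def by blast
  from P[of K] \<eta> obtain A' where A': "\<And>n. A' n \<in> events"
    "\<forall>\<^sub>F n in sequentially. prob (A' n) \<le> \<eta> / 2 \<and> (\<forall>w\<in>space M - A' n. \<bar>Z n w\<bar> \<le> K \<longrightarrow> P (n, w))"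
    unfolding eventually_whp fst_conv snd_conv by blast
  show "\<exists>A. (\<forall>n. A n \<in> events) \<and>
     (\<forall>\<^sub>F n in sequentially. prob (A n) \<le> \<eta> \<and> (\<forall>w\<in>space M - A n. P (n, w)))"
  proof (intro exI conjI allI)
    show "A n \<union> A' n \<in> events" for n using A A' by auto
    show "\<forall>\<^sub>F n in sequentially. prob (A n \<union> A' n) \<le> \<eta> \<and> (\<forall>w\<in>space M - (A n \<union> A' n). P (n, w))"
      using A(2) A'(2)
    proof eventually_elim
      case (elim n)
      have "prob (A n \<union> A' n) \<le> prob (A n) + prob (A' n)"
        using A A' by (intro measure_Un_le) auto
      with elim show ?case by auto
    qed
  qed
qed

lemma tendsto_whp_0_mult_tight:
  assumes Z: "tight_seq M Z" and Y: "((\<lambda>p. Y (fst p) (snd p)) \<longlongrightarrow> 0) (whp M)"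
  shows "((\<lambda>p. Y (fst p) (snd p) * Z (fst p) (snd p)) \<longlongrightarrow> (0::real)) (whp M)"
proof (rule tendstoI)
  fix e :: real assume "e > 0"
  show "\<forall>\<^sub>F p in whp M. dist (Y (fst p) (snd p) * Z (fst p) (snd p)) 0 < e"
  proof (rule eventually_whp_tight[OF Z])
    fix K
    have "e / (\<bar>K\<bar> + 1) > 0" using \<open>e > 0\<close> by simp
    from tendstoD[OF Y this]
    show "\<forall>\<^sub>F p in whp M. \<bar>Z (fst p) (snd p)\<bar> \<le> K \<longrightarrow> dist (Y (fst p) (snd p) * Z (fst p) (snd p)) 0 < e"
    proof eventually_elim
      case (elim p)
      show ?case
      proof
        assume "\<bar>Z (fst p) (snd p)\<bar> \<le> K"
        then have "\<bar>Y (fst p) (snd p)\<bar> * \<bar>Z (fst p) (snd p)\<bar> \<le> \<bar>Y (fst p) (snd p)\<bar> * (\<bar>K\<bar> + 1)"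
          by (intro mult_left_mono) auto
        also have "\<dots> < e" using elim by (simp add: field_simps)
        finally show "dist (Y (fst p) (snd p) * Z (fst p) (snd p)) 0 < e" by (simp add: abs_mult)
      qed
    qed
  qed
qed

lemma tight_seq_add_tendsto:
  assumes Z: "tight_seq M Z" and lim: "((\<lambda>p. Y (fst p) (snd p) - Z (fst p) (snd p)) \<longlongrightarrow> L) (whp M)"
  shows "tight_seq M Y"
  unfolding tight_seq_def
proof safe
  fix \<eta> :: real assume "\<eta> > 0"
  then have \<eta>: "\<eta> / 2 > 0" by simp
  from Z \<eta> obtain K A where A: "\<And>n. A n \<in> events"
    "\<forall>\<^sub>F n in sequentially. prob (A n) \<le> \<eta> / 2 \<and> (\<forall>w\<in>space M - A n. \<bar>Z n w\<bar> \<le> K)"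
    unfolding tight_seq_def by blast
  from tendstoD[OF lim zero_less_one] \<eta> obtain A' where A': "\<And>n. A' n \<in> events"
    "\<forall>\<^sub>F n in sequentially. prob (A' n) \<le> \<eta> / 2 \<and> (\<forall>w\<in>space M - A' n. dist (Y n w - Z n w) L < 1)"
    unfolding eventually_whp fst_conv snd_conv by blast
  show "\<exists>K A. (\<forall>n. A n \<in> events) \<and>
     (\<forall>\<^sub>F n in sequentially. prob (A n) \<le> \<eta> \<and> (\<forall>w\<in>space M - A n. \<bar>Y n w\<bar> \<le> K))"
  proof (intro exI conjI allI)
    show "A n \<union> A' n \<in> events" for n using A A' by auto
    show "\<forall>\<^sub>F n in sequentially. prob (A n \<union> A' n) \<le> \<eta> \<and>
        (\<forall>w\<in>space M - (A n \<union> A' n). \<bar>Y n w\<bar> \<le> K + \<bar>L\<bar> + 1)"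
      using A(2) A'(2)
    proof eventually_elim
      case (elim n)
      have "prob (A n \<union> A' n) \<le> prob (A n) + prob (A' n)"
        using A A' by (intro measure_Un_le) auto
      moreover have "\<bar>Y n w\<bar> \<le> K + \<bar>L\<bar> + 1" if "w \<in> space M - (A n \<union> A' n)" for w
      proof -
        have "\<bar>Z n w\<bar> \<le> K" "dist (Y n w - Z n w) L < 1" using elim that by auto
        then show ?thesis unfolding dist_real_def by linarith
      qed
      ultimately show ?case using elim by auto
    qed
  qed
qed

text \<open>Slutsky's lemma for characteristic functions: the integrands differ by at most two, and
  by at most \<open>\<bar>t\<bar>\<close> times the distance of the variables.\<close>

lemma char_tendsto_whp:
  assumes [measurable]: "\<And>n. Z n \<in> borel_measurable M" "\<And>n. Y n \<in> borel_measurable M"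
    and lim: "((\<lambda>p. Z (fst p) (snd p) - Y (fst p) (snd p)) \<longlongrightarrow> 0) (whp M)"
    and Y: "(\<lambda>n. char (distr M borel (Y n)) t) \<longlonglongrightarrow> L"
  shows "(\<lambda>n. char (distr M borel (Z n)) t) \<longlonglongrightarrow> L"
proof -
  have "(\<lambda>n. char (distr M borel (Z n)) t - char (distr M borel (Y n)) t) \<longlonglongrightarrow> 0"
  proof (rule tendstoI)
    fix e :: real assume "e > 0"
    \<comment> \<open>The good event contributes at most
      \<open>\<bar>t\<bar> * d \<le> e / 2\<close>, the bad one less than
      \<open>2 * (e / 4)\<close>.\<close>
    define d where "d = e / (2 * (\<bar>t\<bar> + 1))"
    have d: "d > 0" using \<open>e > 0\<close> by (simp add: d_def)
    have "\<forall>\<^sub>F p in whp M. \<not> \<bar>Z (fst p) (snd p) - Y (fst p) (snd p)\<bar> > d"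
      using tendstoD[OF lim d] by eventually_elim simp
    from whp_prob_tendsto_0[OF this]
    have lim0: "(\<lambda>n. prob {w \<in> space M. \<bar>Z n w - Y n w\<bar> > d}) \<longlonglongrightarrow> 0" by simp
    have "e / 4 > 0" using \<open>e > 0\<close> by simp
    from order_tendstoD(2)[OF lim0 this]
    show "\<forall>\<^sub>F n in sequentially. dist (char (distr M borel (Z n)) t - char (distr M borel (Y n)) t) 0 < e"
    proof eventually_elim
      case (elim n)
      let ?I = "indicator {w \<in> space M. \<bar>Z n w - Y n w\<bar> > d} :: 'a \<Rightarrow> real"
      have int: "integrable M (\<lambda>w. iexp (t * f w))" if [measurable]: "f \<in> borel_measurable M" for f :: "'a \<Rightarrow> real"
        by (intro integrable_const_bound[of _ 1]) auto
      have "char (distr M borel (Z n)) t - char (distr M borel (Y n)) t =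
          (\<integral>w. iexp (t * Z n w) - iexp (t * Y n w) \<partial>M)"
        by (subst Bochner_Integration.integral_diff[OF int int]) (simp_all add: char_def integral_distr)
      also have "norm \<dots> \<le> (\<integral>w. \<bar>t\<bar> * d + 2 * ?I w \<partial>M)"
      proof (rule order_trans[OF integral_norm_bound integral_mono])
        show "integrable M (\<lambda>w. \<bar>t\<bar> * d + 2 * ?I w)"
          by (intro integrable_const_bound[of _ "\<bar>t\<bar> * d + 2"]) (use d in \<open>auto split: split_indicator simp: abs_mult\<close>)
        fix w assume w: "w \<in> space M"
        have "norm (iexp (t * Z n w) - iexp (t * Y n w)) = norm (iexp (t * Y n w) * (iexp (t * (Z n w - Y n w)) - 1))"
          by (simp add: algebra_simps exp_diff)
        also have "\<dots> = norm (iexp (t * (Z n w - Y n w)) - 1)"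
          by (simp only: norm_mult norm_exp_i_times mult_1)
        finally have eq: "norm (iexp (t * Z n w) - iexp (t * Y n w)) = norm (iexp (t * (Z n w - Y n w)) - 1)" .
        show "norm (iexp (t * Z n w) - iexp (t * Y n w)) \<le> \<bar>t\<bar> * d + 2 * ?I w"
        proof (cases "\<bar>Z n w - Y n w\<bar> > d")
          case True
          have "norm (iexp (t * (Z n w - Y n w)) - 1) \<le> 1 + 1"
            by (rule order_trans[OF norm_triangle_ineq4]) (simp only: norm_exp_i_times norm_one order_refl)
          then show ?thesis using True w d unfolding eq by (simp add: add_increasing)
        next
          case False
          have "norm (iexp (t * (Z n w - Y n w)) - 1) \<le> \<bar>t * (Z n w - Y n w)\<bar>"
            using iexp_approx1[of "t * (Z n w - Y n w)" 0] by simp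
          also have "\<dots> \<le> \<bar>t\<bar> * d" using False by (simp add: abs_mult mult_left_mono)
          finally show ?thesis using False unfolding eq by simp
        qed
      qed (intro integrable_norm Bochner_Integration.integrable_diff int, measurable)
      also have "\<dots> = \<bar>t\<bar> * d + 2 * prob {w \<in> space M. \<bar>Z n w - Y n w\<bar> > d}"
      proof -
        have "integrable M ?I" by (intro integrable_const_bound[of _ 1]) (auto split: split_indicator)
        then show ?thesis by (simp add: prob_space)
      qed
      also have "\<dots> < \<bar>t\<bar> * d + 2 * (e / 4)" using elim by simp
      also have "\<bar>t\<bar> * d \<le> e / 2" using \<open>e > 0\<close> by (simp add: d_def field_simps)
      finally show ?case by simp
    qed
  qed
  from tendsto_add[OF this Y] show ?thesis by simp
qed

end

section \<open>Multivariate normal laws\<close>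

lemma inner_axis_mat:
  fixes S :: "real ^ 'm ^ 'm"
  shows "axis i 1 \<bullet> (S *v axis j 1) = S $ i $ j"
  by (simp add: matrix_vector_mult_basis column_def inner_axis' )

text \<open>Otherwise the form along the line \<open>t *\<^sub>R axis i 1 + axis j 1\<close> would
  be affine in \<open>t\<close> with nonzero slope, hence negative somewhere; the chosen
  \<open>t\<close> gives the value \<open>-1\<close>.\<close>

lemma psd_zero_diag:
  fixes S :: "real ^ 'm ^ 'm"
  assumes sym: "transpose S = S" and psd: "\<And>x. x \<bullet> (S *v x) \<ge> 0" and zero: "S $ i $ i = 0"
  shows "S $ i $ j = 0"
proof (rule ccontr)
  assume nz: "S $ i $ j \<noteq> 0"
  have ji: "S $ j $ i = S $ i $ j"
    using sym by (metis transpose_def vec_lambda_beta)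
  define t where "t = - (S $ j $ j + 1) / (2 * S $ i $ j)"
  have "(t *\<^sub>R axis i 1 + axis j 1) \<bullet> (S *v (t *\<^sub>R axis i 1 + axis j 1)) = 2 * t * S $ i $ j + S $ j $ j"
    by (simp add: matrix_vector_right_distrib matrix_vector_mult_scaleR inner_add_left inner_add_right
        inner_axis_mat zero ji)
  also have "\<dots> = - 1" using nz by (simp add: t_def field_simps)
  finally show False using psd[of "t *\<^sub>R axis i 1 + axis j 1"] by simp
qed

text \<open>Gaussian elimination: subtracting the rank-one part of a nonzero pivot leaves a positive
  semidefinite matrix with fewer nonzero diagonal entries.\<close>

lemma psd_gram:
  fixes S :: "real ^ 'm ^ 'm"
  assumes "transpose S = S" and "\<And>x. x \<bullet> (S *v x) \<ge> 0"
  shows "\<exists>(K::nat) u :: nat \<Rightarrow> real ^ 'm. \<forall>i j. S $ i $ j = (\<Sum>r<K. u r $ i * u r $ j)"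
  using assms
proof (induction "card {i. S $ i $ i \<noteq> 0}" arbitrary: S rule: less_induct)
  case less
  show ?case
  proof (cases "\<exists>p. S $ p $ p \<noteq> 0")
    case False
    then have "S $ i $ j = 0" for i j using psd_zero_diag[OF less.prems] by blast
    then show ?thesis by (intro exI[of _ 0]) auto
  next
    case True
    then obtain p where p: "S $ p $ p \<noteq> 0" by blast
    define c where "c = S $ p $ p"
    have c: "c > 0" using less.prems(2)[of "axis p 1"] p by (simp add: inner_axis_mat c_def)
    define v where "v = (\<chi> i. S $ i $ p / sqrt c)"
    define T where "T = (\<chi> i j. S $ i $ j - v $ i * v $ j)"
    have sym: "S $ i $ j = S $ j $ i" for i j
      using less.prems(1) by (metis transpose_def vec_lambda_beta)
    have T_sym: "transpose T = T"
      by (simp add: T_def transpose_def vec_eq_iff sym mult.commute)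
    have T_vec: "x \<bullet> (T *v x) = x \<bullet> (S *v x) - (v \<bullet> x)\<^sup>2" for x
    proof -
      have "T *v x = S *v x - (v \<bullet> x) *\<^sub>R v"
        by (simp add: T_def vec_eq_iff matrix_vector_mult_def inner_vec_def algebra_simps
            sum_subtractf sum_distrib_left)
      then show ?thesis by (simp add: inner_diff_right inner_commute power2_eq_square)
    qed
    have T_psd: "x \<bullet> (T *v x) \<ge> 0" for x
    proof -
      \<comment> \<open>\<open>a\<close> minimises the form along the pivot axis through
        \<open>x\<close>; the minimum is the form of the Schur complement \<open>T\<close>.\<close>
      define a where "a = (v \<bullet> x) / sqrt c"
      have Sp: "S *v axis p 1 = sqrt c *\<^sub>R v"
        using c by (simp add: matrix_vector_mult_basis column_def v_def vec_eq_iff)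
      have "axis p 1 \<bullet> (S *v x) = sqrt c * (v \<bullet> x)"
        using less.prems(1) Sp by (metis dot_lmul_matrix inner_scaleR_left transpose_matrix_vector)
      moreover have "x \<bullet> (S *v axis p 1) = sqrt c * (v \<bullet> x)" using Sp by (simp add: inner_commute)
      ultimately have "(x - a *\<^sub>R axis p 1) \<bullet> (S *v (x - a *\<^sub>R axis p 1)) =
          x \<bullet> (S *v x) - 2 * a * (sqrt c * (v \<bullet> x)) + a\<^sup>2 * c"
        by (simp add: matrix_vector_mult_diff_distrib matrix_vector_mult_scaleR inner_diff_left
            inner_diff_right inner_axis_mat c_def[symmetric] power2_eq_square algebra_simps)
      also have "\<dots> = x \<bullet> (T *v x)"
        using c by (simp add: T_vec a_def power2_eq_square field_simps)
      finally show ?thesis using less.prems(2) by metis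
    qed
    have "{i. T $ i $ i \<noteq> 0} \<subset> {i. S $ i $ i \<noteq> 0}"
    proof
      \<comment> \<open>A vanishing diagonal entry of \<open>S\<close> kills its whole row, so
        \<open>v\<close> is zero there and no new diagonal entry appears.\<close>
      show "{i. T $ i $ i \<noteq> 0} \<subseteq> {i. S $ i $ i \<noteq> 0}"
        using psd_zero_diag[OF less.prems] by (auto simp: T_def v_def)
      have "T $ p $ p = 0" using c by (simp add: T_def v_def c_def)
      then show "{i. T $ i $ i \<noteq> 0} \<noteq> {i. S $ i $ i \<noteq> 0}" using p by auto
    qed
    then have "card {i. T $ i $ i \<noteq> 0} < card {i. S $ i $ i \<noteq> 0}"
      by (intro psubset_card_mono) auto
    from less.hyps[OF this T_sym T_psd] obtain K and u :: "nat \<Rightarrow> real ^ 'm"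
      where u: "\<And>i j. T $ i $ j = (\<Sum>r<K. u r $ i * u r $ j)" by blast
    have "S $ i $ j = (\<Sum>r<Suc K. (u(K := v)) r $ i * (u(K := v)) r $ j)" for i j
      using u[of i j] by (simp add: T_def)
    then show ?thesis by blast
  qed
qed

lemma real_distribution_normal_law: "v \<ge> 0 \<Longrightarrow> real_distribution (normal_law \<mu> v)"
  by (auto simp: normal_law_def real_distribution_def real_distribution_axioms_def
      prob_space_return prob_space_normal_density)

lemma char_normal_law:
  assumes "v \<ge> 0"
  shows "char (normal_law \<mu> v) t = iexp (t * \<mu>) * of_real (exp (- (v * t\<^sup>2 / 2)))"
proof (cases "v = 0")
  case True
  then show ?thesis by (simp add: normal_law_def char_def integral_return)
next
  case False
  with assms have v: "sqrt v > 0" by simp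
  interpret N: real_distribution std_normal_distribution by (rule real_dist_normal_dist)
  have "distributed std_normal_distribution lborel (\<lambda>x. x) std_normal_density"
    unfolding distributed_def by (auto simp: distr_id2)
  from N.normal_density_affine[OF this zero_less_one, of "sqrt v" \<mu>] v
  have "distributed std_normal_distribution lborel (\<lambda>x. \<mu> + sqrt v * x) (normal_density \<mu> (sqrt v))"
    by simp
  then have "normal_law \<mu> v = distr std_normal_distribution lborel (\<lambda>x. \<mu> + sqrt v * x)"
    using False by (simp add: distributed_def normal_law_def)
  also have "\<dots> = distr std_normal_distribution borel (\<lambda>x. \<mu> + sqrt v * x)"
    by (rule distr_cong) auto
  finally have "char (normal_law \<mu> v) t = (\<integral>x. iexp (t * (\<mu> + sqrt v * x)) \<partial>std_normal_distribution)"
    by (simp add: char_def integral_distr)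
  also have "\<dots> = (\<integral>x. iexp (t * \<mu>) * iexp (t * sqrt v * x) \<partial>std_normal_distribution)"
    by (simp add: exp_add[symmetric] algebra_simps)
  also have "\<dots> = iexp (t * \<mu>) * char std_normal_distribution (t * sqrt v)"
    by (simp add: char_def)
  also have "\<dots> = iexp (t * \<mu>) * of_real (exp (- (v * t\<^sup>2 / 2)))"
    using v by (simp add: char_std_normal_distribution power_mult_distrib mult.commute)
  finally show ?thesis .
qed

text \<open>\<open>is_multivariate_normal\<close> only characterises a law, so the weak limit must
  be exhibited. The Gram vectors of \<open>S\<close> turn independent standard normal variables into
  it; singular \<open>S\<close> is covered, as neither an inverse nor a density is involved.\<close>

lemma exists_multivariate_normal:
  fixes S :: "real ^ 'm ^ 'm"
  assumes sym: "transpose S = S" and psd: "\<And>x. x \<bullet> (S *v x) \<ge> 0"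
  shows "\<exists>Q. is_multivariate_normal Q \<mu> S"
proof -
  obtain K and u :: "nat \<Rightarrow> real ^ 'm" where u: "\<And>i j. S $ i $ j = (\<Sum>r<K. u r $ i * u r $ j)"
    using psd_gram[OF assms] by blast
  have quad: "a \<bullet> (S *v a) = (\<Sum>r<K. (a \<bullet> u r)\<^sup>2)" for a
  proof -
    have "a \<bullet> (S *v a) = (\<Sum>i\<in>UNIV. \<Sum>j\<in>UNIV. \<Sum>r<K. (a $ i * u r $ i) * (a $ j * u r $ j))"
      by (simp add: inner_vec_def matrix_vector_mult_def u sum_distrib_left sum_distrib_right ac_simps)
    also have "\<dots> = (\<Sum>r<K. \<Sum>i\<in>UNIV. \<Sum>j\<in>UNIV. (a $ i * u r $ i) * (a $ j * u r $ j))"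
      by (simp only: sum.swap[of _ UNIV "{..<K}"])
    also have "\<dots> = (\<Sum>r<K. (a \<bullet> u r)\<^sup>2)"
      by (simp add: inner_vec_def power2_eq_square sum_product)
    finally show ?thesis .
  qed
  define P where "P = PiM {..<K} (\<lambda>_. std_normal_distribution)"
  interpret N: real_distribution std_normal_distribution by (rule real_dist_normal_dist)
  interpret P: product_prob_space "\<lambda>_::nat. std_normal_distribution" "{..<K}"
    by unfold_locales
  have [measurable_cong]: "sets P = sets (PiM {..<K} (\<lambda>_. borel))"
    unfolding P_def by (intro sets_PiM_cong) auto
  have prob_P: "prob_space P" unfolding P_def by (rule P.prob_space_axioms)
  interpret PP: prob_space P by (rule prob_P)
  define g where "g = (\<lambda>z. \<mu> + (\<Sum>r<K. z r *\<^sub>R u r))"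
  have g [measurable]: "g \<in> borel_measurable P"
    unfolding g_def by measurable
  define Q where "Q = distr P borel g"
  have prob_Q: "prob_space Q" unfolding Q_def by (rule PP.prob_space_distr) measurable
  have "distr Q borel (\<lambda>x. a \<bullet> x) = normal_law (a \<bullet> \<mu>) (a \<bullet> (S *v a))" for a
  proof (rule Levy_uniqueness)
    have "distr Q borel (\<lambda>x. a \<bullet> x) = distr P borel (\<lambda>z. a \<bullet> g z)"
      unfolding Q_def by (subst distr_distr) (auto simp: comp_def)
    then have eq: "distr Q borel (\<lambda>x. a \<bullet> x) = distr P borel (\<lambda>z. a \<bullet> \<mu> + (\<Sum>r<K. z r * (a \<bullet> u r)))"
      by (simp add: g_def inner_add_right inner_sum_right)
    have [measurable]: "(\<lambda>z. a \<bullet> \<mu> + (\<Sum>r<K. z r * (a \<bullet> u r))) \<in> borel_measurable P" by measurable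
    show "real_distribution (distr Q borel (\<lambda>x. a \<bullet> x))"
      unfolding eq by (rule PP.real_distribution_distr) measurable
    show "real_distribution (normal_law (a \<bullet> \<mu>) (a \<bullet> (S *v a)))"
      by (rule real_distribution_normal_law[OF psd])
    show "char (distr Q borel (\<lambda>x. a \<bullet> x)) = char (normal_law (a \<bullet> \<mu>) (a \<bullet> (S *v a)))"
    proof
      fix t
      have "char (distr Q borel (\<lambda>x. a \<bullet> x)) t = (\<integral>z. iexp (t * (a \<bullet> \<mu> + (\<Sum>r<K. z r * (a \<bullet> u r)))) \<partial>P)"
        unfolding eq char_def by (subst integral_distr) auto
      also have "\<dots> = (\<integral>z. iexp (t * (a \<bullet> \<mu>)) * (\<Prod>r<K. iexp (t * (a \<bullet> u r) * z r)) \<partial>P)"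
        by (intro Bochner_Integration.integral_cong refl)
           (simp add: exp_sum[symmetric] exp_add[symmetric] sum_distrib_left algebra_simps)
      also have "\<dots> = iexp (t * (a \<bullet> \<mu>)) * (\<integral>z. (\<Prod>r<K. iexp (t * (a \<bullet> u r) * z r)) \<partial>P)"
        by simp
      also have "(\<integral>z. (\<Prod>r<K. iexp (t * (a \<bullet> u r) * z r)) \<partial>P) =
          (\<Prod>r<K. char std_normal_distribution (t * (a \<bullet> u r)))"
        unfolding P_def char_def
        by (rule P.product_integral_prod) (auto intro!: N.integrable_const_bound[of _ 1])
      also have "\<dots> = of_real (exp (- (a \<bullet> (S *v a) * t\<^sup>2 / 2)))"
        unfolding char_std_normal_distribution of_real_prod[symmetric] exp_sum[OF finite_lessThan, symmetric] quad
        by (simp add: power_mult_distrib sum_negf sum_divide_distrib sum_distrib_left sum_distrib_right mult.commute)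
      finally show "char (distr Q borel (\<lambda>x. a \<bullet> x)) t = char (normal_law (a \<bullet> \<mu>) (a \<bullet> (S *v a))) t"
        by (simp add: char_normal_law[OF psd])
    qed
  qed
  moreover have "sets Q = sets borel" by (simp add: Q_def)
  ultimately show ?thesis
    unfolding is_multivariate_normal_def using prob_Q sym psd by blast
qed

section \<open>The Cramer-Wold device\<close>

text \<open>The bridge between the one-dimensional and the vector statement: expectations of the
  generators are multiples of real and imaginary parts of characteristic functions of linear
  combinations, and the product-to-sum formulas make the set an algebra, as Stone-Weierstrass
  requires.\<close>

inductive_set trig_poly :: "('a::real_inner \<Rightarrow> real) set" where
  cos: "(\<lambda>x. c * cos (a \<bullet> x)) \<in> trig_poly"
| sin: "(\<lambda>x. c * sin (a \<bullet> x)) \<in> trig_poly"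
| add: "f \<in> trig_poly \<Longrightarrow> g \<in> trig_poly \<Longrightarrow> (\<lambda>x. f x + g x) \<in> trig_poly"

lemma trig_poly_const: "(\<lambda>_. c) \<in> trig_poly"
  using trig_poly.cos[of c 0] by simp

lemma trig_poly_mult_cos: "f \<in> trig_poly \<Longrightarrow> (\<lambda>x. f x * (d * cos (b \<bullet> x))) \<in> trig_poly"
proof (induction rule: trig_poly.induct)
  case (cos c a)
  have "(\<lambda>x. c * cos (a \<bullet> x) * (d * cos (b \<bullet> x))) =
      (\<lambda>x. (c * d / 2) * cos ((a - b) \<bullet> x) + (c * d / 2) * cos ((a + b) \<bullet> x))"
    by (simp add: fun_eq_iff inner_diff_left inner_add_left cos_add cos_diff field_simps)
  then show ?case by (simp only:) (intro trig_poly.intros)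
next
  case (sin c a)
  have "(\<lambda>x. c * sin (a \<bullet> x) * (d * cos (b \<bullet> x))) =
      (\<lambda>x. (c * d / 2) * sin ((a + b) \<bullet> x) + (c * d / 2) * sin ((a - b) \<bullet> x))"
    by (simp add: fun_eq_iff inner_diff_left inner_add_left sin_add sin_diff field_simps)
  then show ?case by (simp only:) (intro trig_poly.intros)
next
  case (add f g)
  then show ?case by (simp only: distrib_right) (intro trig_poly.add)
qed

lemma trig_poly_mult_sin: "f \<in> trig_poly \<Longrightarrow> (\<lambda>x. f x * (d * sin (b \<bullet> x))) \<in> trig_poly"
proof (induction rule: trig_poly.induct)
  case (cos c a)
  have "(\<lambda>x. c * cos (a \<bullet> x) * (d * sin (b \<bullet> x))) =
      (\<lambda>x. (c * d / 2) * sin ((a + b) \<bullet> x) + (- (c * d / 2)) * sin ((a - b) \<bullet> x))"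
    by (simp add: fun_eq_iff inner_diff_left inner_add_left sin_add sin_diff field_simps)
  then show ?case by (simp only:) (intro trig_poly.intros)
next
  case (sin c a)
  have "(\<lambda>x. c * sin (a \<bullet> x) * (d * sin (b \<bullet> x))) =
      (\<lambda>x. (c * d / 2) * cos ((a - b) \<bullet> x) + (- (c * d / 2)) * cos ((a + b) \<bullet> x))"
    by (simp add: fun_eq_iff inner_diff_left inner_add_left cos_add cos_diff field_simps)
  then show ?case by (simp only:) (intro trig_poly.intros)
next
  case (add f g)
  then show ?case by (simp only: distrib_right) (intro trig_poly.add)
qed

lemma trig_poly_mult:
  assumes f: "f \<in> trig_poly" and g: "g \<in> trig_poly"
  shows "(\<lambda>x. f x * g x) \<in> trig_poly"
  using g
proof (induction rule: trig_poly.induct)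
  case (cos c a)
  then show ?case by (rule trig_poly_mult_cos[OF f])
next
  case (sin c a)
  then show ?case by (rule trig_poly_mult_sin[OF f])
next
  case (add g h)
  then show ?case by (simp only: distrib_left) (intro trig_poly.add)
qed

lemma trig_poly_continuous: "f \<in> trig_poly \<Longrightarrow> continuous_on A f"
  by (induction rule: trig_poly.induct) (auto intro!: continuous_intros)

lemma trig_poly_bounded: "f \<in> trig_poly \<Longrightarrow> \<exists>D. \<forall>x. \<bar>f x\<bar> \<le> D"
proof (induction rule: trig_poly.induct)
  case (cos c a)
  have "\<bar>c * cos (a \<bullet> x)\<bar> \<le> \<bar>c\<bar>" for x by (simp add: abs_mult mult_left_le)
  then show ?case by blast
next
  case (sin c a)
  have "\<bar>c * sin (a \<bullet> x)\<bar> \<le> \<bar>c\<bar>" for x by (simp add: abs_mult mult_left_le)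
  then show ?case by blast
next
  case (add f g)
  then show ?case by (meson abs_triangle_ineq add_mono order_trans)
qed

lemma trig_poly_compose_polynomial:
  assumes "real_polynomial_function q" and p: "p \<in> trig_poly"
  shows "(\<lambda>x. q (p x)) \<in> trig_poly"
  using assms(1)
proof (induction rule: real_polynomial_function.induct)
  case (linear f)
  have "f y = f 1 * y" for y
    using linear_scale[OF bounded_linear.linear[OF linear], of y 1] by (simp add: mult.commute)
  then have eq: "(\<lambda>x. f (p x)) = (\<lambda>x. f 1 * p x)" by (intro ext)
  show ?case unfolding eq by (rule trig_poly_mult[OF trig_poly_const p])
next
  case (const c)
  then show ?case by (rule trig_poly_const)
next
  case (add f g)
  show ?case by (rule trig_poly.add[OF add.IH])
next
  case (mult f g)
  show ?case by (rule trig_poly_mult[OF mult.IH])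
qed

text \<open>A first approximation is only controlled on the compact set; composing it with a polynomial
  close to the truncation at level \<open>C\<close> bounds it everywhere.\<close>

lemma trig_poly_approx:
  fixes f :: "'a::euclidean_space \<Rightarrow> real"
  assumes S: "compact S" and f: "continuous_on S f" "\<And>x. x \<in> S \<Longrightarrow> \<bar>f x\<bar> \<le> C" and C: "C \<ge> 0" and "\<epsilon> > 0"
  obtains h where "h \<in> trig_poly" "\<And>x. \<bar>h x\<bar> \<le> C + \<epsilon>" "\<And>x. x \<in> S \<Longrightarrow> \<bar>f x - h x\<bar> \<le> 2 * \<epsilon>"
proof -
  interpret T: function_ring_on "trig_poly :: ('a \<Rightarrow> real) set" S
  proof
    fix x y :: 'a assume "x \<noteq> y"
    define d where "d = y - x"
    \<comment> \<open>The phases at \<open>x\<close> and \<open>y\<close> are made to differ by a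
      right angle. If sine and cosine both agreed, the cosine of the difference would be one instead
      of zero.\<close>
    define a where "a = (pi / 2 / (d \<bullet> d)) *\<^sub>R d"
    have "a \<bullet> y - a \<bullet> x = a \<bullet> d" by (simp add: d_def inner_diff_right)
    also have "\<dots> = pi / 2" using \<open>x \<noteq> y\<close> by (simp add: a_def d_def)
    finally have "cos (a \<bullet> y - a \<bullet> x) = cos (pi / 2)" by (rule arg_cong)
    then have "cos (a \<bullet> y - a \<bullet> x) = 0" by (simp only: cos_pi_half)
    then have "\<not> (sin (a \<bullet> y) = sin (a \<bullet> x) \<and> cos (a \<bullet> y) = cos (a \<bullet> x))"
      using sin_cos_squared_add3[of "a \<bullet> x"] by (auto simp: cos_diff)
    then show "\<exists>f\<in>trig_poly. f x \<noteq> f y"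
      using trig_poly.sin[of 1 a] trig_poly.cos[of 1 a] by fastforce
  qed (use S in \<open>auto intro: trig_poly_continuous trig_poly.add trig_poly_mult trig_poly_const\<close>)
  obtain p where p: "p \<in> trig_poly" "\<And>x. x \<in> S \<Longrightarrow> \<bar>f x - p x\<bar> < \<epsilon>"
    using T.Stone_Weierstrass_basic[OF f(1) \<open>\<epsilon> > 0\<close>] by blast
  obtain D where D: "\<And>x. \<bar>p x\<bar> \<le> D" using trig_poly_bounded[OF p(1)] by blast
  define cl where "cl = (\<lambda>y::real. max (- C) (min C y))"
  have "continuous_on {- D..D} cl" unfolding cl_def by (intro continuous_intros)
  from Stone_Weierstrass_real_polynomial_function[OF compact_Icc this \<open>\<epsilon> > 0\<close>]
  obtain q where q: "real_polynomial_function q" "\<And>y. y \<in> {- D..D} \<Longrightarrow> \<bar>cl y - q y\<bar> < \<epsilon>"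
    by blast
  have pD: "p x \<in> {- D..D}" for x using D[of x] by auto
  show thesis
  proof (rule that[of "\<lambda>x. q (p x)"])
    show "(\<lambda>x. q (p x)) \<in> trig_poly" by (rule trig_poly_compose_polynomial[OF q(1) p(1)])
    fix x
    have "\<bar>cl (p x)\<bar> \<le> C" using C by (auto simp: cl_def)
    with q(2)[OF pD[of x]] show "\<bar>q (p x)\<bar> \<le> C + \<epsilon>" by linarith
  next
    fix x assume x: "x \<in> S"
    \<comment> \<open>Truncation is 1-Lipschitz and fixes the values of \<open>f\<close> on
      \<open>S\<close>, which lie in \<open>{- C..C}\<close>.\<close>
    have "\<bar>cl (p x) - f x\<bar> \<le> \<bar>p x - f x\<bar>" using f(2)[OF x] C unfolding cl_def by linarith
    with q(2)[OF pD[of x]] p(2)[OF x] show "\<bar>f x - q (p x)\<bar> \<le> 2 * \<epsilon>" by linarith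
  qed
qed

lemma (in prob_space) expectation_close:
  fixes f h :: "'a \<Rightarrow> real"
  assumes [measurable]: "f \<in> borel_measurable M" "h \<in> borel_measurable M" "B \<in> events"
    and bounds: "\<And>w. \<bar>f w\<bar> \<le> C" "\<And>w. \<bar>h w\<bar> \<le> D"
    and close: "\<And>w. w \<in> space M - B \<Longrightarrow> \<bar>f w - h w\<bar> \<le> \<epsilon>" and "\<epsilon> \<ge> 0"
  shows "\<bar>expectation f - expectation h\<bar> \<le> \<epsilon> + (C + D) * prob B"
proof -
  have int: "integrable M f" "integrable M h"
    by (intro integrable_const_bound[of _ C] integrable_const_bound[of _ D]; simp add: bounds)+
  have "C + D \<ge> 0" using bounds[of undefined] by linarith
  have "\<bar>expectation f - expectation h\<bar> = \<bar>expectation (\<lambda>w. f w - h w)\<bar>"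
    using int by simp
  also have "\<dots> \<le> expectation (\<lambda>w. \<bar>f w - h w\<bar>)"
    using integral_norm_bound[of M "\<lambda>w. f w - h w"] by simp
  also have "\<dots> \<le> expectation (\<lambda>w. \<epsilon> + (C + D) * indicator B w)"
  proof (rule integral_mono)
    show "\<bar>f w - h w\<bar> \<le> \<epsilon> + (C + D) * indicator B w" if "w \<in> space M" for w
      using close[of w] bounds[of w] that \<open>\<epsilon> \<ge> 0\<close> by (cases "w \<in> B") auto
    show "integrable M (\<lambda>w. \<epsilon> + (C + D) * indicator B w)"
      by (intro Bochner_Integration.integrable_add integrable_mult_right) (auto simp: emeasure_eq_measure)
  qed (use int in auto)
  also have "\<dots> = \<epsilon> + (C + D) * prob B"
    by (subst Bochner_Integration.integral_add) (auto simp: prob_space emeasure_eq_measure)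
  finally show ?thesis .
qed

lemma (in prob_space) trig_poly_integral_tendsto:
  fixes Z :: "nat \<Rightarrow> 'a \<Rightarrow> 'b::euclidean_space"
  assumes [measurable]: "\<And>n. Z n \<in> borel_measurable M"
    and Q: "prob_space Q" "sets Q = sets borel"
    and char: "\<And>a. (\<lambda>n. char (distr M borel (\<lambda>w. a \<bullet> Z n w)) 1) \<longlonglongrightarrow> char (distr Q borel (\<lambda>x. a \<bullet> x)) 1"
    and h: "h \<in> trig_poly"
  shows "(\<lambda>n. expectation (\<lambda>w. h (Z n w))) \<longlonglongrightarrow> (\<integral>x. h x \<partial>Q)"
proof -
  interpret Q: prob_space Q by fact
  note [measurable_cong] = Q(2)
  have charZ: "char (distr M borel (\<lambda>w. a \<bullet> Z n w)) 1 =
      Complex (expectation (\<lambda>w. cos (a \<bullet> Z n w))) (expectation (\<lambda>w. sin (a \<bullet> Z n w)))" for a n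
  proof -
    have "integrable M (\<lambda>w. iexp (a \<bullet> Z n w))" by (intro integrable_const_bound[of _ 1]) auto
    from integral_Re[OF this] integral_Im[OF this] show ?thesis
      by (simp add: complex_eq_iff char_def integral_distr Re_exp Im_exp)
  qed
  have charQ: "char (distr Q borel (\<lambda>x. a \<bullet> x)) 1 =
      Complex (\<integral>x. cos (a \<bullet> x) \<partial>Q) (\<integral>x. sin (a \<bullet> x) \<partial>Q)" for a
  proof -
    have "integrable Q (\<lambda>x. iexp (a \<bullet> x))" by (intro Q.integrable_const_bound[of _ 1]) auto
    from integral_Re[OF this] integral_Im[OF this] show ?thesis
      by (simp add: complex_eq_iff char_def integral_distr Re_exp Im_exp)
  qed
  show ?thesis
    using h
  proof (induction rule: trig_poly.induct)
    case (cos c a)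
    show ?case using tendsto_Re[OF char[of a]] unfolding charZ charQ by (simp add: tendsto_mult_left)
  next
    case (sin c a)
    show ?case using tendsto_Im[OF char[of a]] unfolding charZ charQ by (simp add: tendsto_mult_left)
  next
    case (add f g)
    have int: "integrable M (\<lambda>w. f (Z n w))" "integrable Q f" if "f \<in> trig_poly" for f n
    proof -
      obtain D where D: "\<And>x. \<bar>f x\<bar> \<le> D" using trig_poly_bounded[OF \<open>f \<in> trig_poly\<close>] by blast
      have [measurable]: "f \<in> borel_measurable borel"
        by (rule borel_measurable_continuous_onI[OF trig_poly_continuous[OF that]])
      show "integrable M (\<lambda>w. f (Z n w))" by (intro integrable_const_bound[of _ D]) (auto simp: D)
      show "integrable Q f" by (intro Q.integrable_const_bound[of _ D]) (auto simp: D)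
    qed
    show ?case using tendsto_add[OF add.IH] by (simp add: int add.hyps)
  qed
qed

text \<open>\<open>f\<close> is replaced by a trigonometric polynomial on a ball, and the
  approximation keeps the bound \<open>C + \<epsilon>\<close> outside, where little mass is left.
  The mass under \<open>Z n\<close> is controlled by tightness, which second moments provide in the
  application.\<close>

lemma (in prob_space) cramer_wold:
  fixes Z :: "nat \<Rightarrow> 'a \<Rightarrow> real ^ 'm"
  assumes meas [measurable]: "\<And>n. Z n \<in> borel_measurable M"
    and Q: "prob_space Q" "sets Q = sets borel"
    and char: "\<And>a. (\<lambda>n. char (distr M borel (\<lambda>w. a \<bullet> Z n w)) 1) \<longlonglongrightarrow> char (distr Q borel (\<lambda>x. a \<bullet> x)) 1"
    and tight: "\<And>j. tight_seq M (\<lambda>n w. Z n w $ j)"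
  shows "weak_conv_vec (\<lambda>n. distr M borel (Z n)) Q"
  unfolding weak_conv_vec_def
proof safe
  fix f :: "real ^ 'm \<Rightarrow> real"
  assume f: "continuous_on UNIV f" and "bounded (range f)"
  then obtain C where C: "C > 0" "\<And>x. \<bar>f x\<bar> \<le> C" unfolding bounded_pos by auto
  interpret Q: prob_space Q by fact
  note [measurable_cong] = Q(2)
  have [measurable]: "f \<in> borel_measurable borel" by (rule borel_measurable_continuous_onI[OF f])
  have "(\<lambda>n. expectation (\<lambda>w. f (Z n w))) \<longlonglongrightarrow> (\<integral>x. f x \<partial>Q)"
  proof (rule tendstoI)
    fix e :: real assume "e > 0"
    \<comment> \<open>Replacing \<open>f\<close> by \<open>h\<close> costs
      \<open>3 * \<epsilon>\<close> under each of the two laws and the convergence for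
      \<open>h\<close> costs \<open>\<epsilon>\<close>, seven in total.\<close>
    define \<epsilon> where "\<epsilon> = e / 8"
    have \<epsilon>: "\<epsilon> > 0" using \<open>e > 0\<close> by (simp add: \<epsilon>_def)
    \<comment> \<open>Tuned so that a bad event of probability \<open>\<eta>\<close> contributes
      exactly \<open>\<epsilon>\<close>, as the bounds of \<open>f\<close> and \<open>h\<close> add
      up to \<open>2 * C + \<epsilon>\<close>.\<close>
    define \<eta> where "\<eta> = \<epsilon> / (2 * C + \<epsilon>)"
    have \<eta>: "\<eta> > 0" using \<epsilon> C by (simp add: \<eta>_def)
    have "\<eta> / CARD('m) > 0" using \<eta> by simp
    define good where "good j K A \<longleftrightarrow> (\<forall>n. A n \<in> events) \<and> (\<forall>\<^sub>F n in sequentially.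
        prob (A n) \<le> \<eta> / CARD('m) \<and> (\<forall>w\<in>space M - A n. \<bar>Z n w $ j\<bar> \<le> K))" for j K A
    have "\<exists>K A. good j K A" for j
      using tight[of j] \<open>\<eta> / CARD('m) > 0\<close> unfolding tight_seq_def good_def by blast
    then obtain K A where KA: "\<And>j. good j (K j) (A j)" by metis
    then have A: "\<And>j n. A j n \<in> events"
      "\<And>j. \<forall>\<^sub>F n in sequentially. prob (A j n) \<le> \<eta> / CARD('m) \<and> (\<forall>w\<in>space M - A j n. \<bar>Z n w $ j\<bar> \<le> K j)"
      unfolding good_def by blast+
    have "(\<lambda>n. Q.prob {x. real n < norm x}) \<longlonglongrightarrow> Q.prob (\<Inter>n. {x. real n < norm x})"
      by (rule Q.finite_Lim_measure_decseq) (auto simp: decseq_def Q(2))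
    moreover have "(\<Inter>n. {x::real ^ 'm. real n < norm x}) = {}"
    proof (rule equals0I)
      fix x :: "real ^ 'm" assume "x \<in> (\<Inter>n. {x. real n < norm x})"
      then have "real n < norm x" for n by auto
      moreover obtain n where "norm x < real n" using reals_Archimedean2 by blast
      ultimately show False by (meson less_asym)
    qed
    ultimately have "(\<lambda>n. Q.prob {x. real n < norm x}) \<longlonglongrightarrow> 0" by simp
    from order_tendstoD(2)[OF this \<eta>] obtain L1 where L1: "Q.prob {x. real L1 < norm x} < \<eta>"
      unfolding eventually_sequentially by blast
    \<comment> \<open>The first entry serves the limit law; the second bounds the norm of
      \<open>Z n\<close> by the sum of its coordinates.\<close>
    define L where "L = max (real L1) (\<Sum>j\<in>UNIV. \<bar>K j\<bar>)"
    obtain h where h: "h \<in> trig_poly" "\<And>x. \<bar>h x\<bar> \<le> C + \<epsilon>" "\<And>x. x \<in> cball 0 L \<Longrightarrow> \<bar>f x - h x\<bar> \<le> 2 * \<epsilon>"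
      using trig_poly_approx[OF compact_cball continuous_on_subset[OF f subset_UNIV] _ _ \<epsilon>, of 0 L C] C by (metis less_imp_le)
    have [measurable]: "h \<in> borel_measurable borel"
      by (rule borel_measurable_continuous_onI[OF trig_poly_continuous[OF h(1)]])
    have \<eta>_eq: "(C + (C + \<epsilon>)) * \<eta> = \<epsilon>" using C \<epsilon> by (simp add: \<eta>_def field_simps)
    have fQ: "\<bar>(\<integral>x. f x \<partial>Q) - (\<integral>x. h x \<partial>Q)\<bar> \<le> 3 * \<epsilon>"
    proof -
      have "\<bar>(\<integral>x. f x \<partial>Q) - (\<integral>x. h x \<partial>Q)\<bar> \<le> 2 * \<epsilon> + (C + (C + \<epsilon>)) * Q.prob {x. real L1 < norm x}"
        by (rule Q.expectation_close) (use C(2) h \<epsilon> in \<open>auto simp: L_def Q(2)\<close>)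
      also have "\<dots> \<le> 2 * \<epsilon> + (C + (C + \<epsilon>)) * \<eta>"
        using L1 C \<epsilon> by (intro add_left_mono mult_left_mono) auto
      finally show ?thesis unfolding \<eta>_eq by simp
    qed
    have "\<forall>\<^sub>F n in sequentially. \<forall>j. prob (A j n) \<le> \<eta> / CARD('m) \<and> (\<forall>w\<in>space M - A j n. \<bar>Z n w $ j\<bar> \<le> K j)"
      by (rule eventually_all_finite[OF A(2)])
    moreover have "\<forall>\<^sub>F n in sequentially. dist (expectation (\<lambda>w. h (Z n w))) (\<integral>x. h x \<partial>Q) < \<epsilon>"
      by (rule tendstoD[OF trig_poly_integral_tendsto[OF meas Q char h(1)] \<epsilon>])
    ultimately show "\<forall>\<^sub>F n in sequentially. dist (expectation (\<lambda>w. f (Z n w))) (\<integral>x. f x \<partial>Q) < e"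
    proof eventually_elim
      case (elim n)
      let ?B = "\<Union>j. A j n"
      have "prob ?B \<le> (\<Sum>j\<in>UNIV. prob (A j n))"
        by (rule finite_measure_subadditive_finite) (use A in auto)
      also have "\<dots> \<le> (\<Sum>j\<in>(UNIV::'m set). \<eta> / CARD('m))" using elim by (intro sum_mono) auto
      also have "\<dots> = \<eta>" by simp
      finally have B: "prob ?B \<le> \<eta>" .
      have "\<bar>expectation (\<lambda>w. f (Z n w)) - expectation (\<lambda>w. h (Z n w))\<bar> \<le> 2 * \<epsilon> + (C + (C + \<epsilon>)) * prob ?B"
      proof (rule expectation_close)
        fix w assume w: "w \<in> space M - ?B"
        have "norm (Z n w) \<le> (\<Sum>j\<in>UNIV. \<bar>Z n w $ j\<bar>)" by (rule norm_le_l1_cart)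
        also have "\<dots> \<le> (\<Sum>j\<in>UNIV. \<bar>K j\<bar>)"
        proof (rule sum_mono)
          fix j have "\<bar>Z n w $ j\<bar> \<le> K j" using elim w by blast
          then show "\<bar>Z n w $ j\<bar> \<le> \<bar>K j\<bar>" by linarith
        qed
        finally show "\<bar>f (Z n w) - h (Z n w)\<bar> \<le> 2 * \<epsilon>" by (intro h(3)) (simp add: L_def)
      qed (use A C(2) h(2) \<epsilon> in \<open>auto\<close>)
      also have "\<dots> \<le> 2 * \<epsilon> + (C + (C + \<epsilon>)) * \<eta>"
        using B C \<epsilon> by (intro add_left_mono mult_left_mono) auto
      finally have "\<bar>expectation (\<lambda>w. f (Z n w)) - expectation (\<lambda>w. h (Z n w))\<bar> \<le> 3 * \<epsilon>"
        unfolding \<eta>_eq by simp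
      with fQ elim(2) \<epsilon> show ?case unfolding dist_real_def \<epsilon>_def by linarith
    qed
  qed
  then show "(\<lambda>n. \<integral>x. f x \<partial>distr M borel (Z n)) \<longlonglongrightarrow> (\<integral>x. f x \<partial>Q)"
    by (subst integral_distr) auto
qed

section \<open>Lyapunov's central limit theorem\<close>

lemma exp_minus_quadratic_bound:
  fixes x :: real assumes "x \<ge> 0"
  shows "\<bar>exp (- x) - (1 - x)\<bar> \<le> x\<^sup>2"
proof -
  have "exp (- x) \<ge> 1 - x" using exp_ge_add_one_self[of "- x"] by simp
  moreover have "exp (- x) \<le> 1 - x + x\<^sup>2"
  proof -
    have "exp (- x) = 1 / exp x" by (simp add: exp_minus inverse_eq_divide)
    also have "\<dots> \<le> 1 / (1 + x)" using assms exp_ge_add_one_self[of x] by (intro divide_left_mono) auto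
    also have "\<dots> \<le> 1 - x + x\<^sup>2"
    proof -
      have "(1 - x + x\<^sup>2) * (1 + x) = 1 + x ^ 3" by (simp add: power2_eq_square power3_eq_cube algebra_simps)
      then show ?thesis using assms by (simp add: divide_le_eq)
    qed
    finally show ?thesis .
  qed
  ultimately show ?thesis by simp
qed

text \<open>Splitting at \<open>\<bar>y\<bar> = \<delta>\<close> interpolates the third moment of
  the Taylor remainder between the second and the fourth, the two that are computed for
  exceedances.\<close>

lemma abs_cube_le:
  fixes y :: real assumes "\<delta> > 0"
  shows "\<bar>y\<bar> ^ 3 \<le> \<delta> * y\<^sup>2 + y ^ 4 / \<delta>"
proof (cases "\<bar>y\<bar> \<le> \<delta>")
  case True
  then have "\<bar>y\<bar> * y\<^sup>2 \<le> \<delta> * y\<^sup>2" by (intro mult_right_mono) auto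
  moreover have "\<bar>y\<bar> ^ 3 = \<bar>y\<bar> * y\<^sup>2" by (simp add: power3_eq_cube power2_eq_square)
  ultimately show ?thesis using assms by (simp add: add_increasing2)
next
  case False
  then have "\<delta> * \<bar>y\<bar> ^ 3 \<le> \<bar>y\<bar> * \<bar>y\<bar> ^ 3" by (intro mult_right_mono) auto
  also have "\<dots> = y ^ 4" by (simp add: power_Suc[symmetric] power_even_abs del: power_Suc)
  finally have "\<bar>y\<bar> ^ 3 \<le> y ^ 4 / \<delta>" using assms by (simp add: field_simps)
  then show ?thesis using assms by (simp add: add_increasing)
qed

context prob_space
begin

lemma integrable_power4_imp:
  assumes [measurable]: "Y \<in> borel_measurable M" and int: "integrable M (\<lambda>w. Y w ^ 4 :: real)"
  shows "integrable M (\<lambda>w. (Y w)\<^sup>2)" and "integrable M Y"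
proof -
  have le: "x \<le> 1 + x\<^sup>2" for x :: real
    using sum_power2_ge_zero[of "x - 1/2" 0] zero_le_power2[of "x - 1/2"] by (simp add: power2_eq_square algebra_simps)
  have le2: "(Y w)\<^sup>2 \<le> 1 + Y w ^ 4" for w using le[of "(Y w)\<^sup>2"] by simp
  have bd: "integrable M (\<lambda>w. 2 + Y w ^ 4)" using int by simp
  show "integrable M (\<lambda>w. (Y w)\<^sup>2)"
    by (rule Bochner_Integration.integrable_bound[OF bd]) (use le2 in \<open>auto intro!: AE_I2 simp: add_increasing\<close>, metis add_mono_thms_linordered_semiring(1) add.commute le2 one_le_numeral order_trans add_le_cancel_right)
  show "integrable M Y"
    by (rule square_integrable_imp_integrable) fact+
qed

text \<open>Both \<open>char\<close> and the Gaussian factor are compared with their common Taylor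
  polynomial \<open>1 - t\<^sup>2 * s / 2\<close>, where \<open>s\<close> is the second moment. The
  parameter \<open>\<delta>\<close> is left free to be balanced over a whole row of the
  array.\<close>

lemma char_lyapunov_bound:
  assumes [measurable]: "Y \<in> borel_measurable M" and int: "integrable M (\<lambda>w. Y w ^ 4)"
    and mean: "expectation Y = 0" and "\<delta> > 0"
  shows "cmod (char (distr M borel Y) t - of_real (exp (- (t\<^sup>2 * expectation (\<lambda>w. (Y w)\<^sup>2) / 2)))) \<le>
    \<bar>t\<bar> ^ 3 / 6 * (\<delta> * expectation (\<lambda>w. (Y w)\<^sup>2) + expectation (\<lambda>w. Y w ^ 4) / \<delta>) + t ^ 4 / 4 * expectation (\<lambda>w. Y w ^ 4)"
proof -
  note int2 = integrable_power4_imp[OF assms(1,2)]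
  let ?s = "expectation (\<lambda>w. (Y w)\<^sup>2)" and ?q = "expectation (\<lambda>w. Y w ^ 4)"
  have "cmod (char (distr M borel Y) t - complex_of_real (1 - t\<^sup>2 * ?s / 2)) \<le>
      t\<^sup>2 / 6 * expectation (\<lambda>w. min (6 * (Y w)\<^sup>2) (\<bar>t\<bar> * \<bar>Y w\<bar> ^ 3))"
    by (rule char_approx3') (use int2 mean in auto)
  also have "\<dots> \<le> t\<^sup>2 / 6 * (\<bar>t\<bar> * (\<delta> * ?s + ?q / \<delta>))"
  proof (rule mult_left_mono)
    have "expectation (\<lambda>w. min (6 * (Y w)\<^sup>2) (\<bar>t\<bar> * \<bar>Y w\<bar> ^ 3)) \<le>
        expectation (\<lambda>w. \<bar>t\<bar> * (\<delta> * (Y w)\<^sup>2 + Y w ^ 4 / \<delta>))"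
    proof (rule integral_mono)
      show "integrable M (\<lambda>w. min (6 * (Y w)\<^sup>2) (\<bar>t\<bar> * \<bar>Y w\<bar> ^ 3))"
        by (rule Bochner_Integration.integrable_bound[of M "\<lambda>w. 6 * (Y w)\<^sup>2"]) (use int2 in auto)
      show "integrable M (\<lambda>w. \<bar>t\<bar> * (\<delta> * (Y w)\<^sup>2 + Y w ^ 4 / \<delta>))" using int int2 by auto
      show "min (6 * (Y w)\<^sup>2) (\<bar>t\<bar> * \<bar>Y w\<bar> ^ 3) \<le> \<bar>t\<bar> * (\<delta> * (Y w)\<^sup>2 + Y w ^ 4 / \<delta>)" for w
        by (rule min.coboundedI2, rule mult_left_mono[OF abs_cube_le[OF \<open>\<delta> > 0\<close>]]) simp
    qed
    also have "\<dots> = \<bar>t\<bar> * (\<delta> * ?s + ?q / \<delta>)" using int int2 by simp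
    finally show "expectation (\<lambda>w. min (6 * (Y w)\<^sup>2) (\<bar>t\<bar> * \<bar>Y w\<bar> ^ 3)) \<le> \<bar>t\<bar> * (\<delta> * ?s + ?q / \<delta>)" .
  qed simp
  also have "\<dots> = \<bar>t\<bar> ^ 3 / 6 * (\<delta> * ?s + ?q / \<delta>)"
    by (simp add: power3_eq_cube power2_eq_square)
  finally have 1: "cmod (char (distr M borel Y) t - complex_of_real (1 - t\<^sup>2 * ?s / 2)) \<le> \<bar>t\<bar> ^ 3 / 6 * (\<delta> * ?s + ?q / \<delta>)" .
  \<comment> \<open>Jensen's inequality, as nonnegativity of the variance of the square.\<close>
  have "?s\<^sup>2 \<le> ?q"
  proof -
    have "0 \<le> variance (\<lambda>w. (Y w)\<^sup>2)" by (rule variance_positive)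
    also have "\<dots> = expectation (\<lambda>w. ((Y w)\<^sup>2)\<^sup>2) - ?s\<^sup>2"
      by (rule variance_eq) (use int int2 in simp_all)
    finally show ?thesis by simp
  qed
  have "cmod (complex_of_real (exp (- (t\<^sup>2 * ?s / 2))) - complex_of_real (1 - t\<^sup>2 * ?s / 2))
      = \<bar>exp (- (t\<^sup>2 * ?s / 2)) - (1 - t\<^sup>2 * ?s / 2)\<bar>"
    by (simp only: of_real_diff[symmetric] norm_of_real)
  also have "\<dots> \<le> (t\<^sup>2 * ?s / 2)\<^sup>2" by (rule exp_minus_quadratic_bound) (simp add: integral_nonneg_AE)
  also have "\<dots> = t ^ 4 / 4 * ?s\<^sup>2" by (simp add: power_mult_distrib power_divide)
  also have "\<dots> \<le> t ^ 4 / 4 * ?q" using \<open>?s\<^sup>2 \<le> ?q\<close> by (intro mult_left_mono) auto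
  finally have 2: "cmod (complex_of_real (exp (- (t\<^sup>2 * ?s / 2))) - complex_of_real (1 - t\<^sup>2 * ?s / 2)) \<le> t ^ 4 / 4 * ?q" .
  have "cmod (char (distr M borel Y) t - of_real (exp (- (t\<^sup>2 * ?s / 2)))) \<le>
     cmod (char (distr M borel Y) t - complex_of_real (1 - t\<^sup>2 * ?s / 2))
     + cmod (complex_of_real (exp (- (t\<^sup>2 * ?s / 2))) - complex_of_real (1 - t\<^sup>2 * ?s / 2))"
    using norm_triangle_ineq4[of "char (distr M borel Y) t - complex_of_real (1 - t\<^sup>2 * ?s / 2)"
      "complex_of_real (exp (- (t\<^sup>2 * ?s / 2))) - complex_of_real (1 - t\<^sup>2 * ?s / 2)"] by simp
  with 1 2 show ?thesis by linarith
qed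

lemma lyapunov_char_tendsto:
  fixes Y :: "nat \<Rightarrow> nat \<Rightarrow> 'a \<Rightarrow> real"
  assumes indep: "\<And>n. indep_vars (\<lambda>_. borel) (Y n) (I n)" and fin: "\<And>n. finite (I n)"
    and mean: "\<And>n i. i \<in> I n \<Longrightarrow> expectation (Y n i) = 0"
    and int: "\<And>n i. i \<in> I n \<Longrightarrow> integrable M (\<lambda>w. Y n i w ^ 4)"
    and var: "(\<lambda>n. \<Sum>i\<in>I n. expectation (\<lambda>w. (Y n i w)\<^sup>2)) \<longlonglongrightarrow> v"
    and fourth: "(\<lambda>n. \<Sum>i\<in>I n. expectation (\<lambda>w. Y n i w ^ 4)) \<longlonglongrightarrow> 0"
  shows "(\<lambda>n. char (distr M borel (\<lambda>w. \<Sum>i\<in>I n. Y n i w)) t) \<longlonglongrightarrow> of_real (exp (- (v * t\<^sup>2 / 2)))"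
proof -
  define s where "s n i = expectation (\<lambda>w. (Y n i w)\<^sup>2)" for n i
  define q where "q n i = expectation (\<lambda>w. Y n i w ^ 4)" for n i
  define Q where "Q n = (\<Sum>i\<in>I n. q n i)" for n
  define S where "S n = (\<Sum>i\<in>I n. s n i)" for n
  \<comment> \<open>\<open>\<delta> n\<close> must tend to zero while
    \<open>Q n / \<delta> n\<close> does so too; the square root of \<open>Q n\<close> achieves
    both, and the second summand keeps the divisor positive.\<close>
  define \<delta> where "\<delta> n = sqrt (Q n) + inverse (real (Suc n))" for n
  have meas [measurable]: "Y n i \<in> borel_measurable M" if "i \<in> I n" for n i
    using indep[of n] that unfolding indep_vars_def2 by auto
  have Q0: "Q \<longlonglongrightarrow> 0" using fourth unfolding Q_def q_def .
  have S0: "S \<longlonglongrightarrow> v" using var unfolding S_def s_def .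
  have Q_nn: "Q n \<ge> 0" for n unfolding Q_def q_def by (intro sum_nonneg integral_nonneg_AE) auto
  have \<delta>: "\<delta> n > 0" for n using Q_nn[of n] by (simp add: \<delta>_def add_nonneg_pos)
  have \<delta>0: "\<delta> \<longlonglongrightarrow> 0"
    unfolding \<delta>_def using tendsto_add[OF tendsto_real_sqrt[OF Q0] LIMSEQ_inverse_real_of_nat] by simp
  have bound: "cmod (char (distr M borel (\<lambda>w. \<Sum>i\<in>I n. Y n i w)) t - of_real (exp (- (S n * t\<^sup>2 / 2)))) \<le>
      \<bar>t\<bar> ^ 3 / 6 * (\<delta> n * S n + sqrt (Q n)) + t ^ 4 / 4 * Q n" for n
  proof -
    let ?e = "\<lambda>i. of_real (exp (- (t\<^sup>2 * s n i / 2))) :: complex"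
    have "of_real (exp (- (S n * t\<^sup>2 / 2))) = (\<Prod>i\<in>I n. ?e i)"
      unfolding S_def of_real_prod[symmetric] exp_sum[OF fin, symmetric]
      by (simp add: sum_negf sum_divide_distrib sum_distrib_left sum_distrib_right mult.commute)
    then have "cmod (char (distr M borel (\<lambda>w. \<Sum>i\<in>I n. Y n i w)) t - of_real (exp (- (S n * t\<^sup>2 / 2)))) =
       cmod ((\<Prod>i\<in>I n. char (distr M borel (Y n i)) t) - (\<Prod>i\<in>I n. ?e i))"
      by (simp add: char_distr_sum[OF indep])
    also have "\<dots> \<le> (\<Sum>i\<in>I n. cmod (char (distr M borel (Y n i)) t - ?e i))"
    proof (rule norm_prod_diff)
      fix i assume i: "i \<in> I n"
      show "cmod (char (distr M borel (Y n i)) t) \<le> 1"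
        using i by (intro real_distribution.cmod_char_le_1 real_distribution_distr) auto
      have "s n i \<ge> 0" unfolding s_def by simp
      then show "cmod (?e i) \<le> 1" by simp
    qed
    also have "\<dots> \<le> (\<Sum>i\<in>I n. \<bar>t\<bar> ^ 3 / 6 * (\<delta> n * s n i + q n i / \<delta> n) + t ^ 4 / 4 * q n i)"
      unfolding s_def q_def by (intro sum_mono char_lyapunov_bound mean int \<delta> meas)
    also have "\<dots> = \<bar>t\<bar> ^ 3 / 6 * (\<delta> n * S n + Q n / \<delta> n) + t ^ 4 / 4 * Q n"
      by (simp only: S_def Q_def sum.distrib sum_distrib_left[symmetric] sum_divide_distrib[symmetric])
    also have "\<dots> \<le> \<bar>t\<bar> ^ 3 / 6 * (\<delta> n * S n + sqrt (Q n)) + t ^ 4 / 4 * Q n"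
    proof -
      have "sqrt (Q n) * sqrt (Q n) \<le> sqrt (Q n) * \<delta> n"
        using Q_nn[of n] by (intro mult_left_mono) (auto simp: \<delta>_def)
      then have "Q n / \<delta> n \<le> sqrt (Q n)" using \<delta>[of n] Q_nn[of n] by (simp add: divide_le_eq)
      then show ?thesis by (intro add_right_mono mult_left_mono add_left_mono) auto
    qed
    finally show ?thesis .
  qed
  have "(\<lambda>n. char (distr M borel (\<lambda>w. \<Sum>i\<in>I n. Y n i w)) t - of_real (exp (- (S n * t\<^sup>2 / 2)))) \<longlonglongrightarrow> 0"
  proof (rule Lim_null_comparison[OF always_eventually])
    show "\<forall>n. cmod (char (distr M borel (\<lambda>w. \<Sum>i\<in>I n. Y n i w)) t - of_real (exp (- (S n * t\<^sup>2 / 2)))) \<le>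
      \<bar>t\<bar> ^ 3 / 6 * (\<delta> n * S n + sqrt (Q n)) + t ^ 4 / 4 * Q n"
      using bound by blast
    have "(\<lambda>n. \<bar>t\<bar> ^ 3 / 6 * (\<delta> n * S n + sqrt (Q n)) + t ^ 4 / 4 * Q n) \<longlonglongrightarrow>
        \<bar>t\<bar> ^ 3 / 6 * (0 * v + sqrt 0) + t ^ 4 / 4 * 0"
      by (intro tendsto_intros \<delta>0 S0 Q0)
    then show "(\<lambda>n. \<bar>t\<bar> ^ 3 / 6 * (\<delta> n * S n + sqrt (Q n)) + t ^ 4 / 4 * Q n) \<longlonglongrightarrow> 0" by simp
  qed
  moreover have "(\<lambda>n. complex_of_real (exp (- (S n * t\<^sup>2 / 2)))) \<longlonglongrightarrow> of_real (exp (- (v * t\<^sup>2 / 2)))"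
    by (intro tendsto_intros S0) simp
  ultimately show ?thesis using tendsto_add by fastforce
qed

end

section \<open>Order statistics and the Hill estimator\<close>

lemma sort_nth_le_iff:
  fixes xs :: "real list"
  assumes "i < length xs"
  shows "sort xs ! i \<le> c \<longleftrightarrow> i < length (filter (\<lambda>x. x \<le> c) xs)"
proof -
  let ?ys = "sort xs"
  have len: "length (filter (\<lambda>x. x \<le> c) xs) = card {l. l < length xs \<and> ?ys ! l \<le> c}"
  proof -
    have "mset (filter (\<lambda>x. x \<le> c) xs) = mset (filter (\<lambda>x. x \<le> c) ?ys)"
      by (simp add: mset_filter)
    then have "length (filter (\<lambda>x. x \<le> c) xs) = length (filter (\<lambda>x. x \<le> c) ?ys)"
      by (metis size_mset)
    then show ?thesis by (simp add: length_filter_conv_card)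
  qed
  have mono: "?ys ! p \<le> ?ys ! q" if "p \<le> q" "q < length xs" for p q
    using that by (simp add: sorted_nth_mono)
  show ?thesis
  proof
    assume "?ys ! i \<le> c"
    then have "{..i} \<subseteq> {l. l < length xs \<and> ?ys ! l \<le> c}"
      using mono[of _ i] assms by (auto intro: order_trans)
    then have "card {..i} \<le> card {l. l < length xs \<and> ?ys ! l \<le> c}"
      by (intro card_mono) auto
    then show "i < length (filter (\<lambda>x. x \<le> c) xs)" by (simp add: len)
  next
    assume less: "i < length (filter (\<lambda>x. x \<le> c) xs)"
    show "?ys ! i \<le> c"
    proof (rule ccontr)
      assume neg: "\<not> ?ys ! i \<le> c"
      have "{l. l < length xs \<and> ?ys ! l \<le> c} \<subseteq> {..<i}"
      proof
        fix l assume "l \<in> {l. l < length xs \<and> ?ys ! l \<le> c}"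
        then show "l \<in> {..<i}" using mono[of i l] neg by (cases "l < i") auto
      qed
      then have "card {l. l < length xs \<and> ?ys ! l \<le> c} \<le> card {..<i}"
        by (intro card_mono) auto
      with less show False by (simp add: len)
    qed
  qed
qed

text \<open>The counting form of an order statistic. Measurability, and later the duality between
  quantiles and exceedance counts, rest on it.\<close>

lemma order_stat_le_iff:
  assumes "1 \<le> i" "i \<le> n"
  shows "order_stat x n i \<le> c \<longleftrightarrow> i \<le> card {l \<in> {1..n}. x l \<le> c}"
proof -
  have "length (filter (\<lambda>y. y \<le> c) (map x [1..<Suc n])) = card (set (filter (\<lambda>l. x l \<le> c) [1..<Suc n]))"
    by (simp only: filter_map length_map o_def) (rule distinct_card[symmetric], simp)
  also have "set (filter (\<lambda>l. x l \<le> c) [1..<Suc n]) = {l \<in> {1..n}. x l \<le> c}" by auto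
  finally show ?thesis
    unfolding order_stat_def using assms by (subst sort_nth_le_iff) auto
qed

text \<open>An index beyond the end leaves an unspecified value which depends on the overshoot
  alone. It is the same for all samples, so \<open>order_stat\<close> stays measurable for every
  index.\<close>

lemma nth_length_add: "xs ! (length xs + i) = [] ! i"
  by (induction xs) auto

lemma order_stat_measurable [measurable]:
  assumes [measurable]: "\<And>i. i \<in> {1..n} \<Longrightarrow> x i \<in> borel_measurable M"
  shows "(\<lambda>w. order_stat (\<lambda>i. x i w) n r) \<in> borel_measurable M"
proof (cases "r - 1 < n")
  case True
  \<comment> \<open>Truncated subtraction makes the indices zero and one denote the same
    entry.\<close>
  have eq: "order_stat y n r = order_stat y n (max 1 r)" for y
    by (cases r) (auto simp: order_stat_def)
  show ?thesis
    unfolding eq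
  proof (rule borel_measurableI_le)
    fix c
    have "{w \<in> space M. order_stat (\<lambda>i. x i w) n (max 1 r) \<le> c} =
        {w \<in> space M. real (max 1 r) \<le> (\<Sum>l\<in>{1..n}. indicator {..c} (x l w))}"
    proof -
      have "(\<Sum>l\<in>{1..n}. indicator {..c} (x l w)) = real (card {l \<in> {1..n}. x l w \<le> c})" for w
        by (simp add: indicator_def sum.If_cases Int_def del: sum.cl_ivl_Suc)
      then show ?thesis using True by (subst order_stat_le_iff) (auto simp del: sum.cl_ivl_Suc)
    qed
    also have "\<dots> \<in> sets M" by measurable
    finally show "{w \<in> space M. order_stat (\<lambda>i. x i w) n (max 1 r) \<le> c} \<in> sets M" .
  qed
next
  case False
  have "order_stat y n r = ([] :: real list) ! (r - 1 - n)" for y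
  proof -
    have "r - 1 = length (sort (map y [1..<Suc n])) + (r - 1 - n)" using False by (simp del: upt_Suc)
    then show ?thesis
      unfolding order_stat_def using nth_length_add by metis
  qed
  then show ?thesis by simp
qed

lemma hill_measurable [measurable]:
  assumes [measurable]: "\<And>i. i \<in> {1..n} \<Longrightarrow> x i \<in> borel_measurable M"
  shows "(\<lambda>w. hill (\<lambda>i. x i w) n k) \<in> borel_measurable M"
  unfolding hill_def by measurable

text \<open>Monotonicity is restricted to a set because it will be applied to tail quantile
  functions, which are handled on \<open>{1<..}\<close> only.\<close>

lemma order_stat_mono_on:
  assumes "mono_on S f" "\<And>i. i \<in> {1..n} \<Longrightarrow> x i \<in> S" "1 \<le> r" "r \<le> n"
  shows "order_stat (\<lambda>i. f (x i)) n r = f (order_stat x n r)"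
proof -
  let ?xs = "map x [1..<Suc n]"
  have in_S: "sort ?xs ! p \<in> S" if "p < n" for p
  proof -
    have "sort ?xs ! p \<in> set (sort ?xs)" using that by (intro nth_mem) simp
    then show ?thesis using assms(2) by auto
  qed
  have "sorted (map f (sort ?xs))"
    unfolding sorted_iff_nth_mono
  proof safe
    fix p q assume "p \<le> q" "q < length (map f (sort ?xs))"
    then show "map f (sort ?xs) ! p \<le> map f (sort ?xs) ! q"
      using in_S[of p] in_S[of q] mono_onD[OF assms(1)] by (simp add: sorted_nth_mono del: upt_Suc)
  qed
  moreover have "mset (map f (sort ?xs)) = mset (map (\<lambda>i. f (x i)) [1..<Suc n])"
    by (simp add: image_mset.compositionality comp_def del: upt_Suc)
  ultimately have "sort (map (\<lambda>i. f (x i)) [1..<Suc n]) = map f (sort ?xs)"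
    by (metis properties_for_sort)
  then show ?thesis
    using assms(3,4) by (simp add: order_stat_def del: upt_Suc)
qed

lemma order_stat_in:
  assumes "1 \<le> r" "r \<le> n"
  shows "order_stat x n r \<in> x ` {1..n}"
proof -
  have "order_stat x n r \<in> set (sort (map x [1..<Suc n]))"
    unfolding order_stat_def using assms by (intro nth_mem) auto
  also have "\<dots> = x ` {1..n}" by auto
  finally show ?thesis .
qed

text \<open>Because \<open>f\<close> vanishes up to the threshold, even with ties, the sum over the
  upper order statistics becomes a sum over the unordered sample, to which independence
  applies.\<close>

lemma sum_top_order_stats:
  fixes f :: "real \<Rightarrow> real"
  assumes "k < n" and f: "\<And>y. y \<le> order_stat x n (n - k) \<Longrightarrow> f y = 0"
  shows "(\<Sum>i=1..k. f (order_stat x n (n - i + 1))) = (\<Sum>l=1..n. f (x l))"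
proof -
  let ?ys = "sort (map x [1..<Suc n])"
  have "(\<Sum>l=1..n. f (x l)) = sum_list (map f (map x [1..<Suc n]))"
    by (simp only: map_map sum_set_upt_conv_sum_list_nat[symmetric] atLeastLessThanSuc_atLeastAtMost
        set_upt comp_def sum.distinct_set_conv_list[symmetric] interv_sum_list_conv_sum_set_nat)
  also have "\<dots> = sum_list (map f ?ys)"
    by (metis mset_map mset_sort sum_mset_sum_list)
  also have "\<dots> = (\<Sum>p<n. f (?ys ! p))"
    by (simp add: sum_list_sum_nth atLeast0LessThan del: upt_Suc)
  also have "\<dots> = (\<Sum>p\<in>{n-k..<n}. f (?ys ! p))"
  proof (rule sum.mono_neutral_right)
    show "\<forall>p\<in>{..<n} - {n - k..<n}. f (?ys ! p) = 0"
    proof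
      fix p assume p: "p \<in> {..<n} - {n - k..<n}"
      then have "?ys ! p \<le> ?ys ! (n - k - 1)"
        using \<open>k < n\<close> by (intro sorted_nth_mono) auto
      then show "f (?ys ! p) = 0" by (intro f) (simp add: order_stat_def)
    qed
  qed auto
  also have "\<dots> = (\<Sum>i=1..k. f (order_stat x n (n - i + 1)))"
    by (rule sum.reindex_bij_witness[of _ "\<lambda>i. n - i" "\<lambda>p. n - p"])
       (use \<open>k < n\<close> in \<open>auto simp: order_stat_def\<close>)
  finally show ?thesis ..
qed

text \<open>Ties are allowed, so \<open>k\<close> is only sandwiched between the numbers of strict
  and of weak exceedances of the threshold. Both bounds come from the counting form.\<close>

lemma
  fixes x :: "nat \<Rightarrow> real"
  assumes "1 \<le> k" "k < n"
  defines "t \<equiv> order_stat x n (n - k)"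
  shows order_stat_le_iff_exceed: "t \<le> c \<longleftrightarrow> card {l \<in> {1..n}. c < x l} \<le> k"
    and card_exceed_order_stat: "card {l \<in> {1..n}. t < x l} \<le> k"
    and card_atLeast_order_stat: "k \<le> card {l \<in> {1..n}. t \<le> x l}"
proof -
  show iff: "t \<le> c \<longleftrightarrow> card {l \<in> {1..n}. c < x l} \<le> k" for c
  proof -
    have "{l \<in> {1..n}. c < x l} = {1..n} - {l \<in> {1..n}. x l \<le> c}" by auto
    then have "card {l \<in> {1..n}. c < x l} = card ({1..n} - {l \<in> {1..n}. x l \<le> c})" by (rule arg_cong)
    also have "\<dots> = n - card {l \<in> {1..n}. x l \<le> c}"
      by (subst card_Diff_subset) auto
    finally have "card {l \<in> {1..n}. c < x l} = n - card {l \<in> {1..n}. x l \<le> c}" .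
    moreover have "card {l \<in> {1..n}. x l \<le> c} \<le> n"
      by (rule order_trans[OF card_mono[of "{1..n}"]]) auto
    ultimately show ?thesis
      unfolding t_def using assms(1,2) by (subst order_stat_le_iff) auto
  qed
  show "card {l \<in> {1..n}. t < x l} \<le> k" using iff[of t] by simp
  \<comment> \<open>The largest observation below \<open>t\<close>, or \<open>t - 1\<close> if that
    is larger: exceeding \<open>c\<close> then means reaching \<open>t\<close>.\<close>
  define c where "c = Max (insert (t - 1) (x ` {l \<in> {1..n}. x l < t}))"
  have "c < t" unfolding c_def by (subst Max_less_iff) auto
  then have "k < card {l \<in> {1..n}. c < x l}" using iff[of c] by auto
  also have "{l \<in> {1..n}. c < x l} \<subseteq> {l \<in> {1..n}. t \<le> x l}"
  proof safe
    fix l assume l: "l \<in> {1..n}" "c < x l"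
    show "t \<le> x l"
    proof (rule ccontr)
      assume "\<not> t \<le> x l"
      then have "x l \<le> c" unfolding c_def using l by (intro Max_ge) auto
      with l show False by simp
    qed
  qed
  then have "card {l \<in> {1..n}. c < x l} \<le> card {l \<in> {1..n}. t \<le> x l}" by (intro card_mono) auto
  finally show "k \<le> card {l \<in> {1..n}. t \<le> x l}" by simp
qed

section \<open>Extended regular variation\<close>

text \<open>Pointwise convergence becomes convergence in measure. The interval \<open>{0..3}\<close>
  holds all sums of a point of \<open>{1..2}\<close> and a shift of size at most one.\<close>

lemma measure_exceedance_tendsto_0:
  fixes \<phi> :: "nat \<Rightarrow> real \<Rightarrow> real"
  assumes [measurable]: "\<And>n. \<phi> n \<in> borel_measurable borel"
    and lim: "\<And>v. (\<lambda>n. \<phi> n v) \<longlonglongrightarrow> 0" and "\<epsilon> > 0"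
  shows "(\<lambda>n. measure lborel {v \<in> {0..3}. \<epsilon> < \<bar>\<phi> n v\<bar>}) \<longlonglongrightarrow> 0"
proof -
  have "(\<lambda>n. \<integral>v. indicator {v \<in> {0..3}. \<epsilon> < \<bar>\<phi> n v\<bar>} v \<partial>lborel) \<longlonglongrightarrow> (\<integral>v. (0::real) \<partial>(lborel :: real measure))"
  proof (rule integral_dominated_convergence[where w = "indicator {0..3}"])
    show "AE v in lborel. (\<lambda>n. indicator {v \<in> {0..3}. \<epsilon> < \<bar>\<phi> n v\<bar>} v :: real) \<longlonglongrightarrow> 0"
    proof (rule AE_I2)
      fix v
      have "\<forall>\<^sub>F n in sequentially. \<bar>\<phi> n v\<bar> < \<epsilon>"
        using order_tendstoD(2)[OF tendsto_rabs_zero[OF lim[of v]] \<open>\<epsilon> > 0\<close>] .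
      then show "(\<lambda>n. indicator {v \<in> {0..3}. \<epsilon> < \<bar>\<phi> n v\<bar>} v :: real) \<longlonglongrightarrow> 0"
        by (intro tendsto_eventually) (auto elim!: eventually_mono split: split_indicator)
    qed
  qed (auto split: split_indicator)
  then show ?thesis by simp
qed

text \<open>A Steinhaus-type argument: the exceptional set of \<open>\<psi>\<close> and the
  translated one of \<open>\<phi>\<close> have total measure below one, so they cannot cover
  \<open>{1..2}\<close>.\<close>

lemma eventually_shifted_point:
  fixes \<phi> \<psi> :: "nat \<Rightarrow> real \<Rightarrow> real" and y :: "nat \<Rightarrow> real"
  assumes [measurable]: "\<And>n. \<phi> n \<in> borel_measurable borel" "\<And>n. \<psi> n \<in> borel_measurable borel"
    and lim: "\<And>v. (\<lambda>n. \<phi> n v) \<longlonglongrightarrow> 0" "\<And>v. (\<lambda>n. \<psi> n v) \<longlonglongrightarrow> 0"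
    and y: "\<And>n. \<bar>y n\<bar> \<le> 1" and "\<epsilon> > 0"
  shows "\<forall>\<^sub>F n in sequentially. \<exists>v\<in>{1..2}. \<bar>\<phi> n (v + y n)\<bar> \<le> \<epsilon> \<and> \<bar>\<psi> n v\<bar> \<le> \<epsilon>"
proof -
  let ?B = "\<lambda>\<phi> n. {v \<in> {0..3}. \<epsilon> < \<bar>\<phi> n v :: real\<bar>}"
  have "(\<lambda>n. measure lborel (?B \<phi> n) + measure lborel (?B \<psi> n)) \<longlonglongrightarrow> 0 + 0"
    by (intro tendsto_add measure_exceedance_tendsto_0 assms)
  then have "\<forall>\<^sub>F n in sequentially. measure lborel (?B \<phi> n) + measure lborel (?B \<psi> n) < 1"
    by (rule order_tendstoD) simp
  then show ?thesis
  proof (rule eventually_mono)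
    fix n
    assume elim: "measure lborel (?B \<phi> n) + measure lborel (?B \<psi> n) < 1"
    show "\<exists>v\<in>{1..2}. \<bar>\<phi> n (v + y n)\<bar> \<le> \<epsilon> \<and> \<bar>\<psi> n v\<bar> \<le> \<epsilon>"
    proof (rule ccontr)
      assume neg: "\<not> ?thesis"
      let ?C = "(+) (y n) -` ?B \<phi> n"
      have fin: "emeasure lborel (?B f n) < \<infinity>" for f :: "nat \<Rightarrow> real \<Rightarrow> real"
        by (rule le_less_trans[OF emeasure_mono[of _ "{0..3}"]]) auto
      have "emeasure lborel (?B \<phi> n) = emeasure (distr lborel borel ((+) (y n))) (?B \<phi> n)"
        by (simp add: lborel_distr_plus)
      also have "\<dots> = emeasure lborel ?C"
        by (subst emeasure_distr) auto
      finally have C: "emeasure lborel ?C = emeasure lborel (?B \<phi> n)" ..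
      have "{1..2} \<subseteq> ?C \<union> ?B \<psi> n"
      proof
        fix v :: real assume v: "v \<in> {1..2}"
        then have "\<epsilon> < \<bar>\<phi> n (v + y n)\<bar> \<or> \<epsilon> < \<bar>\<psi> n v\<bar>" using neg by force
        then show "v \<in> ?C \<union> ?B \<psi> n" using v y[of n] by (auto simp: add.commute)
      qed
      then have "emeasure lborel {1..2::real} \<le> emeasure lborel (?C \<union> ?B \<psi> n)"
        by (intro emeasure_mono) auto
      also have "\<dots> \<le> emeasure lborel ?C + emeasure lborel (?B \<psi> n)"
        by (intro emeasure_subadditive) auto
      also have "\<dots> = ennreal (measure lborel (?B \<phi> n) + measure lborel (?B \<psi> n))"
        unfolding C using fin[of \<phi>] fin[of \<psi>] by (simp add: emeasure_eq_ennreal_measure ennreal_plus)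
      also have "\<dots> < 1"
        using elim by (subst ennreal_1[symmetric], subst ennreal_less_iff) (auto simp del: ennreal_1)
      finally show False by simp
    qed
  qed
qed

lemma shifted_points:
  fixes \<phi> \<psi> :: "nat \<Rightarrow> real \<Rightarrow> real" and y :: "nat \<Rightarrow> real"
  assumes meas: "\<And>n. \<phi> n \<in> borel_measurable borel" "\<And>n. \<psi> n \<in> borel_measurable borel"
    and lim: "\<And>v. (\<lambda>n. \<phi> n v) \<longlonglongrightarrow> 0" "\<And>v. (\<lambda>n. \<psi> n v) \<longlonglongrightarrow> 0"
    and y: "\<And>n. \<bar>y n\<bar> \<le> 1"
  obtains v where "\<And>n. v n \<in> {1..2}" "(\<lambda>n. \<phi> n (v n + y n)) \<longlonglongrightarrow> 0" "(\<lambda>n. \<psi> n (v n)) \<longlonglongrightarrow> 0"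
proof -
  \<comment> \<open>Near-minimisers of the larger error serve all tolerances at once, which yields
    one sequence of points.\<close>
  define g where "g n v = max \<bar>\<phi> n (v + y n)\<bar> \<bar>\<psi> n v\<bar>" for n v
  define m where "m n = Inf (g n ` {1..2})" for n
  have bdd: "bdd_below (g n ` {1..2})" for n
    by (rule bdd_belowI[of _ 0]) (auto simp: g_def le_max_iff_disj)
  have "\<exists>v\<in>{1..2}. g n v < m n + 1 / Suc n" for n
    using cInf_lessD[of "g n ` {1..2}" "m n + 1 / Suc n"] by (auto simp: m_def)
  then obtain v where v: "\<And>n. v n \<in> {1..2}" "\<And>n. g n (v n) < m n + 1 / Suc n"
    by metis
  have "(\<lambda>n. g n (v n)) \<longlonglongrightarrow> 0"
  proof (rule tendstoI)
    fix e :: real assume "e > 0"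
    then have "e / 2 > 0" by simp
    have "\<forall>\<^sub>F n in sequentially. 1 / real (Suc n) < e / 2"
      using order_tendstoD(2)[OF LIMSEQ_inverse_real_of_nat \<open>e/2 > 0\<close>] by (simp add: inverse_eq_divide)
    with eventually_shifted_point[where \<phi> = \<phi> and \<psi> = \<psi> and y = y, OF assms \<open>e/2 > 0\<close>]
    show "\<forall>\<^sub>F n in sequentially. dist (g n (v n)) 0 < e"
    proof eventually_elim
      case (elim n)
      then obtain u where "u \<in> {1..2}" "g n u \<le> e / 2" by (auto simp: g_def)
      then have "m n \<le> e / 2" unfolding m_def using bdd[of n] by (meson cINF_lower order_trans)
      with v(2)[of n] elim have "g n (v n) < e" by linarith
      moreover have "g n (v n) \<ge> 0" by (simp add: g_def le_max_iff_disj)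
      ultimately show ?case by simp
    qed
  qed
  note g0 = this
  have "(\<lambda>n. \<phi> n (v n + y n)) \<longlonglongrightarrow> 0"
    by (rule Lim_null_comparison[OF always_eventually g0]) (simp add: g_def)
  moreover have "(\<lambda>n. \<psi> n (v n)) \<longlonglongrightarrow> 0"
    by (rule Lim_null_comparison[OF always_eventually g0]) (simp add: g_def)
  ultimately show thesis using that[of v] v(1) by blast
qed

text \<open>The limit \<open>(x powr \<rho> - 1) / \<rho>\<close> of the second-order condition at
  \<open>x = exp y\<close>. On the logarithmic scale, multiplication of the argument becomes a
  shift.\<close>

definition erv_limit :: "real \<Rightarrow> real \<Rightarrow> real" where
  "erv_limit \<rho> y = (if \<rho> = 0 then y else (exp (\<rho> * y) - 1) / \<rho>)"

text \<open>Cocycle identity; it relates increments taken from two base points.\<close>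

lemma erv_limit_add: "erv_limit \<rho> (v + y) = erv_limit \<rho> y + exp (\<rho> * y) * erv_limit \<rho> v"
  by (auto simp: erv_limit_def field_simps exp_add)

lemma erv_limit_0: "erv_limit \<rho> 0 = 0"
  by (simp add: erv_limit_def)

lemma erv_limit_1_pos: "erv_limit \<rho> 1 > 0"
  by (cases "\<rho> < 0") (auto simp: erv_limit_def zero_less_divide_iff divide_neg_neg)

lemma continuous_erv_limit: "continuous_on UNIV (erv_limit \<rho>)"
  by (cases "\<rho> = 0") (auto simp: erv_limit_def[abs_def] intro!: continuous_intros)

lemma erv_limit_measurable [measurable]: "erv_limit \<rho> \<in> borel_measurable borel"
  by (rule borel_measurable_continuous_onI[OF continuous_erv_limit])

lemma erv_limit_bounded:
  obtains K where "K > 0" "\<And>v. v \<in> {a..b} \<Longrightarrow> \<bar>erv_limit \<rho> v\<bar> \<le> K"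
proof -
  have "bounded (erv_limit \<rho> ` {a..b})"
    by (intro compact_imp_bounded compact_continuous_image continuous_on_subset[OF continuous_erv_limit]) auto
  then show thesis
    using that unfolding bounded_pos by (metis imageI real_norm_def)
qed

text \<open>The unit increment at \<open>s + y\<close> is a difference of two increments at
  \<open>s\<close>, so its ratio to \<open>a s\<close> converges; dividing by its ratio to
  \<open>a (s + y)\<close> leaves the ratio of the auxiliary functions.\<close>

lemma erv_auxiliary_ratio:
  fixes G a :: "real \<Rightarrow> real"
  assumes lim: "\<And>y. ((\<lambda>s. (G (s + y) - G s) / a s) \<longlongrightarrow> erv_limit \<rho> y) at_top"
    and nz: "\<forall>\<^sub>F s in at_top. a s \<noteq> 0"
  shows "((\<lambda>s. a (s + y) / a s) \<longlongrightarrow> exp (\<rho> * y)) at_top"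
proof -
  have sh: "filterlim (\<lambda>s::real. s + y) at_top at_top"
    by (rule filterlim_at_top_mono[OF filterlim_tendsto_add_at_top[OF tendsto_const[of y] filterlim_ident]])
       (simp add: add.commute)
  have lim1: "((\<lambda>s. (G (s + y + 1) - G (s + y)) / a (s + y)) \<longlongrightarrow> erv_limit \<rho> 1) at_top"
    using filterlim_compose[OF lim[of 1] sh] by simp
  have "((\<lambda>s. ((G (s + (y + 1)) - G s) / a s - (G (s + y) - G s) / a s) /
            ((G (s + y + 1) - G (s + y)) / a (s + y)))
      \<longlongrightarrow> (erv_limit \<rho> (1 + y) - erv_limit \<rho> y) / erv_limit \<rho> 1) at_top"
    using erv_limit_1_pos[of \<rho>] lim[of "1 + y"] by (intro tendsto_divide tendsto_diff lim lim1) (auto simp: add.commute)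
  also have "(erv_limit \<rho> (1 + y) - erv_limit \<rho> y) / erv_limit \<rho> 1 = exp (\<rho> * y)"
    using erv_limit_1_pos[of \<rho>] by (simp add: erv_limit_add)
  finally show ?thesis
  proof (rule Lim_transform_eventually)
    have "\<forall>\<^sub>F s in at_top. (G (s + y + 1) - G (s + y)) / a (s + y) > 0"
      using order_tendstoD(1)[OF lim1 erv_limit_1_pos] .
    with nz show "\<forall>\<^sub>F s in at_top. ((G (s + (y + 1)) - G s) / a s - (G (s + y) - G s) / a s) /
            ((G (s + y + 1) - G (s + y)) / a (s + y)) = a (s + y) / a s"
    proof eventually_elim
      case (elim s)
      then have "G (s + y + 1) - G (s + y) \<noteq> 0" "a (s + y) \<noteq> 0" by (force, force)
      with elim show ?case
        by (simp add: diff_divide_distrib[symmetric] add.assoc)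
    qed
  qed
qed

text \<open>A point \<open>v\<close> outside small exceptional sets links \<open>s\<close> and \<open>s + y\<close>
  through \<open>s + y + v\<close>, so measurability suffices.\<close>

lemma erv_uniform:
  fixes G a :: "real \<Rightarrow> real" and s y :: "nat \<Rightarrow> real"
  assumes [measurable]: "G \<in> borel_measurable borel" "a \<in> borel_measurable borel"
    and lim: "\<And>y. ((\<lambda>s. (G (s + y) - G s) / a s) \<longlongrightarrow> erv_limit \<rho> y) at_top"
    and nz: "\<forall>\<^sub>F s in at_top. a s \<noteq> 0" and \<rho>: "\<rho> \<le> 0"
    and s: "filterlim s at_top sequentially" and y: "\<And>n. \<bar>y n\<bar> \<le> 1"
  shows "(\<lambda>n. (G (s n + y n) - G (s n)) / a (s n) - erv_limit \<rho> (y n)) \<longlonglongrightarrow> 0"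
proof -
  define F where "F t v = (G (t + v) - G t) / a t - erv_limit \<rho> v" for t v
  define r where "r t v = a (t + v) / a t - exp (\<rho> * v)" for t v
  define t where "t n = s n + y n" for n
  have t: "filterlim t at_top sequentially"
    unfolding t_def
  proof (rule filterlim_at_top_mono[where f = "\<lambda>n. - 1 + s n"])
    show "filterlim (\<lambda>n. - 1 + s n) at_top sequentially"
      by (rule filterlim_tendsto_add_at_top[OF tendsto_const s])
    have "- 1 + s n \<le> s n + y n" for n using y[of n] by (simp add: abs_le_iff)
    then show "\<forall>\<^sub>F n in sequentially. - 1 + s n \<le> s n + y n" by simp
  qed
  have [measurable]: "F t \<in> borel_measurable borel" "r t \<in> borel_measurable borel" for t
    unfolding F_def[abs_def] r_def[abs_def] by measurable
  have limF: "((\<lambda>t. F t v) \<longlongrightarrow> 0) at_top" for v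
    unfolding F_def using lim[of v] by (simp add: LIM_zero_iff)
  have limr: "((\<lambda>t. r t v) \<longlongrightarrow> 0) at_top" for v
    unfolding r_def using erv_auxiliary_ratio[OF lim nz, of v] by (simp add: LIM_zero_iff)
  have lim0: "(\<lambda>n. \<bar>F (u n) v\<bar> + \<bar>r (u n) v\<bar>) \<longlonglongrightarrow> 0" if "filterlim u at_top sequentially" for u v
    using tendsto_add[OF tendsto_rabs[OF filterlim_compose[OF limF that, of v]]
        tendsto_rabs[OF filterlim_compose[OF limr that, of v]]] by simp
  \<comment> \<open>The errors of increments and of auxiliary ratios are added up first, so that one
    point \<open>v n\<close> is good for all four limits.\<close>
  obtain v where v: "\<And>n. v n \<in> {1..2}"
    and s0: "(\<lambda>n. \<bar>F (s n) (v n + y n)\<bar> + \<bar>r (s n) (v n + y n)\<bar>) \<longlonglongrightarrow> 0"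
    and t0: "(\<lambda>n. \<bar>F (t n) (v n)\<bar> + \<bar>r (t n) (v n)\<bar>) \<longlonglongrightarrow> 0"
    using shifted_points[of "\<lambda>n v. \<bar>F (s n) v\<bar> + \<bar>r (s n) v\<bar>" "\<lambda>n v. \<bar>F (t n) v\<bar> + \<bar>r (t n) v\<bar>" y]
      lim0[OF s] lim0[OF t] y by (auto)
  have Fs: "(\<lambda>n. F (s n) (v n + y n)) \<longlonglongrightarrow> 0" and rs: "(\<lambda>n. r (s n) (v n + y n)) \<longlonglongrightarrow> 0"
    by (auto intro: Lim_null_comparison[OF _ s0] always_eventually)
  have Ft: "(\<lambda>n. F (t n) (v n)) \<longlonglongrightarrow> 0" and rt: "(\<lambda>n. r (t n) (v n)) \<longlonglongrightarrow> 0"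
    by (auto intro: Lim_null_comparison[OF _ t0] always_eventually)
  define E where "E n = exp (\<rho> * y n)" for n
  have E: "0 \<le> E n" "E n \<le> exp (- \<rho>)" for n
  proof -
    have "(- \<rho>) * (- y n) \<le> (- \<rho>) * 1"
      using y[of n] \<rho> by (intro mult_left_mono) auto
    then show "0 \<le> E n" "E n \<le> exp (- \<rho>)" by (auto simp: E_def)
  qed
  let ?d = "exp (\<rho> * 2)"
  have lower: "\<forall>\<^sub>F n in sequentially. ?d / 2 \<le> a (t n + v n) / a (t n)"
  proof -
    have "\<forall>\<^sub>F n in sequentially. \<bar>r (t n) (v n)\<bar> < ?d / 2"
      by (rule order_tendstoD(2)[OF tendsto_rabs_zero[OF rt]]) simp
    then show ?thesis
    proof eventually_elim
      case (elim n)
      have "\<rho> * 2 \<le> \<rho> * v n" using v[of n] \<rho> by (simp add: mult_left_mono_neg)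
      then have "?d \<le> exp (\<rho> * v n)" by simp
      with elim show ?case unfolding r_def by linarith
    qed
  qed
  have nzs: "\<forall>\<^sub>F n in sequentially. a (s n) \<noteq> 0" and nzt: "\<forall>\<^sub>F n in sequentially. a (t n) \<noteq> 0"
    using eventually_compose_filterlim[OF nz s] eventually_compose_filterlim[OF nz t] .
  \<comment> \<open>Both \<open>a (s n)\<close> and \<open>a (t n)\<close> are compared with
    \<open>a\<close> at the common point \<open>t n + v n\<close>; dividing is safe because the
    ratio there stays away from zero.\<close>
  have ratio: "(\<lambda>n. a (t n) / a (s n) - E n) \<longlonglongrightarrow> 0"
  proof (rule Lim_null_comparison)
    show "(\<lambda>n. (\<bar>r (s n) (v n + y n)\<bar> + exp (- \<rho>) * \<bar>r (t n) (v n)\<bar>) * (2 / ?d)) \<longlonglongrightarrow> 0"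
      by (intro tendsto_mult_left_zero tendsto_add_zero tendsto_mult_right_zero tendsto_rabs_zero rs rt)
    show "\<forall>\<^sub>F n in sequentially. norm (a (t n) / a (s n) - E n) \<le>
        (\<bar>r (s n) (v n + y n)\<bar> + exp (- \<rho>) * \<bar>r (t n) (v n)\<bar>) * (2 / ?d)"
      using lower nzs nzt
    proof eventually_elim
      case (elim n)
      define q where "q = a (t n + v n) / a (t n)"
      have "0 < ?d / 2" by simp
      moreover have "?d / 2 \<le> q" using elim(1) by (simp add: q_def)
      ultimately have q: "?d / 2 \<le> q" "q > 0" by linarith+
      have "a (s n + (v n + y n)) / a (s n) = q * (a (t n) / a (s n))"
      proof -
        have eq: "s n + (v n + y n) = t n + v n" by (simp add: t_def)
        show ?thesis unfolding eq using elim by (simp add: q_def)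
      qed
      then have "q * (a (t n) / a (s n) - E n) = r (s n) (v n + y n) - E n * r (t n) (v n)"
        unfolding r_def q_def[symmetric] E_def distrib_left exp_add
        by (simp only: right_diff_distrib mult.commute)
      then have "a (t n) / a (s n) - E n = (r (s n) (v n + y n) - E n * r (t n) (v n)) / q"
        using q by (simp add: field_simps)
      also have "norm \<dots> = \<bar>r (s n) (v n + y n) - E n * r (t n) (v n)\<bar> * (1 / q)"
        using q by (simp add: abs_divide)
      also have "\<dots> \<le> (\<bar>r (s n) (v n + y n)\<bar> + exp (- \<rho>) * \<bar>r (t n) (v n)\<bar>) * (2 / ?d)"
      proof (rule mult_mono)
        have "\<bar>E n * r (t n) (v n)\<bar> \<le> exp (- \<rho>) * \<bar>r (t n) (v n)\<bar>"
          using E[of n] by (simp add: abs_mult mult_right_mono)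
        then show "\<bar>r (s n) (v n + y n) - E n * r (t n) (v n)\<bar> \<le>
            \<bar>r (s n) (v n + y n)\<bar> + exp (- \<rho>) * \<bar>r (t n) (v n)\<bar>"
          by linarith
        show "1 / q \<le> 2 / ?d" using q by (simp add: field_simps)
      qed (use q in auto)
      finally show ?case .
    qed
  qed
  obtain K where K: "\<And>v. v \<in> {1..2} \<Longrightarrow> \<bar>erv_limit \<rho> v\<bar> \<le> K"
    using erv_limit_bounded by blast
  show ?thesis
  proof (rule Lim_null_comparison)
    show "(\<lambda>n. \<bar>F (s n) (v n + y n)\<bar> + \<bar>F (t n) (v n)\<bar> * \<bar>a (t n) / a (s n) - E n\<bar>
        + exp (- \<rho>) * \<bar>F (t n) (v n)\<bar> + K * \<bar>a (t n) / a (s n) - E n\<bar>) \<longlonglongrightarrow> 0"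
      by (intro tendsto_add_zero tendsto_mult_zero tendsto_mult_right_zero tendsto_rabs_zero Fs Ft ratio)
    show "\<forall>\<^sub>F n in sequentially. norm ((G (s n + y n) - G (s n)) / a (s n) - erv_limit \<rho> (y n)) \<le>
        \<bar>F (s n) (v n + y n)\<bar> + \<bar>F (t n) (v n)\<bar> * \<bar>a (t n) / a (s n) - E n\<bar>
        + exp (- \<rho>) * \<bar>F (t n) (v n)\<bar> + K * \<bar>a (t n) / a (s n) - E n\<bar>"
      using nzs nzt
    proof eventually_elim
      case (elim n)
      define q where "q = a (t n) / a (s n)"
      define h where "h = erv_limit \<rho> (v n)"
      have "(G (t n + v n) - G (t n)) / a (t n) = F (t n) (v n) + h"
        by (simp add: F_def h_def)
      from this[symmetric] have "(F (t n) (v n) + h) * q = (G (t n + v n) - G (t n)) / a (s n)"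
        using elim by (simp add: q_def)
      moreover have "(G (t n + v n) - G (s n)) / a (s n)
          = F (s n) (v n + y n) + erv_limit \<rho> (y n) + E n * h"
        by (simp add: F_def h_def t_def E_def erv_limit_add add_ac)
      moreover have "(G (t n) - G (s n)) / a (s n)
          = (G (t n + v n) - G (s n)) / a (s n) - (G (t n + v n) - G (t n)) / a (s n)"
        by (simp add: diff_divide_distrib)
      ultimately have "(G (s n + y n) - G (s n)) / a (s n) - erv_limit \<rho> (y n)
          = F (s n) (v n + y n) + E n * h - (F (t n) (v n) + h) * q"
        unfolding t_def[symmetric] by linarith
      also have "\<dots> = F (s n) (v n + y n) - F (t n) (v n) * (q - E n) - E n * F (t n) (v n) - h * (q - E n)"
        by (simp add: algebra_simps)
      finally have eq: "(G (s n + y n) - G (s n)) / a (s n) - erv_limit \<rho> (y n) = \<dots>" .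
      have "\<bar>E n * F (t n) (v n)\<bar> \<le> exp (- \<rho>) * \<bar>F (t n) (v n)\<bar>"
        using E[of n] by (simp add: abs_mult mult_right_mono)
      moreover have "\<bar>h * (q - E n)\<bar> \<le> K * \<bar>q - E n\<bar>"
        using K[OF v] by (simp add: h_def abs_mult mult_right_mono)
      moreover have "\<bar>F (t n) (v n) * (q - E n)\<bar> = \<bar>F (t n) (v n)\<bar> * \<bar>q - E n\<bar>"
        by (simp add: abs_mult)
      ultimately show ?case unfolding eq q_def[symmetric] real_norm_def by linarith
    qed
  qed
qed

lemma erv_locally_uniform:
  fixes G a :: "real \<Rightarrow> real"
  assumes meas: "G \<in> borel_measurable borel" "a \<in> borel_measurable borel"
    and lim: "\<And>y. ((\<lambda>s. (G (s + y) - G s) / a s) \<longlongrightarrow> erv_limit \<rho> y) at_top"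
    and nz: "\<forall>\<^sub>F s in at_top. a s \<noteq> 0" and \<rho>: "\<rho> \<le> 0" and "\<epsilon> > 0"
  shows "\<forall>\<^sub>F s in at_top. \<forall>y\<in>{-1..1}. \<bar>(G (s + y) - G s) / a s - erv_limit \<rho> y\<bar> < \<epsilon>"
proof (rule ccontr)
  assume "\<not> ?thesis"
  then have "\<exists>s\<ge>real n. \<exists>y\<in>{-1..1}. \<not> \<bar>(G (s + y) - G s) / a s - erv_limit \<rho> y\<bar> < \<epsilon>" for n
    unfolding eventually_at_top_linorder by blast
  then obtain s y where s: "\<And>n. s n \<ge> real n" and y: "\<And>n. y n \<in> {-1..1}"
    and neg: "\<And>n. \<not> \<bar>(G (s n + y n) - G (s n)) / a (s n) - erv_limit \<rho> (y n)\<bar> < \<epsilon>"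
    by metis
  have "filterlim s at_top sequentially"
    by (rule filterlim_at_top_mono[OF filterlim_real_sequentially]) (simp add: s)
  then have "(\<lambda>n. (G (s n + y n) - G (s n)) / a (s n) - erv_limit \<rho> (y n)) \<longlonglongrightarrow> 0"
    using y by (intro erv_uniform[OF assms(1-5)]) (auto simp: abs_le_iff)
  from order_tendstoD(2)[OF tendsto_rabs_zero[OF this] \<open>\<epsilon> > 0\<close>] neg show False
    by (simp add: eventually_sequentially)
qed

text \<open>\<open>erv_limit\<close> is continuous and vanishes at zero. This is what allows the
  random threshold to be replaced by a fixed level in the remainder \<open>G\<close>.\<close>

lemma erv_small_increments:
  fixes G a :: "real \<Rightarrow> real"
  assumes meas: "G \<in> borel_measurable borel" "a \<in> borel_measurable borel"
    and lim: "\<And>y. ((\<lambda>s. (G (s + y) - G s) / a s) \<longlongrightarrow> erv_limit \<rho> y) at_top"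
    and nz: "\<forall>\<^sub>F s in at_top. a s \<noteq> 0" and \<rho>: "\<rho> \<le> 0" and "\<epsilon> > 0"
  obtains \<delta> where "\<delta> > 0" "\<forall>\<^sub>F s in at_top. \<forall>y. \<bar>y\<bar> \<le> \<delta> \<longrightarrow> \<bar>G (s + y) - G s\<bar> \<le> \<epsilon> * \<bar>a s\<bar>"
proof -
  have "\<epsilon> / 2 > 0" using \<open>\<epsilon> > 0\<close> by simp
  have "isCont (erv_limit \<rho>) 0"
    using continuous_erv_limit[of \<rho>] by (simp add: continuous_on_eq_continuous_at)
  then obtain d where d: "d > 0" "\<And>y. \<bar>y\<bar> < d \<Longrightarrow> \<bar>erv_limit \<rho> y\<bar> < \<epsilon> / 2"
    using \<open>\<epsilon> / 2 > 0\<close> unfolding continuous_at_eps_delta erv_limit_0 dist_real_def diff_0_right by blast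
  show thesis
  proof (rule that)
    show "min (d / 2) 1 > 0" using d by simp
    show "\<forall>\<^sub>F s in at_top. \<forall>y. \<bar>y\<bar> \<le> min (d / 2) 1 \<longrightarrow> \<bar>G (s + y) - G s\<bar> \<le> \<epsilon> * \<bar>a s\<bar>"
      using erv_locally_uniform[OF assms(1-5) \<open>\<epsilon> / 2 > 0\<close>] nz
    proof eventually_elim
      case (elim s)
      show ?case
      proof safe
        fix y :: real assume y: "\<bar>y\<bar> \<le> min (d / 2) 1"
        then have "y \<in> {-1..1}" "\<bar>y\<bar> < d" using d(1) by auto
        then have "\<bar>(G (s + y) - G s) / a s - erv_limit \<rho> y\<bar> < \<epsilon> / 2" "\<bar>erv_limit \<rho> y\<bar> < \<epsilon> / 2"
          using elim(1) d(2) by blast+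
        then have "\<bar>(G (s + y) - G s) / a s\<bar> \<le> \<epsilon>" by linarith
        then show "\<bar>G (s + y) - G s\<bar> \<le> \<epsilon> * \<bar>a s\<bar>"
          using elim(2) by (simp add: abs_divide divide_le_eq)
      qed
    qed
  qed
qed

text \<open>Unit steps are chained: the auxiliary function grows by a factor of at most
  \<open>exp (1 / 8)\<close> per step, its limiting factor being \<open>exp \<rho> \<le> 1\<close>.
  The exponent \<open>1 / 4\<close> leaves room for squares to be integrable against the exponential
  law.\<close>

lemma erv_potter_bound:
  fixes G a :: "real \<Rightarrow> real"
  assumes meas: "G \<in> borel_measurable borel" "a \<in> borel_measurable borel"
    and lim: "\<And>y. ((\<lambda>s. (G (s + y) - G s) / a s) \<longlongrightarrow> erv_limit \<rho> y) at_top"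
    and nz: "\<forall>\<^sub>F s in at_top. a s \<noteq> 0" and \<rho>: "\<rho> \<le> 0"
  obtains K where "K > 0" "\<forall>\<^sub>F s in at_top. \<forall>y\<ge>0. \<bar>G (s + y) - G s\<bar> \<le> K * \<bar>a s\<bar> * exp (y / 4)"
proof -
  obtain L where L: "L > 0" "\<And>v. v \<in> {-1..1} \<Longrightarrow> \<bar>erv_limit \<rho> v\<bar> \<le> L"
    using erv_limit_bounded by blast
  have "exp (\<rho> * 1) < exp (1 / 8)" using \<rho> by simp
  then have "\<forall>\<^sub>F s in at_top. \<bar>a (s + 1) / a s\<bar> < exp (1 / 8)"
    using order_tendstoD(2)[OF tendsto_rabs[OF erv_auxiliary_ratio[OF lim nz, of 1]]] by simp
  with erv_locally_uniform[OF assms zero_less_one] nz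
  have "\<forall>\<^sub>F s in at_top. (\<forall>y\<in>{0..1}. \<bar>G (s + y) - G s\<bar> \<le> (L + 1) * \<bar>a s\<bar>) \<and> \<bar>a (s + 1)\<bar> \<le> exp (1 / 8) * \<bar>a s\<bar>"
  proof eventually_elim
    case (elim s)
    have "\<bar>G (s + y) - G s\<bar> \<le> (L + 1) * \<bar>a s\<bar>" if "y \<in> {0..1}" for y
    proof -
      have "y \<in> {-1..1}" using that by auto
      with elim(1) L(2)[of y] have "\<bar>(G (s + y) - G s) / a s\<bar> \<le> L + 1" by fastforce
      then show ?thesis using elim(2) by (simp add: abs_divide divide_le_eq)
    qed
    moreover have "\<bar>a (s + 1)\<bar> \<le> exp (1 / 8) * \<bar>a s\<bar>"
      using elim(2,3) by (simp add: abs_divide divide_less_eq)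
    ultimately show ?case by blast
  qed
  then obtain s0 where s0: "\<And>s y. s \<ge> s0 \<Longrightarrow> y \<in> {0..1} \<Longrightarrow> \<bar>G (s + y) - G s\<bar> \<le> (L + 1) * \<bar>a s\<bar>"
    "\<And>s. s \<ge> s0 \<Longrightarrow> \<bar>a (s + 1)\<bar> \<le> exp (1 / 8) * \<bar>a s\<bar>"
    unfolding eventually_at_top_linorder by blast
  have step: "\<bar>G (s + real m + u) - G s\<bar> \<le> (L + 1) * \<bar>a s\<bar> * (real m + 1) * exp (1 / 8) ^ m"
    if "s \<ge> s0" "u \<in> {0..1}" for s m u
    using that(1)
  proof (induction m arbitrary: s)
    case 0
    then show ?case using s0(1)[OF _ that(2), of s] by simp
  next
    case (Suc m)
    have "\<bar>G (s + 1 + real m + u) - G (s + 1)\<bar> \<le> (L + 1) * \<bar>a (s + 1)\<bar> * (real m + 1) * exp (1 / 8) ^ m"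
      using Suc.prems by (intro Suc.IH) simp
    also have "\<dots> \<le> (L + 1) * (exp (1 / 8) * \<bar>a s\<bar>) * (real m + 1) * exp (1 / 8) ^ m"
      using L(1) s0(2)[OF Suc.prems] by (intro mult_right_mono mult_left_mono) auto
    finally have 1: "\<bar>G (s + 1 + real m + u) - G (s + 1)\<bar> \<le> (L + 1) * \<bar>a s\<bar> * (real m + 1) * exp (1 / 8) ^ Suc m"
      by (simp add: ac_simps)
    have "\<bar>G (s + 1) - G s\<bar> \<le> (L + 1) * \<bar>a s\<bar> * 1"
      using s0(1)[OF Suc.prems, of 1] by simp
    also have "\<dots> \<le> (L + 1) * \<bar>a s\<bar> * exp (1 / 8) ^ Suc m"
      using L(1) by (intro mult_left_mono one_le_power) auto
    finally have 2: "\<bar>G (s + 1) - G s\<bar> \<le> (L + 1) * \<bar>a s\<bar> * exp (1 / 8) ^ Suc m" .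
    have "(L + 1) * \<bar>a s\<bar> * (real (Suc m) + 1) * exp (1 / 8) ^ Suc m =
      (L + 1) * \<bar>a s\<bar> * (real m + 1) * exp (1 / 8) ^ Suc m + (L + 1) * \<bar>a s\<bar> * exp (1 / 8) ^ Suc m"
      by (simp add: algebra_simps)
    moreover have eq: "s + real (Suc m) + u = s + 1 + real m + u" by simp
    ultimately show ?case
      using 1 2 abs_triangle_ineq[of "G (s + 1 + real m + u) - G (s + 1)" "G (s + 1) - G s"]
      unfolding eq by linarith
  qed
  show thesis
  proof (rule that)
    show "(L + 1) * 8 > 0" using L by simp
    show "\<forall>\<^sub>F s in at_top. \<forall>y\<ge>0. \<bar>G (s + y) - G s\<bar> \<le> (L + 1) * 8 * \<bar>a s\<bar> * exp (y / 4)"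
    proof (rule eventually_at_top_linorderI[of s0], safe)
      fix s y :: real assume s: "s0 \<le> s" and y: "0 \<le> y"
      define m where "m = nat \<lfloor>y\<rfloor>"
      have m: "real m \<le> y" "y - real m \<in> {0..1}" using y by (auto simp: m_def) linarith
      \<comment> \<open>The linear number of steps is absorbed in a second factor
        \<open>exp (y / 8)\<close>, which brings the exponent to \<open>y / 4\<close>.\<close>
      have "real m + 1 \<le> 8 * exp (y / 8)"
        using exp_ge_add_one_self[of "y / 8"] m(1) by linarith
      moreover have "exp (1 / 8) ^ m \<le> exp (y / 8)"
        using m(1) by (simp add: exp_of_nat_mult[symmetric])
      ultimately have "(real m + 1) * exp (1 / 8) ^ m \<le> (8 * exp (y / 8)) * exp (y / 8)"
        by (intro mult_mono) auto
      also have "\<dots> = 8 * exp (y / 4)" by (simp add: exp_add[symmetric])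
      finally have bound: "(real m + 1) * exp (1 / 8) ^ m \<le> 8 * exp (y / 4)" .
      have "\<bar>G (s + y) - G s\<bar> \<le> (L + 1) * \<bar>a s\<bar> * ((real m + 1) * exp (1 / 8) ^ m)"
        using step[OF s m(2), of m] by (simp add: mult.assoc)
      also have "\<dots> \<le> (L + 1) * \<bar>a s\<bar> * (8 * exp (y / 4))"
        using L(1) bound by (intro mult_left_mono) auto
      also have "\<dots> = (L + 1) * 8 * \<bar>a s\<bar> * exp (y / 4)" by (simp only: ac_simps)
      finally show "\<bar>G (s + y) - G s\<bar> \<le> (L + 1) * 8 * \<bar>a s\<bar> * exp (y / 4)" .
    qed
  qed
qed

section \<open>The exponential distribution\<close>

definition expo :: "real measure" where
  "expo = density lborel (exponential_density 1)"

lemma sets_expo [measurable_cong, simp]: "sets expo = sets borel"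
  and space_expo [simp]: "space expo = UNIV"
  by (auto simp: expo_def)

lemma real_distribution_expo: "real_distribution expo"
  unfolding expo_def real_distribution_def real_distribution_axioms_def
  by (auto intro: prob_space_exponential_density)

interpretation expo: real_distribution expo by (rule real_distribution_expo)

lemma AE_expo_nonneg: "AE x in expo. x > 0"
proof -
  have "AE x in lborel. x \<noteq> (0::real)" by (rule AE_lborel_singleton)
  then show ?thesis
    unfolding expo_def by (subst AE_density) (auto simp: exponential_density_def elim!: eventually_mono)
qed

lemma integrable_expo_iff:
  fixes f :: "real \<Rightarrow> real"
  assumes [measurable]: "f \<in> borel_measurable borel"
  shows "integrable expo f \<longleftrightarrow> integrable lborel (\<lambda>x. exponential_density 1 x * f x)"
  unfolding expo_def by (subst integrable_density) (auto simp: exponential_density_nonneg)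

lemma integral_expo_eq:
  fixes f :: "real \<Rightarrow> real"
  assumes [measurable]: "f \<in> borel_measurable borel"
  shows "(\<integral>x. f x \<partial>expo) = (\<integral>x. exponential_density 1 x * f x \<partial>lborel)"
  unfolding expo_def by (subst integral_density) (auto simp: exponential_density_nonneg)

text \<open>Lack of memory: given an exceedance of \<open>t\<close>, the excess is again standard
  exponential. Moments of thresholded sums are reduced to moments without threshold in this
  way.\<close>

lemma
  fixes f :: "real \<Rightarrow> real"
  assumes [measurable]: "f \<in> borel_measurable borel" and t: "t \<ge> 0"
  shows integrable_expo_shift: "integrable expo f \<Longrightarrow> integrable expo (\<lambda>x. f (x - t) * indicator {t<..} x)" (is "_ \<Longrightarrow> ?I")
    and integral_expo_shift: "(\<integral>x. f (x - t) * indicator {t<..} x \<partial>expo) = exp (- t) * (\<integral>x. f x \<partial>expo)" (is ?E)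
proof -
  let ?h = "\<lambda>x. exponential_density 1 x * (f (x - t) * indicator {t<..} x)"
  \<comment> \<open>The identity may fail at zero only, where the strict indicator vanishes but the
    density does not.\<close>
  have ae: "AE x in lborel. ?h (t + 1 * x) = exp (- t) * (exponential_density 1 x * f x)"
    using AE_lborel_singleton[of "0::real"]
    by eventually_elim (use t in \<open>auto simp: exponential_density_def exp_add[symmetric] split: split_indicator\<close>)
  show ?I if "integrable expo f"
  proof -
    have "integrable lborel (\<lambda>x. exp (- t) * (exponential_density 1 x * f x))"
      using that by (simp add: integrable_expo_iff)
    then have "integrable lborel (\<lambda>x. ?h (t + 1 * x))"
      by (subst integrable_cong_AE[OF _ _ ae]) auto
    then have "integrable lborel ?h"
      using lborel_integrable_real_affine_iff[of 1 ?h t] by simp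
    then show ?thesis by (subst integrable_expo_iff) auto
  qed
  have "(\<integral>x. f (x - t) * indicator {t<..} x \<partial>expo) = (\<integral>x. ?h x \<partial>lborel)"
    by (subst integral_expo_eq) auto
  also have "\<dots> = (\<integral>x. ?h (t + 1 * x) \<partial>lborel)"
    by (subst lborel_integral_real_affine[of 1 _ t]) auto
  also have "\<dots> = (\<integral>x. exp (- t) * (exponential_density 1 x * f x) \<partial>lborel)"
    by (intro integral_cong_AE ae) auto
  also have "\<dots> = exp (- t) * (\<integral>x. f x \<partial>expo)"
    by (simp add: integral_expo_eq)
  finally show ?E .
qed

text \<open>Exponential tilting turns the density of rate one into a multiple of that of rate
  \<open>1 - c\<close>.\<close>

lemma
  fixes c :: real
  assumes c: "c < 1"
  shows integrable_expo_exp: "integrable expo (\<lambda>x. exp (c * x))"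
    and integral_expo_exp: "(\<integral>x. exp (c * x) \<partial>expo) = 1 / (1 - c)"
proof -
  let ?d = "exponential_density (1 - c)"
  have eq: "exponential_density 1 x * exp (c * x) = ?d x * (1 / (1 - c))" for x
  proof (cases "x < 0")
    case False
    have "exp (- x * 1) * exp (c * x) = exp (- x * (1 - c))"
      by (simp add: exp_add[symmetric] algebra_simps)
    then show ?thesis using False c by (simp add: exponential_density_def)
  qed (simp add: exponential_density_def)
  have "has_bochner_integral lborel ?d 1"
    using nn_integral_erlang_ith_moment[of "1 - c" 0 0] c
    by (intro has_bochner_integral_nn_integral) (auto simp: exponential_density_nonneg)
  then have 1: "integrable lborel ?d" "(\<integral>x. ?d x \<partial>lborel) = 1"
    by (auto simp: has_bochner_integral_iff)
  show "integrable expo (\<lambda>x. exp (c * x))"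
    unfolding integrable_expo_iff[of "\<lambda>x. exp (c * x)", simplified] eq
    using 1 by auto
  show "(\<integral>x. exp (c * x) \<partial>expo) = 1 / (1 - c)"
    unfolding integral_expo_eq[of "\<lambda>x. exp (c * x)", simplified] eq
    using 1 by simp
qed

lemma has_bochner_integral_expo_power: "has_bochner_integral expo (\<lambda>x. x ^ i) (fact i)"
proof -
  have "distributed expo lborel (\<lambda>x. x) (exponential_density 1)"
    unfolding distributed_def by (auto simp: distr_id2 expo_def)
  from expo.has_bochner_integral_erlang_ith_moment[OF _ this, of i] show ?thesis by simp
qed

lemma integrable_expo_power [simp]: "integrable expo (\<lambda>x. x ^ i)"
  and integral_expo_power [simp]: "(\<integral>x. x ^ i \<partial>expo) = fact i"
  using has_bochner_integral_expo_power[of i] by (auto simp: has_bochner_integral_iff)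

text \<open>The origin of the factor \<open>1 / (1 - \<rho>)\<close> in the bias.\<close>

lemma integral_expo_erv_limit:
  assumes "\<rho> \<le> 0"
  shows "(\<integral>x. erv_limit \<rho> x \<partial>expo) = 1 / (1 - \<rho>)"
proof (cases "\<rho> = 0")
  case True
  then show ?thesis using integral_expo_power[of 1] by (simp add: erv_limit_def)
next
  case False
  have "(\<integral>x. erv_limit \<rho> x \<partial>expo) = (\<integral>x. (exp (\<rho> * x) - 1) / \<rho> \<partial>expo)"
    using False by (simp add: erv_limit_def)
  also have "\<dots> = ((\<integral>x. exp (\<rho> * x) \<partial>expo) - 1) / \<rho>"
    using assms integrable_expo_exp[of \<rho>] by (simp add: expo.prob_space[simplified])
  also have "\<dots> = 1 / (1 - \<rho>)"
    using assms False by (subst integral_expo_exp) (auto simp: field_simps)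
  finally show ?thesis .
qed

text \<open>Dominated convergence with the Potter envelope. The mean will give the bias; the bound
  on the second moment makes the fluctuation of the remainder sum negligible.\<close>

lemma
  fixes G a :: "real \<Rightarrow> real"
  assumes meas [measurable]: "G \<in> borel_measurable borel" "a \<in> borel_measurable borel"
    and lim: "\<And>y. ((\<lambda>s. (G (s + y) - G s) / a s) \<longlongrightarrow> erv_limit \<rho> y) at_top"
    and nz: "\<forall>\<^sub>F s in at_top. a s \<noteq> 0" and \<rho>: "\<rho> \<le> 0"
  shows erv_integral: "((\<lambda>s. (\<integral>y. G (s + y) - G s \<partial>expo) / a s) \<longlongrightarrow> 1 / (1 - \<rho>)) at_top"
    and erv_square_integral: "\<exists>C. \<forall>\<^sub>F s in at_top. integrable expo (\<lambda>y. (G (s + y) - G s)\<^sup>2) \<and>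
          (\<integral>y. (G (s + y) - G s)\<^sup>2 \<partial>expo) \<le> C * (a s)\<^sup>2"
proof -
  obtain K where K: "K > 0" "\<forall>\<^sub>F s in at_top. \<forall>y\<ge>0. \<bar>G (s + y) - G s\<bar> \<le> K * \<bar>a s\<bar> * exp (y / 4)"
    using erv_potter_bound[OF assms] by blast
  have int4: "integrable expo (\<lambda>y. exp (y / 4))" using integrable_expo_exp[of "1/4"] by simp
  have int2: "integrable expo (\<lambda>y. exp (y / 2))" using integrable_expo_exp[of "1/2"] by simp
  have "((\<lambda>s. \<integral>y. (G (s + y) - G s) / a s \<partial>expo) \<longlongrightarrow> (\<integral>y. erv_limit \<rho> y \<partial>expo)) at_top"
  proof (rule integral_dominated_convergence_at_top[where w = "\<lambda>y. K * exp (y / 4)"])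
    show "\<forall>\<^sub>F s in at_top. AE y in expo. norm ((G (s + y) - G s) / a s) \<le> K * exp (y / 4)"
      using K(2) nz
    proof eventually_elim
      case (elim s)
      show ?case
        using AE_expo_nonneg
      proof eventually_elim
        case (elim y)
        with \<open>\<forall>y\<ge>0. _ y\<close> have "\<bar>G (s + y) - G s\<bar> \<le> K * \<bar>a s\<bar> * exp (y / 4)" by simp
        then show ?case using \<open>a s \<noteq> 0\<close> by (simp add: abs_divide divide_le_eq mult.commute mult.left_commute)
      qed
    qed
  qed (use lim int4 in auto)
  then show "((\<lambda>s. (\<integral>y. G (s + y) - G s \<partial>expo) / a s) \<longlongrightarrow> 1 / (1 - \<rho>)) at_top"
    by (simp add: integral_expo_erv_limit[OF \<rho>])
  have "\<forall>\<^sub>F s in at_top. integrable expo (\<lambda>y. (G (s + y) - G s)\<^sup>2) \<and>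
          (\<integral>y. (G (s + y) - G s)\<^sup>2 \<partial>expo) \<le> (2 * K\<^sup>2) * (a s)\<^sup>2"
    using K(2)
  proof eventually_elim
    case (elim s)
    have bd: "AE y in expo. (G (s + y) - G s)\<^sup>2 \<le> K\<^sup>2 * (a s)\<^sup>2 * exp (y / 2)"
      using AE_expo_nonneg
    proof eventually_elim
      case (elim y)
      with \<open>\<forall>y\<ge>0. _ y\<close> have "\<bar>G (s + y) - G s\<bar> \<le> K * \<bar>a s\<bar> * exp (y / 4)" by simp
      then have "\<bar>G (s + y) - G s\<bar>\<^sup>2 \<le> (K * \<bar>a s\<bar> * exp (y / 4))\<^sup>2" by (intro power_mono) auto
      also have "\<dots> = K\<^sup>2 * (a s)\<^sup>2 * exp (y / 2)"
        by (simp add: power_mult_distrib exp_double[symmetric])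
      finally show ?case by simp
    qed
    have int: "integrable expo (\<lambda>y. K\<^sup>2 * (a s)\<^sup>2 * exp (y / 2))" using int2 by simp
    have 1: "integrable expo (\<lambda>y. (G (s + y) - G s)\<^sup>2)"
      by (rule Bochner_Integration.integrable_bound[OF int]) (use bd in \<open>auto elim: eventually_mono\<close>)
    have "(\<integral>y. (G (s + y) - G s)\<^sup>2 \<partial>expo) \<le> (\<integral>y. K\<^sup>2 * (a s)\<^sup>2 * exp (y / 2) \<partial>expo)"
      by (rule integral_mono_AE[OF 1 int bd])
    also have "\<dots> = (2 * K\<^sup>2) * (a s)\<^sup>2"
      using integral_expo_exp[of "1/2"] by simp
    finally show ?case using 1 by blast
  qed
  then show "\<exists>C. \<forall>\<^sub>F s in at_top. integrable expo (\<lambda>y. (G (s + y) - G s)\<^sup>2) \<and>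
          (\<integral>y. (G (s + y) - G s)\<^sup>2 \<partial>expo) \<le> C * (a s)\<^sup>2"
    by blast
qed

section \<open>Tail quantile functions\<close>

lemma le_inverse_ereal_iff:
  assumes "q \<ge> 0" "t > 0"
  shows "1 / ereal q \<ge> ereal t \<longleftrightarrow> q \<le> 1 / t"
proof (cases "q = 0")
  case False
  then show ?thesis using assms by (simp add: one_ereal_def field_simps)
qed (use assms in \<open>simp add: zero_ereal_def[symmetric] divide_ereal_def\<close>)

context real_distribution
begin

lemma tail_quantile_eq: "t > 0 \<Longrightarrow> tail_quantile M t = Inf {x. 1 - cdf M x \<le> 1 / t}"
  unfolding tail_quantile_def by (subst le_inverse_ereal_iff) (auto simp: cdf_bounded_prob)

lemma tail_quantile_set:
  assumes "t > 1"
  shows "{x. 1 - cdf M x \<le> 1 / t} \<noteq> {}" and "bdd_below {x. 1 - cdf M x \<le> 1 / t}"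
proof -
  have "1 - 1 / t < 1" "0 < 1 - 1 / t" using assms by auto
  from order_tendstoD(1)[OF cdf_lim_at_top_prob this(1)]
  have "\<exists>x. 1 - 1 / t < cdf M x" by (auto simp: eventually_at_top_linorder)
  then obtain x where "1 - 1 / t < cdf M x" ..
  then have "x \<in> {x. 1 - cdf M x \<le> 1 / t}" by simp
  then show "{x. 1 - cdf M x \<le> 1 / t} \<noteq> {}" by blast
  from order_tendstoD(2)[OF cdf_lim_at_bot \<open>0 < 1 - 1 / t\<close>]
  obtain N where N: "\<And>x. x \<le> N \<Longrightarrow> cdf M x < 1 - 1 / t" by (auto simp: eventually_at_bot_linorder)
  show "bdd_below {x. 1 - cdf M x \<le> 1 / t}"
  proof (rule bdd_belowI[of _ N])
    fix x assume "x \<in> {x. 1 - cdf M x \<le> 1 / t}"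
    then show "N \<le> x" using N[of x] by (cases "x \<le> N") auto
  qed
qed

lemma tail_quantile_mono: "mono_on {1<..} (tail_quantile M)"
proof (rule mono_onI)
  fix s t :: real assume st: "s \<in> {1<..}" "t \<in> {1<..}" "s \<le> t"
  then have "1 / t \<le> 1 / s" by (intro divide_left_mono) auto
  then have "{x. 1 - cdf M x \<le> 1 / t} \<subseteq> {x. 1 - cdf M x \<le> 1 / s}" by auto
  then show "tail_quantile M s \<le> tail_quantile M t"
    using st tail_quantile_set[of s] tail_quantile_set[of t]
    by (auto simp: tail_quantile_eq intro!: cInf_superset_mono)
qed

lemma cdf_measurable [measurable]: "cdf M \<in> borel_measurable borel"
  by (rule borel_measurable_mono) (auto simp: mono_def cdf_nondecreasing)

text \<open>The uniform transform, without strict monotonicity: the sublevel set is a half-line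
  ending at its supremum, where continuity forces the value \<open>u\<close>.\<close>

lemma prob_cdf_le:
  assumes cont: "continuous_on UNIV (cdf M)" and u: "0 < u" "u < 1"
  shows "prob {x. cdf M x \<le> u} = u"
proof -
  let ?S = "{x. cdf M x \<le> u}"
  from order_tendstoD(1)[OF cdf_lim_at_top_prob u(2)]
  obtain N where N: "\<And>x. x \<ge> N \<Longrightarrow> u < cdf M x" by (auto simp: eventually_at_top_linorder)
  from order_tendstoD(2)[OF cdf_lim_at_bot u(1)]
  obtain L where L: "\<And>x. x \<le> L \<Longrightarrow> cdf M x < u" by (auto simp: eventually_at_bot_linorder)
  have LN: "L \<le> N" using N[of L] L[of L] by (cases "L \<le> N") auto
  obtain s where s: "L \<le> s" "s \<le> N" "cdf M s = u"
    using IVT'[of "cdf M" L u N] N[of N] L[of L] LN continuous_on_subset[OF cont] by (auto simp: less_imp_le)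
  have bdd: "bdd_above ?S"
  proof (rule bdd_aboveI[of _ N])
    fix x assume "x \<in> ?S" then show "x \<le> N" using N[of x] by (cases "x \<le> N") auto
  qed
  have ne: "?S \<noteq> {}" using s by auto
  have "closed ?S" by (intro closed_Collect_le cont continuous_on_const)
  then have Sup: "Sup ?S \<in> ?S" using closed_contains_Sup[OF ne bdd] by blast
  have "?S = {..Sup ?S}"
    using Sup cSup_upper[OF _ bdd] by (auto intro: order_trans[OF cdf_nondecreasing])
  then have "prob ?S = cdf M (Sup ?S)" by (metis cdf_def)
  also have "\<dots> = u"
  proof (rule antisym)
    show "cdf M (Sup ?S) \<le> u" using Sup by simp
    have "s \<le> Sup ?S" using s by (intro cSup_upper[OF _ bdd]) auto
    then show "u \<le> cdf M (Sup ?S)" using cdf_nondecreasing[of s "Sup ?S"] s by simp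
  qed
  finally show ?thesis .
qed

text \<open>A level set of the distribution function is null even where it is an interval, because
  by the uniform transform it fits into a slab of arbitrarily small mass.\<close>

lemma AE_cdf_neq:
  assumes cont: "continuous_on UNIV (cdf M)"
  shows "AE x in M. cdf M x \<noteq> c"
proof -
  have "prob {x. cdf M x = c} \<le> \<epsilon>" if "\<epsilon> > 0" for \<epsilon>
  proof -
    consider "c \<le> 0" | "0 < c" "c < 1" | "c \<ge> 1" by linarith
    then show ?thesis
    proof cases
      case 1
      have "prob {x. cdf M x = c} \<le> prob {x. cdf M x \<le> min \<epsilon> (1/2)}"
        using 1 that by (intro finite_measure_mono) auto
      also have "\<dots> = min \<epsilon> (1/2)" by (rule prob_cdf_le[OF cont]) (use that in auto)
      finally show ?thesis by simp
    next
      case 2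
      define d where "d = min \<epsilon> (c / 2)"
      have d: "0 < d" "d < c" "d \<le> \<epsilon>" using 2 that by (auto simp: d_def)
      have "prob {x. cdf M x = c} \<le> prob ({x. cdf M x \<le> c} - {x. cdf M x \<le> c - d})"
        using d by (intro finite_measure_mono) auto
      also have "\<dots> = prob {x. cdf M x \<le> c} - prob {x. cdf M x \<le> c - d}"
        using d by (intro finite_measure_Diff) auto
      also have "\<dots> = d" using 2 d by (simp add: prob_cdf_le[OF cont])
      finally show ?thesis using d by simp
    next
      case 3
      define d where "d = min \<epsilon> (1 / 2)"
      have d: "0 < d" "d < 1" "d \<le> \<epsilon>" using that by (auto simp: d_def)
      have "prob {x. cdf M x = c} \<le> prob (UNIV - {x. cdf M x \<le> 1 - d})"
        using d 3 by (intro finite_measure_mono) auto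
      also have "\<dots> = 1 - prob {x. cdf M x \<le> 1 - d}"
        using prob_compl[of "{x. cdf M x \<le> 1 - d}"] by simp
      also have "\<dots> = d" using d by (simp add: prob_cdf_le[OF cont])
      finally show ?thesis using d by simp
    qed
  qed
  then have "prob {x. cdf M x = c} = 0"
    by (meson field_le_epsilon measure_nonneg antisym add_0 order_refl le_less_linear less_irrefl dense order.strict_trans1)
  then show ?thesis by (subst (asm) prob_eq_0) auto
qed

text \<open>The tail quantile recovers \<open>x\<close> unless the distribution function is flat
  just to the left of \<open>x\<close>. Such a stretch contains a rational with the same value of
  \<open>cdf M\<close>, and the countably many levels of rationals are avoided almost
  surely.\<close>

lemma AE_tail_quantile_cdf:
  assumes cont: "continuous_on UNIV (cdf M)"
  shows "AE x in M. 0 < cdf M x \<and> cdf M x < 1 \<and> tail_quantile M (exp (- ln (1 - cdf M x))) = x"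
proof -
  have "AE x in M. \<forall>r\<in>\<rat>. cdf M x \<noteq> cdf M r"
    by (subst AE_ball_countable) (auto simp: countable_rat AE_cdf_neq[OF cont])
  with AE_cdf_neq[OF cont, of 0] AE_cdf_neq[OF cont, of 1] show ?thesis
  proof eventually_elim
    case (elim x)
    then have x: "0 < cdf M x" "cdf M x < 1"
      using cdf_nonneg[of x] cdf_bounded_prob[of x] by (auto simp: less_le)
    have strict: "cdf M y < cdf M x" if yx: "y < x" for y
    proof -
      obtain r where r: "r \<in> \<rat>" "y < r" "r < x" using Rats_dense_in_real[OF yx] by blast
      have "cdf M y \<le> cdf M r" "cdf M r \<le> cdf M x" using r by (auto intro: cdf_nondecreasing)
      then show ?thesis using elim r by (auto simp: less_le)
    qed
    have e: "exp (- ln (1 - cdf M x)) = 1 / (1 - cdf M x)" using x by (simp add: exp_minus inverse_eq_divide)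
    have "{y. 1 - cdf M y \<le> 1 / (1 / (1 - cdf M x))} = {x..}"
      using strict by (auto intro: cdf_nondecreasing) (meson not_le)
    then have "tail_quantile M (exp (- ln (1 - cdf M x))) = x"
      unfolding e using x by (subst tail_quantile_eq) auto
    then show ?case using x by blast
  qed
qed

lemma distr_neg_ln_survival:
  assumes cont: "continuous_on UNIV (cdf M)"
  shows "distr M borel (\<lambda>x. - ln (1 - cdf M x)) = density lborel (exponential_density 1)"
proof -
  have "prob {x \<in> space M. - ln (1 - cdf M x) \<le> a} = 1 - exp (- a * 1)" if a: "0 \<le> a" for a
  proof -
    have "prob {x \<in> space M. - ln (1 - cdf M x) \<le> a} = prob {x. cdf M x \<le> 1 - exp (- a)}"
    proof (rule measure_eq_AE)
      show "AE x in M. x \<in> {x \<in> space M. - ln (1 - cdf M x) \<le> a} \<longleftrightarrow> x \<in> {x. cdf M x \<le> 1 - exp (- a)}"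
        using AE_tail_quantile_cdf[OF cont]
      proof eventually_elim
        case (elim x)
        then have "- a \<le> ln (1 - cdf M x) \<longleftrightarrow> exp (- a) \<le> 1 - cdf M x"
          by (intro ln_ge_iff) auto
        then show ?case by auto
      qed
    qed auto
    also have "\<dots> = 1 - exp (- a * 1)"
    proof (cases "a = 0")
      case True
      have "AE x in M. \<not> cdf M x \<le> 0" using AE_tail_quantile_cdf[OF cont] by eventually_elim simp
      then have "prob {x. cdf M x \<le> 0} = 0" by (subst prob_eq_0) auto
      then show ?thesis using True by simp
    next
      case False
      then show ?thesis using a by (simp add: prob_cdf_le[OF cont])
    qed
    finally show ?thesis .
  qed
  then have "distributed M lborel (\<lambda>x. - ln (1 - cdf M x)) (exponential_density 1)"
    by (subst exponential_distributed_iff) auto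
  then show ?thesis by (simp add: distributed_def cong: distr_cong)
qed

end

text \<open>With \<open>r = c * (1 + \<delta>)\<close>, the hypothesis says that
  \<open>\<delta> / A\<close> converges to \<open>h\<close>; as \<open>A\<close> vanishes, so does
  \<open>\<delta>\<close>, and the quadratic error of the logarithm is negligible against
  \<open>A\<close>.\<close>

lemma second_order_log:
  fixes r A :: "real \<Rightarrow> real"
  assumes A: "\<forall>\<^sub>F t in F. A t \<noteq> 0" "(A \<longlongrightarrow> 0) F" and "c > 0"
    and lim: "((\<lambda>t. 1 / A t * (r t - c)) \<longlongrightarrow> c * h) F"
  shows "((\<lambda>t. (ln (r t) - ln c) / A t) \<longlongrightarrow> h) F" and "(r \<longlongrightarrow> c) F"
proof -
  define \<delta> where "\<delta> t = (r t - c) / c" for t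
  have q: "((\<lambda>t. \<delta> t / A t) \<longlongrightarrow> h) F"
    using tendsto_divide[OF lim tendsto_const, of c] \<open>c > 0\<close> by (simp add: \<delta>_def mult.commute)
  have "((\<lambda>t. \<delta> t / A t * A t) \<longlongrightarrow> h * 0) F" by (intro tendsto_mult q A(2))
  then have "((\<lambda>t. \<delta> t / A t * A t) \<longlongrightarrow> 0) F" by simp
  then have \<delta>0: "(\<delta> \<longlongrightarrow> 0) F"
    by (rule Lim_transform_eventually) (use A(1) in \<open>auto elim!: eventually_mono\<close>)
  have "((\<lambda>t. c * (1 + \<delta> t)) \<longlongrightarrow> c * (1 + 0)) F" by (intro tendsto_intros \<delta>0)
  then show "(r \<longlongrightarrow> c) F" using \<open>c > 0\<close> by (simp add: \<delta>_def field_simps)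
  have err: "((\<lambda>t. (ln (1 + \<delta> t) - \<delta> t) / A t) \<longlongrightarrow> 0) F"
  proof (rule Lim_null_comparison)
    have "\<forall>\<^sub>F t in F. \<bar>\<delta> t\<bar> < 1 / 2" by (rule order_tendstoD(2)[OF tendsto_rabs_zero[OF \<delta>0]]) simp
    then show "\<forall>\<^sub>F t in F. norm ((ln (1 + \<delta> t) - \<delta> t) / A t) \<le> 2 * (\<bar>\<delta> t\<bar> * \<bar>\<delta> t / A t\<bar>)"
    proof eventually_elim
      case (elim t)
      then have "\<bar>ln (1 + \<delta> t) - \<delta> t\<bar> \<le> 2 * (\<delta> t)\<^sup>2" by (intro abs_ln_one_plus_x_minus_x_bound) simp
      then have "\<bar>ln (1 + \<delta> t) - \<delta> t\<bar> / \<bar>A t\<bar> \<le> 2 * (\<delta> t)\<^sup>2 / \<bar>A t\<bar>" by (intro divide_right_mono) auto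
      then show ?case by (simp add: abs_divide power2_eq_square)
    qed
    have "((\<lambda>t. 2 * (\<bar>\<delta> t\<bar> * \<bar>\<delta> t / A t\<bar>)) \<longlongrightarrow> 2 * (0 * \<bar>h\<bar>)) F"
      by (intro tendsto_intros tendsto_rabs_zero \<delta>0 q)
    then show "((\<lambda>t. 2 * (\<bar>\<delta> t\<bar> * \<bar>\<delta> t / A t\<bar>)) \<longlongrightarrow> 0) F" by simp
  qed
  from tendsto_add[OF err q] have "((\<lambda>t. ln (1 + \<delta> t) / A t) \<longlongrightarrow> h) F"
    by (simp add: diff_divide_distrib)
  then show "((\<lambda>t. (ln (r t) - ln c) / A t) \<longlongrightarrow> h) F"
  proof (rule tendsto_cong[THEN iffD1, rotated])
    have "\<forall>\<^sub>F t in F. r t > 0" using order_tendstoD(1)[OF \<open>(r \<longlongrightarrow> c) F\<close> \<open>c > 0\<close>] .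
    then show "\<forall>\<^sub>F t in F. ln (1 + \<delta> t) / A t = (ln (r t) - ln c) / A t"
    proof eventually_elim
      case (elim t)
      have "1 + \<delta> t = r t / c" using \<open>c > 0\<close> by (simp add: \<delta>_def field_simps)
      then show ?case using elim \<open>c > 0\<close> by (simp add: ln_div)
    qed
  qed
qed

text \<open>\<open>A\<close> comes without measurability, so it is replaced by the unit increment of
  \<open>G\<close> divided by its limit constant. The result \<open>a\<close> is measurable and
  asymptotically equivalent to \<open>A\<close>.\<close>

lemma (in real_distribution) second_order_expansion:
  assumes "second_order_cond M \<gamma> \<rho> A"
  obtains G a where "G \<in> borel_measurable borel" "a \<in> borel_measurable borel"
    "\<forall>\<^sub>F s in at_top. tail_quantile M (exp s) > 0"
    "\<And>s. s > 0 \<Longrightarrow> ln (tail_quantile M (exp s)) = \<gamma> * s + G s"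
    "((\<lambda>s. a s / A (exp s)) \<longlongrightarrow> 1) at_top" "\<forall>\<^sub>F s in at_top. A (exp s) \<noteq> 0" "\<forall>\<^sub>F s in at_top. a s \<noteq> 0"
    "\<And>y. ((\<lambda>s. (G (s + y) - G s) / a s) \<longlongrightarrow> erv_limit \<rho> y) at_top"
proof -
  let ?U = "tail_quantile M"
  have \<gamma>: "\<gamma> > 0" and \<rho>: "\<rho> \<le> 0" and A0: "(A \<longlongrightarrow> 0) at_top"
    and sgn: "(\<forall>\<^sub>F t in at_top. A t > 0) \<or> (\<forall>\<^sub>F t in at_top. A t < 0)"
    and lim: "\<And>x. x > 0 \<Longrightarrow> ((\<lambda>t. (1 / A t) * (?U (t * x) / ?U t - x powr \<gamma>))
        \<longlongrightarrow> x powr \<gamma> * (if \<rho> = 0 then ln x else (x powr \<rho> - 1) / \<rho>)) at_top"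
    using assms unfolding second_order_cond_def by auto
  have Anz: "\<forall>\<^sub>F t in at_top. A t \<noteq> 0"
    using sgn by (auto elim: eventually_mono)
  \<comment> \<open>For a nondecreasing function the ratio of \<open>?U (t * 2)\<close> to
    \<open>?U t\<close> cannot exceed one where \<open>?U t\<close> is negative, and it is zero by
    convention where \<open>?U t = 0\<close>.\<close>
  have Upos: "\<forall>\<^sub>F t in at_top. ?U t > 0"
  proof -
    have "((\<lambda>t. ?U (t * 2) / ?U t) \<longlongrightarrow> 2 powr \<gamma>) at_top"
      by (rule second_order_log(2)[OF Anz A0 _ lim]) auto
    moreover have "1 < 2 powr \<gamma>" using \<gamma> by simp
    ultimately have "\<forall>\<^sub>F t in at_top. 1 < ?U (t * 2) / ?U t" by (rule order_tendstoD(1))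
    then show ?thesis
      using eventually_gt_at_top[of 1]
    proof eventually_elim
      case (elim t)
      then have "?U t \<le> ?U (t * 2)" by (intro mono_onD[OF tail_quantile_mono]) auto
      with elim show ?case by (cases "?U t > 0") (auto simp: less_divide_eq split: if_splits)
    qed
  qed
  have V_mono: "mono_on {0<..} (\<lambda>s. ?U (exp s))"
    by (rule mono_onI) (intro mono_onD[OF tail_quantile_mono], auto)
  define G where "G s = (if s > 0 then ln (?U (exp s)) - \<gamma> * s else 0)" for s
  have [measurable]: "(\<lambda>s. if s > 0 then ?U (exp s) else 0) \<in> borel_measurable borel"
  proof -
    have "(\<lambda>s. indicator {0<..} s *\<^sub>R ?U (exp s)) \<in> borel_measurable borel"
      using borel_measurable_mono_on_fnc[OF V_mono] by (subst (asm) borel_measurable_restrict_space_iff) auto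
    also have "(\<lambda>s. indicator {0<..} s *\<^sub>R ?U (exp s)) = (\<lambda>s. if s > 0 then ?U (exp s) else 0)"
      by (auto simp: fun_eq_iff)
    finally show ?thesis .
  qed
  have "G = (\<lambda>s. if s > 0 then ln (if s > 0 then ?U (exp s) else 0) - \<gamma> * s else 0)"
    by (simp add: G_def fun_eq_iff)
  also have "\<dots> \<in> borel_measurable borel" by measurable
  finally have G_meas [measurable]: "G \<in> borel_measurable borel" .
  have GA: "((\<lambda>s. (G (s + y) - G s) / A (exp s)) \<longlongrightarrow> erv_limit \<rho> y) at_top" for y
  proof -
    have h: "(if \<rho> = 0 then ln (exp y) else (exp y powr \<rho> - 1) / \<rho>) = erv_limit \<rho> y"
      by (simp add: erv_limit_def powr_def)
    have "((\<lambda>t. (ln (?U (t * exp y) / ?U t) - ln (exp y powr \<gamma>)) / A t) \<longlongrightarrow> erv_limit \<rho> y) at_top"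
      by (rule second_order_log(1)[OF Anz A0 _ lim[OF exp_gt_zero, of y, unfolded h]]) simp
    from filterlim_compose[OF this exp_at_top]
    have L: "((\<lambda>s. (ln (?U (exp s * exp y) / ?U (exp s)) - ln (exp y powr \<gamma>)) / A (exp s)) \<longlongrightarrow> erv_limit \<rho> y) at_top" .
    have sh: "filterlim (\<lambda>s::real. exp (s + y)) at_top at_top"
      by (rule filterlim_compose[OF exp_at_top])
         (rule filterlim_at_top_mono[OF filterlim_tendsto_add_at_top[OF tendsto_const[of y] filterlim_ident]],
          simp add: add.commute)
    show ?thesis
    proof (rule tendsto_cong[THEN iffD1, OF _ L])
      show "\<forall>\<^sub>F s in at_top. (ln (?U (exp s * exp y) / ?U (exp s)) - ln (exp y powr \<gamma>)) / A (exp s) =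
          (G (s + y) - G s) / A (exp s)"
        using eventually_compose_filterlim[OF Upos exp_at_top] eventually_compose_filterlim[OF Upos sh]
          eventually_gt_at_top[of 0] eventually_gt_at_top[of "- y"]
      proof eventually_elim
        case (elim s)
        then have "ln (?U (exp s * exp y) / ?U (exp s)) = ln (?U (exp (s + y))) - ln (?U (exp s))"
          by (simp add: exp_add ln_div)
        then show ?case using elim by (simp add: G_def ln_powr algebra_simps)
      qed
    qed
  qed
  have Anz': "\<forall>\<^sub>F s in at_top. A (exp s) \<noteq> 0" by (rule eventually_compose_filterlim[OF Anz exp_at_top])
  define a where "a s = (G (s + 1) - G s) / erv_limit \<rho> 1" for s
  have e1: "erv_limit \<rho> 1 \<noteq> 0" using erv_limit_1_pos[of \<rho>] by simp
  have a1: "((\<lambda>s. a s / A (exp s)) \<longlongrightarrow> 1) at_top"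
    using tendsto_divide[OF GA[of 1] tendsto_const e1] e1 by (simp add: a_def mult.commute)
  show thesis
  proof (rule that[of G a])
    show "a \<in> borel_measurable borel" unfolding a_def by measurable
    show "\<forall>\<^sub>F s in at_top. ?U (exp s) > 0" by (rule eventually_compose_filterlim[OF Upos exp_at_top])
    show "ln (?U (exp s)) = \<gamma> * s + G s" if "s > 0" for s using that by (simp add: G_def)
    show nz: "\<forall>\<^sub>F s in at_top. a s \<noteq> 0"
      using order_tendstoD(1)[OF a1, of 0] by (auto elim!: eventually_mono)
    show "((\<lambda>s. (G (s + y) - G s) / a s) \<longlongrightarrow> erv_limit \<rho> y) at_top" for y
    proof -
      have "((\<lambda>s. ((G (s + y) - G s) / A (exp s)) / (a s / A (exp s))) \<longlongrightarrow> erv_limit \<rho> y / 1) at_top"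
        by (intro tendsto_divide GA a1) simp
      then show ?thesis
        unfolding div_by_1 by (rule Lim_transform_eventually) (use Anz' in \<open>auto elim!: eventually_mono\<close>)
    qed
  qed (use a1 Anz' in auto)
qed

section \<open>Intermediate order statistics of exponential samples\<close>

lemma (in prob_space) square_sum_indep:
  fixes Y :: "'i \<Rightarrow> 'a \<Rightarrow> real"
  assumes "finite I" "indep_vars (\<lambda>_. borel) Y I"
    and "\<And>i. i \<in> I \<Longrightarrow> integrable M (\<lambda>w. (Y i w)\<^sup>2)" "\<And>i. i \<in> I \<Longrightarrow> expectation (Y i) = 0"
  shows "integrable M (\<lambda>w. (\<Sum>i\<in>I. Y i w)\<^sup>2) \<and>
    expectation (\<lambda>w. (\<Sum>i\<in>I. Y i w)\<^sup>2) = (\<Sum>i\<in>I. expectation (\<lambda>w. (Y i w)\<^sup>2))"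
  using assms
proof (induction I rule: finite_induct)
  case (insert i I)
  have meas [measurable]: "Y j \<in> borel_measurable M" if "j \<in> insert i I" for j
    using insert.prems(1) that unfolding indep_vars_def2 by auto
  have IH: "integrable M (\<lambda>w. (\<Sum>i\<in>I. Y i w)\<^sup>2)"
    "expectation (\<lambda>w. (\<Sum>i\<in>I. Y i w)\<^sup>2) = (\<Sum>i\<in>I. expectation (\<lambda>w. (Y i w)\<^sup>2))"
    using insert.IH insert.prems indep_vars_subset[OF insert.prems(1), of I] by auto
  have int: "integrable M (Y j)" if "j \<in> insert i I" for j
    by (rule square_integrable_imp_integrable[OF meas[OF that] insert.prems(2)[OF that]])
  have indep: "indep_var borel (Y i) borel (\<lambda>w. \<Sum>i\<in>I. Y i w)"
    using insert by (intro indep_vars_sum) auto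
  have intS: "integrable M (\<lambda>w. \<Sum>i\<in>I. Y i w)" using int by auto
  have prod: "integrable M (\<lambda>w. Y i w * (\<Sum>i\<in>I. Y i w))" "expectation (\<lambda>w. Y i w * (\<Sum>i\<in>I. Y i w)) = 0"
    using indep_var_integrable[OF indep int intS] indep_var_lebesgue_integral[OF indep int intS] insert.prems(3)
    by auto
  have eq: "(\<Sum>i\<in>insert i I. Y i w)\<^sup>2 = (Y i w)\<^sup>2 + 2 * (Y i w * (\<Sum>i\<in>I. Y i w)) + (\<Sum>i\<in>I. Y i w)\<^sup>2" for w
    using insert.hyps by (simp add: power2_sum algebra_simps)
  show ?case
    unfolding eq using IH prod insert by simp
qed simp

text \<open>One margin on the exponential scale. The dependence between margins enters only through
  the joint limit theorem.\<close>

locale expo_sample = prob_space +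
  fixes W :: "nat \<Rightarrow> 'a \<Rightarrow> real" and N k :: "nat \<Rightarrow> nat"
  assumes indep_W: "indep_vars (\<lambda>_. borel) W {1..}"
    and distr_W: "\<And>i. i \<ge> 1 \<Longrightarrow> distr M borel (W i) = expo"
    and N_lim: "filterlim N at_top sequentially"
    and k_pos: "\<And>n. k n \<ge> 1"
    and k_lim: "filterlim k at_top sequentially"
    and ratio_lim: "(\<lambda>n. real (k n) / real (N n)) \<longlonglongrightarrow> 0"
begin

text \<open>The level that \<open>k n\<close> of \<open>N n\<close> standard exponential variables
  exceed on average.\<close>

definition T :: "nat \<Rightarrow> real" where
  "T n = ln (real (N n) / real (k n))"

definition exceed :: "nat \<Rightarrow> real \<Rightarrow> 'a \<Rightarrow> real" where
  "exceed n s w = (\<Sum>i=1..N n. indicator {s<..} (W i w))"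

lemma W_measurable [measurable]: "i \<in> {1..m} \<Longrightarrow> W i \<in> borel_measurable M"
  using indep_W unfolding indep_vars_def2 by auto

lemma W_measurable' [measurable]: "i \<ge> 1 \<Longrightarrow> W i \<in> borel_measurable M"
  using indep_W unfolding indep_vars_def2 by auto

lemma
  assumes [measurable]: "f \<in> borel_measurable borel" and i: "i \<ge> 1"
  shows integrable_W_iff: "integrable M (\<lambda>w. f (W i w) :: real) \<longleftrightarrow> integrable expo f"
    and expectation_W: "expectation (\<lambda>w. f (W i w)) = (\<integral>x. f x \<partial>expo)"
  using i by (simp_all add: distr_W[OF i, symmetric] integrable_distr_eq integral_distr)

lemma AE_W_pos: "i \<ge> 1 \<Longrightarrow> AE w in M. W i w > 0"
  using AE_expo_nonneg by (subst (asm) distr_W[symmetric, of i]) (auto simp: AE_distr_iff)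

lemma N_pos: "\<forall>\<^sub>F n in sequentially. N n > 0"
  using eventually_compose_filterlim[OF eventually_gt_at_top[of 0] N_lim] .

lemma k_less_N: "\<forall>\<^sub>F n in sequentially. k n < N n"
  using order_tendstoD(2)[OF ratio_lim zero_less_one] N_pos
  by eventually_elim (simp add: divide_less_eq)

lemma exp_T: "\<forall>\<^sub>F n in sequentially. exp (- T n) = real (k n) / real (N n)"
  using N_pos
proof eventually_elim
  case (elim n)
  with k_pos[of n] have "real (N n) / real (k n) > 0" by simp
  then show ?case by (simp add: T_def exp_minus inverse_eq_divide)
qed

lemma T_lim: "filterlim T at_top sequentially"
proof -
  have "filterlim (\<lambda>n. inverse (real (k n) / real (N n))) at_top sequentially"
  proof (rule filterlim_inverse_at_top[OF ratio_lim])
    show "\<forall>\<^sub>F n in sequentially. 0 < real (k n) / real (N n)"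
      using N_pos
    proof eventually_elim
      case (elim n)
      then show ?case using k_pos[of n] by (simp add: Suc_le_eq)
    qed
  qed
  then have "filterlim (\<lambda>n. real (N n) / real (k n)) at_top sequentially" by simp
  then show ?thesis unfolding T_def[abs_def] by (rule filterlim_compose[OF ln_at_top])
qed

lemma T_pos: "\<forall>\<^sub>F n in sequentially. T n > 0"
  using eventually_compose_filterlim[OF eventually_gt_at_top[of 0] T_lim] .

lemma sqrt_k_lim: "filterlim (\<lambda>n. sqrt (real (k n))) at_top sequentially"
  by (rule filterlim_compose[OF sqrt_at_top filterlim_compose[OF filterlim_real_sequentially k_lim]])

lemma real_k_lim: "filterlim (\<lambda>n. real (k n)) at_top sequentially"
  by (rule filterlim_compose[OF filterlim_real_sequentially k_lim])

lemma sample_sum_square: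
  assumes [measurable]: "f \<in> borel_measurable borel" and int: "integrable expo (\<lambda>x. (f x)\<^sup>2)"
  shows "integrable M (\<lambda>w. ((\<Sum>i=1..m. f (W i w)) - real m * (\<integral>x. f x \<partial>expo))\<^sup>2)" (is ?I)
    and "expectation (\<lambda>w. ((\<Sum>i=1..m. f (W i w)) - real m * (\<integral>x. f x \<partial>expo))\<^sup>2)
      \<le> real m * (\<integral>x. (f x)\<^sup>2 \<partial>expo)" (is ?E)
proof -
  let ?\<mu> = "\<integral>x. f x \<partial>expo"
  have [measurable]: "f \<in> borel_measurable expo"
    using assms(1) measurable_cong_sets[of expo borel borel borel] by simp
  have int1: "integrable expo f"
    by (rule expo.square_integrable_imp_integrable[OF _ int]) measurable
  have eq: "(\<Sum>i=1..m. f (W i w)) - real m * ?\<mu> = (\<Sum>i=1..m. f (W i w) - ?\<mu>)" for w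
    by (simp add: sum_subtractf)
  have sq: "(f x - ?\<mu>)\<^sup>2 = (f x)\<^sup>2 - 2 * ?\<mu> * f x + ?\<mu>\<^sup>2" for x
    by (simp add: power2_diff algebra_simps)
  have intc: "integrable expo (\<lambda>x. (f x - ?\<mu>)\<^sup>2)" unfolding sq using int int1 by auto
  have "(\<integral>x. (f x - ?\<mu>)\<^sup>2 \<partial>expo) = (\<integral>x. (f x)\<^sup>2 \<partial>expo) - ?\<mu>\<^sup>2"
    using int int1 expo.variance_eq[of f] by simp
  then have var: "(\<integral>x. (f x - ?\<mu>)\<^sup>2 \<partial>expo) \<le> (\<integral>x. (f x)\<^sup>2 \<partial>expo)" by simp
  have "indep_vars (\<lambda>_. borel) (\<lambda>i w. f (W i w) - ?\<mu>) {1..m}"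
    by (rule indep_vars_compose2[OF indep_vars_subset[OF indep_W]]) auto
  from square_sum_indep[OF _ this]
  have "integrable M (\<lambda>w. (\<Sum>i=1..m. f (W i w) - ?\<mu>)\<^sup>2) \<and>
      expectation (\<lambda>w. (\<Sum>i=1..m. f (W i w) - ?\<mu>)\<^sup>2) = (\<Sum>i=1..m. expectation (\<lambda>w. (f (W i w) - ?\<mu>)\<^sup>2))"
    using intc int1 integrable_W_iff[of "\<lambda>x. (f x - ?\<mu>)\<^sup>2"] expectation_W[of "\<lambda>x. f x - ?\<mu>"]
    by (simp add: expo.prob_space[simplified])
  moreover have "(\<Sum>i=1..m. expectation (\<lambda>w. (f (W i w) - ?\<mu>)\<^sup>2)) = (\<Sum>i=1..m. \<integral>x. (f x - ?\<mu>)\<^sup>2 \<partial>expo)"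
    by (intro sum.cong refl expectation_W[of "\<lambda>x. (f x - ?\<mu>)\<^sup>2"]) auto
  ultimately show ?I ?E unfolding eq using var by (auto intro: mult_left_mono)
qed

text \<open>A weak law for triangular arrays: the variance of the row sum is at most
  \<open>N n\<close> times the second moment of a summand.\<close>

lemma sample_sum_tendsto:
  assumes [measurable]: "\<And>n. f n \<in> borel_measurable borel"
    and int: "\<forall>\<^sub>F n in sequentially. integrable expo (\<lambda>x. (f n x)\<^sup>2)"
    and mean: "(\<lambda>n. real (N n) * (\<integral>x. f n x \<partial>expo)) \<longlonglongrightarrow> m"
    and sq: "(\<lambda>n. real (N n) * (\<integral>x. (f n x)\<^sup>2 \<partial>expo)) \<longlonglongrightarrow> 0"
  shows "((\<lambda>p. \<Sum>i=1..N (fst p). f (fst p) (W i (snd p))) \<longlongrightarrow> m) (whp M)"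
proof -
  define Z where "Z n w = (\<Sum>i=1..N n. f n (W i w)) - real (N n) * (\<integral>x. f n x \<partial>expo)" for n w
  have "((\<lambda>p. Z (fst p) (snd p)) \<longlongrightarrow> 0) (whp M)"
  proof (rule tendsto_whp_L2)
    show "Z n \<in> borel_measurable M" for n unfolding Z_def by measurable
    show "\<forall>\<^sub>F n in sequentially. integrable M (\<lambda>w. (Z n w)\<^sup>2)"
      using int unfolding Z_def by eventually_elim (intro sample_sum_square, auto)
    show "(\<lambda>n. expectation (\<lambda>w. (Z n w)\<^sup>2)) \<longlonglongrightarrow> 0"
    proof (rule Lim_null_comparison[OF _ sq])
      show "\<forall>\<^sub>F n in sequentially. norm (expectation (\<lambda>w. (Z n w)\<^sup>2)) \<le> real (N n) * (\<integral>x. (f n x)\<^sup>2 \<partial>expo)"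
        using int
      proof eventually_elim
        case (elim n)
        have "expectation (\<lambda>w. (Z n w)\<^sup>2) \<ge> 0" by simp
        then show ?case using sample_sum_square(2)[OF _ elim, of "N n"] by (simp add: Z_def)
      qed
    qed
  qed
  from tendsto_add[OF this tendsto_whp_deterministic[OF mean]] show ?thesis
    by (simp add: Z_def)
qed

lemma sample_sum_tight:
  assumes [measurable]: "\<And>n. f n \<in> borel_measurable borel"
    and int: "\<forall>\<^sub>F n in sequentially. integrable expo (\<lambda>x. (f n x)\<^sup>2) \<and>
      real (N n) * (\<integral>x. (f n x)\<^sup>2 \<partial>expo) \<le> C"
  shows "tight_seq M (\<lambda>n w. (\<Sum>i=1..N n. f n (W i w)) - real (N n) * (\<integral>x. f n x \<partial>expo))"
proof (rule tight_seqI_L2[where C = C])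
  show "\<forall>\<^sub>F n in sequentially. integrable M (\<lambda>w. ((\<Sum>i=1..N n. f n (W i w)) - real (N n) * (\<integral>x. f n x \<partial>expo))\<^sup>2) \<and>
      expectation (\<lambda>w. ((\<Sum>i=1..N n. f n (W i w)) - real (N n) * (\<integral>x. f n x \<partial>expo))\<^sup>2) \<le> C"
    using int
  proof eventually_elim
    case (elim n)
    then show ?case using sample_sum_square[of "f n" "N n"] by (auto intro: order_trans)
  qed
qed measurable

lemma prob_expo_tail: "s \<ge> 0 \<Longrightarrow> expo.prob {s<..} = exp (- s)"
  using integral_expo_shift[of "\<lambda>_. 1" s] by (simp add: expo.prob_space[simplified])

lemma N_exp_T: "\<forall>\<^sub>F n in sequentially. real (N n) * exp (- T n) = real (k n)"
  using exp_T N_pos by eventually_elim simp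

lemma exceed_T_ratio: "((\<lambda>p. exceed (fst p) (T (fst p)) (snd p) / real (k (fst p))) \<longlongrightarrow> 1) (whp M)"
proof -
  have "((\<lambda>p. \<Sum>i=1..N (fst p). indicator {T (fst p)<..} (W i (snd p)) / real (k (fst p))) \<longlongrightarrow> 1) (whp M)"
  proof (rule sample_sum_tendsto[where f = "\<lambda>n x. indicator {T n<..} x / real (k n)"])
    have "\<forall>\<^sub>F n in sequentially. real (N n) * (\<integral>x. indicator {T n<..} x / real (k n) \<partial>expo) = 1"
      using N_exp_T T_pos
    proof eventually_elim
      case (elim n)
      then show ?case using k_pos[of n] by (simp add: prob_expo_tail)
    qed
    then show "(\<lambda>n. real (N n) * (\<integral>x. indicator {T n<..} x / real (k n) \<partial>expo)) \<longlonglongrightarrow> 1"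
      by (rule tendsto_eventually)
    have "(\<lambda>n. inverse (real (k n))) \<longlonglongrightarrow> 0" by (rule tendsto_inverse_0_at_top[OF real_k_lim])
    then show "(\<lambda>n. real (N n) * (\<integral>x. (indicator {T n<..} x / real (k n))\<^sup>2 \<partial>expo)) \<longlonglongrightarrow> 0"
    proof (rule Lim_transform_eventually)
      show "\<forall>\<^sub>F n in sequentially. inverse (real (k n)) = real (N n) * (\<integral>x. (indicator {T n<..} x / real (k n))\<^sup>2 \<partial>expo)"
        using N_exp_T T_pos
      proof eventually_elim
        case (elim n)
        have eq: "(indicator {T n<..} x / real (k n))\<^sup>2 = indicator {T n<..} x / (real (k n) * real (k n))" for x
          by (simp add: power2_eq_square indicator_def)
        show ?case unfolding eq using elim k_pos[of n] by (simp add: prob_expo_tail field_simps)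
      qed
    qed
    show "\<forall>\<^sub>F n in sequentially. integrable expo (\<lambda>x. (indicator {T n<..} x / real (k n))\<^sup>2)"
    proof (intro always_eventually allI)
      fix n show "integrable expo (\<lambda>x. (indicator {T n<..} x / real (k n))\<^sup>2)"
        by (intro expo.integrable_const_bound[of _ "1 / (real (k n))\<^sup>2"]) (auto simp: power_divide indicator_def)
    qed
  qed measurable
  then show ?thesis by (simp add: exceed_def sum_divide_distrib)
qed

text \<open>The standardised exceedance count; the Bahadur expansion will show that the normalised
  random threshold follows it.\<close>

definition Wn :: "nat \<Rightarrow> 'a \<Rightarrow> real" where
  "Wn n w = (exceed n (T n) w - real (k n)) / sqrt (real (k n))"

lemma tight_Wn: "tight_seq M Wn"
proof -
  have "tight_seq M (\<lambda>n w. (\<Sum>i=1..N n. indicator {T n<..} (W i w) / sqrt (real (k n)))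
      - real (N n) * (\<integral>x. indicator {T n<..} x / sqrt (real (k n)) \<partial>expo))"
  proof (rule sample_sum_tight[where C = 1])
    show "\<forall>\<^sub>F n in sequentially. integrable expo (\<lambda>x. (indicator {T n<..} x / sqrt (real (k n)))\<^sup>2) \<and>
      real (N n) * (\<integral>x. (indicator {T n<..} x / sqrt (real (k n)))\<^sup>2 \<partial>expo) \<le> 1"
      using N_exp_T T_pos
    proof eventually_elim
      case (elim n)
      have eq: "(indicator {T n<..} x / sqrt (real (k n)))\<^sup>2 = indicator {T n<..} x / real (k n)" for x
        by (simp add: power_divide indicator_def)
      have "integrable expo (\<lambda>x. indicator {T n<..} x / real (k n))"
        by (intro expo.integrable_const_bound[of _ "1 / real (k n)"]) (auto simp: indicator_def)
      then show ?case unfolding eq using elim k_pos[of n] by (simp add: prob_expo_tail)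
    qed
  qed measurable
  then show ?thesis
  proof (rule tight_seq_add_tendsto[where L = 0])
    have "\<forall>\<^sub>F n in sequentially. \<forall>w. Wn n w - ((\<Sum>i=1..N n. indicator {T n<..} (W i w) / sqrt (real (k n)))
      - real (N n) * (\<integral>x. indicator {T n<..} x / sqrt (real (k n)) \<partial>expo)) = 0"
      using N_exp_T T_pos
    proof eventually_elim
      case (elim n)
      then show ?case
        using k_pos[of n]
        by (simp add: Wn_def exceed_def sum_divide_distrib[symmetric] prob_expo_tail diff_divide_distrib)
    qed
    from eventually_whp_deterministic[OF this]
    show "((\<lambda>p. Wn (fst p) (snd p) - ((\<Sum>i=1..N (fst p). indicator {T (fst p)<..} (W i (snd p)) / sqrt (real (k (fst p))))
      - real (N (fst p)) * (\<integral>x. indicator {T (fst p)<..} x / sqrt (real (k (fst p))) \<partial>expo))) \<longlongrightarrow> 0) (whp M)"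
      by (intro tendsto_eventually) (auto elim: eventually_mono)
  qed
qed

text \<open>Moving the threshold by \<open>z / sqrt k\<close> changes the expected count by about
  \<open>- z * sqrt k\<close>, with a variance of order \<open>sqrt k\<close> only, so that after
  division by \<open>sqrt k\<close> the fluctuation disappears.\<close>

lemma exceed_increment:
  "((\<lambda>p. (exceed (fst p) (T (fst p) + z / sqrt (real (k (fst p)))) (snd p) - exceed (fst p) (T (fst p)) (snd p))
      / sqrt (real (k (fst p)))) \<longlongrightarrow> - z) (whp M)"
proof -
  define u where "u n = T n + z / sqrt (real (k n))" for n
  define f where "f n x = (indicator {u n<..} x - indicator {T n<..} x) / sqrt (real (k n))" for n and x :: real
  have z0: "(\<lambda>n. z / sqrt (real (k n))) \<longlonglongrightarrow> 0"
    using tendsto_divide_0[OF tendsto_const filterlim_at_top_imp_at_infinity[OF sqrt_k_lim]] .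
  have u_pos: "\<forall>\<^sub>F n in sequentially. u n > 0"
  proof -
    have "\<forall>\<^sub>F n in sequentially. - 1 < z / sqrt (real (k n))" by (rule order_tendstoD(1)[OF z0]) simp
    with eventually_compose_filterlim[OF eventually_gt_at_top[of 1] T_lim]
    show ?thesis by eventually_elim (simp add: u_def)
  qed
  have [measurable]: "f n \<in> borel_measurable borel" for n unfolding f_def by measurable
  have ind_int: "integrable expo (\<lambda>x. indicator {s<..} x :: real)" for s
    by (intro expo.integrable_const_bound[of _ 1]) auto
  have mean: "\<forall>\<^sub>F n in sequentially. real (N n) * (\<integral>x. f n x \<partial>expo) = sqrt (real (k n)) * (exp (- (z / sqrt (real (k n)))) - 1)"
    using N_exp_T T_pos u_pos
  proof eventually_elim
    case (elim n)
    have "(\<integral>x. f n x \<partial>expo) = (exp (- u n) - exp (- T n)) / sqrt (real (k n))"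
      using elim ind_int by (simp add: f_def prob_expo_tail)
    then have "real (N n) * (\<integral>x. f n x \<partial>expo) = real (N n) * exp (- T n) * (exp (- (z / sqrt (real (k n)))) - 1) / sqrt (real (k n))"
    proof -
      have "exp (- u n) = exp (- T n) * exp (- (z / sqrt (real (k n))))"
        by (simp add: u_def exp_add[symmetric])
      then show ?thesis
        unfolding \<open>(\<integral>x. f n x \<partial>expo) = _\<close> by (simp add: algebra_simps diff_divide_distrib)
    qed
    also have "\<dots> = sqrt (real (k n)) * (exp (- (z / sqrt (real (k n)))) - 1)"
      unfolding elim(1) using k_pos[of n] by (simp add: real_div_sqrt field_simps)
    finally show ?case .
  qed
  have sq: "\<forall>\<^sub>F n in sequentially. real (N n) * (\<integral>x. (f n x)\<^sup>2 \<partial>expo) = \<bar>exp (- (z / sqrt (real (k n)))) - 1\<bar>"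
    using mean
  proof eventually_elim
    case (elim n)
    define d where "d x = (indicator {u n<..} x - indicator {T n<..} x :: real)" for x
    have ord: "z \<ge> 0 \<Longrightarrow> T n \<le> u n" "z < 0 \<Longrightarrow> u n \<le> T n"
      by (auto simp: u_def divide_nonpos_nonneg)
    \<comment> \<open>The two half-lines are nested, so the difference of their indicators has
      constant sign and size zero or one. The second moment then reduces to the mean.\<close>
    have "(d x)\<^sup>2 = (if z \<ge> 0 then - 1 else 1) * d x" for x
      by (cases "z \<ge> 0") (use ord in \<open>auto simp: d_def indicator_def\<close>)
    then have eq: "(f n x)\<^sup>2 = (if z \<ge> 0 then - 1 else 1) / sqrt (real (k n)) * f n x" for x
      by (simp add: f_def d_def[symmetric] power_divide power2_eq_square)
    have "real (N n) * (\<integral>x. (f n x)\<^sup>2 \<partial>expo) = (if z \<ge> 0 then - 1 else 1) / sqrt (real (k n)) * (real (N n) * (\<integral>x. f n x \<partial>expo))"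
      unfolding eq by simp
    also have "\<dots> = (if z \<ge> 0 then - 1 else 1) * (exp (- (z / sqrt (real (k n)))) - 1)"
      unfolding elim using k_pos[of n] by simp
    also have "\<dots> = \<bar>exp (- (z / sqrt (real (k n)))) - 1\<bar>"
    proof (cases "z \<ge> 0")
      case True
      then have "exp (- (z / sqrt (real (k n)))) \<le> 1" by simp
      then show ?thesis using True by simp
    next
      case False
      then have "z / sqrt (real (k n)) \<le> 0" by (simp add: divide_nonpos_nonneg)
      then have "1 \<le> exp (- (z / sqrt (real (k n))))" by simp
      then show ?thesis using False by simp
    qed
    finally show ?case .
  qed
  have "((\<lambda>p. \<Sum>i=1..N (fst p). f (fst p) (W i (snd p))) \<longlongrightarrow> - z) (whp M)"
  proof (rule sample_sum_tendsto)
    show "\<forall>\<^sub>F n in sequentially. integrable expo (\<lambda>x. (f n x)\<^sup>2)"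
    proof (intro always_eventually allI)
      fix n show "integrable expo (\<lambda>x. (f n x)\<^sup>2)"
        by (intro expo.integrable_const_bound[of _ "1 / real (k n)"])
           (auto simp: f_def power_divide indicator_def)
    qed
    have "((\<lambda>x. (exp x - 1) / x) \<longlongrightarrow> 1) (at (0::real))"
      using DERIV_exp[of 0] by (simp add: DERIV_def)
    show "(\<lambda>n. real (N n) * (\<integral>x. f n x \<partial>expo)) \<longlonglongrightarrow> - z"
    proof (cases "z = 0")
      case True
      have "\<forall>\<^sub>F n in sequentially. real (N n) * (\<integral>x. f n x \<partial>expo) = - z"
        using mean by eventually_elim (simp add: True)
      then show ?thesis by (rule tendsto_eventually)
    next
      case False
      have "filterlim (\<lambda>n. - (z / sqrt (real (k n)))) (at 0) sequentially"
        unfolding filterlim_at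
      proof
        show "\<forall>\<^sub>F n in sequentially. - (z / sqrt (real (k n))) \<in> UNIV \<and> - (z / sqrt (real (k n))) \<noteq> 0"
          using False k_pos by (intro always_eventually) (auto simp: Suc_le_eq)
        show "(\<lambda>n. - (z / sqrt (real (k n)))) \<longlonglongrightarrow> 0" using tendsto_minus[OF z0] by simp
      qed
      from filterlim_compose[OF \<open>((\<lambda>x. (exp x - 1) / x) \<longlongrightarrow> 1) (at 0)\<close> this]
      have "(\<lambda>n. (- z) * ((exp (- (z / sqrt (real (k n)))) - 1) / (- (z / sqrt (real (k n)))))) \<longlonglongrightarrow> (- z) * 1"
        by (intro tendsto_mult tendsto_const)
      then have "(\<lambda>n. (- z) * ((exp (- (z / sqrt (real (k n)))) - 1) / (- (z / sqrt (real (k n)))))) \<longlonglongrightarrow> - z" by simp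
      then show ?thesis
      proof (rule Lim_transform_eventually)
        have eq: "(- z) * (q / (- (z / s))) = s * q" for q s :: real
          using False by simp
        show "\<forall>\<^sub>F n in sequentially. (- z) * ((exp (- (z / sqrt (real (k n)))) - 1) / (- (z / sqrt (real (k n)))))
            = real (N n) * (\<integral>x. f n x \<partial>expo)"
          using mean by eventually_elim (simp only: eq)
      qed
    qed
    have "(\<lambda>n. \<bar>exp (- (z / sqrt (real (k n)))) - 1\<bar>) \<longlonglongrightarrow> \<bar>exp (- 0) - 1\<bar>"
      by (intro tendsto_intros z0)
    then have "(\<lambda>n. \<bar>exp (- (z / sqrt (real (k n)))) - 1\<bar>) \<longlonglongrightarrow> 0" by simp
    then show "(\<lambda>n. real (N n) * (\<integral>x. (f n x)\<^sup>2 \<partial>expo)) \<longlonglongrightarrow> 0"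
      by (rule Lim_transform_eventually) (use sq in \<open>auto elim!: eventually_mono\<close>)
  qed measurable
  then show ?thesis
    by (simp add: f_def u_def exceed_def sum_subtractf sum_divide_distrib[symmetric])
qed

definition \<tau> :: "nat \<Rightarrow> 'a \<Rightarrow> real" where
  "\<tau> n w = order_stat (\<lambda>i. W i w) (N n) (N n - k n)"

lemma exceed_card: "exceed n s w = real (card {l \<in> {1..N n}. s < W l w})"
  by (simp add: exceed_def indicator_def sum.If_cases Int_def del: sum.cl_ivl_Suc)

text \<open>The quantile process is minus the inverse of the tail empirical process, so it suffices to
  control the latter on a finite grid.\<close>

lemma bahadur:
  "((\<lambda>p. sqrt (real (k (fst p))) * (\<tau> (fst p) (snd p) - T (fst p)) - Wn (fst p) (snd p)) \<longlongrightarrow> 0) (whp M)"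
proof (rule tendstoI)
  fix e :: real assume "e > 0"
  define \<epsilon> where "\<epsilon> = e / 4"
  have \<epsilon>: "\<epsilon> > 0" using \<open>e > 0\<close> by (simp add: \<epsilon>_def)
  define \<Delta> where "\<Delta> z p = (exceed (fst p) (T (fst p) + z / sqrt (real (k (fst p)))) (snd p) - exceed (fst p) (T (fst p)) (snd p))
      / sqrt (real (k (fst p)))" for z p
  show "\<forall>\<^sub>F p in whp M. dist (sqrt (real (k (fst p))) * (\<tau> (fst p) (snd p) - T (fst p)) - Wn (fst p) (snd p)) 0 < e"
  proof (rule eventually_whp_tight[OF tight_Wn])
    fix K
    \<comment> \<open>All cells of mesh \<open>\<epsilon>\<close> met by the range of
      \<open>Wn\<close> under the bound \<open>K\<close>, widened by two grid points on each
      side.\<close>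
    define I where "I = {\<lfloor>- K / \<epsilon>\<rfloor> - 2..\<lceil>K / \<epsilon>\<rceil> + 2}"
    have "\<forall>\<^sub>F p in whp M. \<forall>m\<in>I. dist (\<Delta> (\<epsilon> * real_of_int m) p) (- (\<epsilon> * real_of_int m)) < \<epsilon>"
      unfolding \<Delta>_def by (intro eventually_ball_finite ballI tendstoD[OF exceed_increment \<epsilon>]) (simp add: I_def)
    with eventually_whp_deterministic[OF k_less_N]
    show "\<forall>\<^sub>F p in whp M. \<bar>Wn (fst p) (snd p)\<bar> \<le> K \<longrightarrow>
      dist (sqrt (real (k (fst p))) * (\<tau> (fst p) (snd p) - T (fst p)) - Wn (fst p) (snd p)) 0 < e"
    proof eventually_elim
      case (elim p)
      obtain n w where p: "p = (n, w)" by (cases p)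
      define Z where "Z = sqrt (real (k n)) * (\<tau> n w - T n)"
      have kn: "sqrt (real (k n)) > 0" using k_pos[of n] by simp
      \<comment> \<open>Duality: the threshold is at most a level exactly if at most
        \<open>k n\<close> observations exceed that level.\<close>
      have iff: "Z \<le> z \<longleftrightarrow> Wn n w + \<Delta> z p \<le> 0" for z
      proof -
        have "Z \<le> z \<longleftrightarrow> \<tau> n w \<le> T n + z / sqrt (real (k n))"
          using kn by (simp add: Z_def field_simps)
        also have "\<dots> \<longleftrightarrow> exceed n (T n + z / sqrt (real (k n))) w \<le> real (k n)"
          unfolding \<tau>_def exceed_card using elim(1) k_pos[of n] p by (subst order_stat_le_iff_exceed) auto
        also have "\<dots> \<longleftrightarrow> Wn n w + \<Delta> z p \<le> 0"
          using kn by (simp add: Wn_def \<Delta>_def p add_divide_distrib[symmetric] divide_le_0_iff)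
        finally show ?thesis .
      qed
      show ?case
      proof
        assume "\<bar>Wn (fst p) (snd p)\<bar> \<le> K"
        then have K: "\<bar>Wn n w\<bar> \<le> K" by (simp add: p)
        define m where "m = \<lfloor>Wn n w / \<epsilon>\<rfloor>"
        have m: "\<epsilon> * real_of_int m \<le> Wn n w" "Wn n w < \<epsilon> * (real_of_int m + 1)"
          using \<epsilon> unfolding m_def by (metis floor_divide_lower mult.commute, metis floor_divide_upper mult.commute)
        have "- K / \<epsilon> \<le> Wn n w / \<epsilon>" "Wn n w / \<epsilon> \<le> K / \<epsilon>" using K \<epsilon> by (auto simp: field_simps abs_le_iff)
        then have "\<lfloor>- K / \<epsilon>\<rfloor> \<le> m" "m \<le> \<lfloor>K / \<epsilon>\<rfloor>" unfolding m_def by (auto intro: floor_mono)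
        moreover have "\<lfloor>K / \<epsilon>\<rfloor> \<le> \<lceil>K / \<epsilon>\<rceil>" by (rule floor_le_ceiling)
        ultimately have I: "m + 2 \<in> I" "m - 2 \<in> I"
          unfolding I_def atLeastAtMost_iff by linarith+
        have "\<bar>\<Delta> (\<epsilon> * real_of_int (m + 2)) p + \<epsilon> * real_of_int (m + 2)\<bar> < \<epsilon>"
          "\<bar>\<Delta> (\<epsilon> * real_of_int (m - 2)) p + \<epsilon> * real_of_int (m - 2)\<bar> < \<epsilon>"
          using elim(2) I by (auto simp: dist_real_def simp del: of_int_add of_int_diff)
        \<comment> \<open>Two grid steps from \<open>m\<close> the drift of \<open>\<Delta>\<close>
          outweighs its error \<open>\<epsilon>\<close>, which determines the signs.\<close>
        then have "Wn n w + \<Delta> (\<epsilon> * real_of_int (m + 2)) p \<le> 0" "\<not> Wn n w + \<Delta> (\<epsilon> * real_of_int (m - 2)) p \<le> 0"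
          using m by (auto simp: algebra_simps)
        then have "Z \<le> \<epsilon> * real_of_int (m + 2)" "\<not> Z \<le> \<epsilon> * real_of_int (m - 2)"
          by (simp_all only: iff not_False_eq_True)
        then have "\<bar>Z - Wn n w\<bar> \<le> 3 * \<epsilon>" using m \<epsilon> by (auto simp: abs_le_iff algebra_simps)
        then show "dist (sqrt (real (k (fst p))) * (\<tau> (fst p) (snd p) - T (fst p)) - Wn (fst p) (snd p)) 0 < e"
          using \<open>e > 0\<close> by (simp add: Z_def p \<epsilon>_def)
      qed
    qed
  qed
qed

end

section \<open>Expansion of the Hill estimator\<close>

lemma order_stat_mono_index:
  assumes "1 \<le> r" "r \<le> s" "s \<le> n"
  shows "order_stat x n r \<le> order_stat x n s"
  unfolding order_stat_def using assms by (intro sorted_nth_mono) auto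

text \<open>The logarithmic spacings vanish at the threshold, which allows the passage to a sum over
  the whole sample. Positivity of \<open>U\<close> at the threshold extends to all larger
  observations by monotonicity.\<close>

lemma hill_decomposition:
  fixes U G :: "real \<Rightarrow> real" and x v :: "nat \<Rightarrow> real"
  assumes k: "1 \<le> k" "k < n" and U: "mono_on {1<..} U"
    and log: "\<And>s. s > 0 \<Longrightarrow> ln (U (exp s)) = \<gamma> * s + G s"
    and x: "\<And>i. i \<in> {1..n} \<Longrightarrow> x i = U (exp (v i))" and v: "\<And>i. i \<in> {1..n} \<Longrightarrow> v i > 0"
    and t: "t = order_stat v n (n - k)" and pos: "U (exp t) > 0"
  shows "real k * hill x n k =
    \<gamma> * (\<Sum>i=1..n. max 0 (v i - t)) + (\<Sum>i=1..n. (G (v i) - G t) * indicator {t<..} (v i))"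
proof -
  define f where "f y = (if t < y then \<gamma> * (y - t) + (G y - G t) else 0)" for y
  have os: "order_stat x n r = U (exp (order_stat v n r))" if "1 \<le> r" "r \<le> n" for r
  proof -
    have "order_stat x n r = order_stat (\<lambda>i. U (exp (v i))) n r"
      unfolding order_stat_def by (rule arg_cong[where f = "\<lambda>xs. sort xs ! (r - 1)"]) (auto simp: x)
    also have "\<dots> = U (exp (order_stat v n r))"
      by (rule order_stat_mono_on[of "{0<..}" "\<lambda>s. U (exp s)"])
         (use v that in \<open>auto intro!: mono_onI mono_onD[OF U]\<close>)
    finally show ?thesis .
  qed
  have os_pos: "order_stat v n r > 0" if "1 \<le> r" "r \<le> n" for r
    using order_stat_in[OF that, of v] v by auto
  have t_pos: "t > 0" unfolding t using k by (intro os_pos) auto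
  have "real k * hill x n k = (\<Sum>i=1..k. ln (order_stat x n (n - i + 1) / order_stat x n (n - k)))"
    using k by (simp add: hill_def)
  also have "\<dots> = (\<Sum>i=1..k. f (order_stat v n (n - i + 1)))"
  proof (rule sum.cong[OF refl])
    fix i assume i: "i \<in> {1..k}"
    define y where "y = order_stat v n (n - i + 1)"
    have y: "t \<le> y" "y > 0"
      unfolding y_def t using i k by (auto intro!: order_stat_mono_index os_pos)
    have "U (exp t) \<le> U (exp y)" using y t_pos by (intro mono_onD[OF U]) auto
    with pos have "ln (U (exp y) / U (exp t)) = f y"
      using y t_pos by (auto simp: f_def ln_div log algebra_simps)
    moreover have "order_stat x n (n - i + 1) = U (exp y)" "order_stat x n (n - k) = U (exp t)"
    proof -
      show "order_stat x n (n - i + 1) = U (exp y)" unfolding y_def by (rule os) (use i k in auto)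
      show "order_stat x n (n - k) = U (exp t)" unfolding t by (rule os) (use i k in auto)
    qed
    ultimately show "ln (order_stat x n (n - i + 1) / order_stat x n (n - k)) = f (order_stat v n (n - i + 1))"
      by (simp only: y_def)
  qed
  also have "\<dots> = (\<Sum>i=1..n. f (v i))"
    by (rule sum_top_order_stats) (use k in \<open>auto simp: f_def t\<close>)
  also have "\<dots> = (\<Sum>i=1..n. \<gamma> * max 0 (v i - t) + (G (v i) - G t) * indicator {t<..} (v i))"
    by (intro sum.cong) (auto simp: f_def)
  finally show ?thesis by (simp add: sum.distrib sum_distrib_left)
qed

text \<open>As a function of the threshold, the excess sum is convex with slope minus the exceedance
  count. At the order statistic this count is pinned to \<open>k\<close>, so on the way from
  \<open>t\<close> to \<open>s\<close> it lies between \<open>k\<close> and the count at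
  \<open>s\<close>.\<close>

lemma excess_sum_change:
  fixes v :: "nat \<Rightarrow> real"
  assumes k: "1 \<le> k" "k < n" and t: "t = order_stat v n (n - k)"
  shows "\<bar>(\<Sum>i=1..n. max 0 (v i - t)) - (\<Sum>i=1..n. max 0 (v i - s)) + real k * (t - s)\<bar>
    \<le> \<bar>t - s\<bar> * \<bar>(\<Sum>i=1..n. indicator {s<..} (v i)) - real k\<bar>"
proof -
  let ?N = "\<lambda>c. (\<Sum>i=1..n. indicator {c<..} (v i)) :: real"
  have card: "?N c = real (card {l \<in> {1..n}. c < v l})" for c
    by (simp add: indicator_def sum.If_cases Int_def del: sum.cl_ivl_Suc)
  have card': "(\<Sum>i=1..n. indicator {c..} (v i)) = real (card {l \<in> {1..n}. c \<le> v l})" for c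
    by (simp add: indicator_def sum.If_cases Int_def del: sum.cl_ivl_Suc)
  have Nt: "?N t \<le> real k"
    using card_exceed_order_stat[OF k, of v] unfolding card t by (simp only: of_nat_le_iff)
  have Nt': "real k \<le> (\<Sum>i=1..n. indicator {t..} (v i))"
    using card_atLeast_order_stat[OF k, of v] unfolding card' t by (simp only: of_nat_le_iff)
  have diff: "(\<Sum>i=1..n. max 0 (v i - t)) - (\<Sum>i=1..n. max 0 (v i - s)) =
      (\<Sum>i=1..n. max 0 (v i - t) - max 0 (v i - s))"
    by (simp add: sum_subtractf)
  show ?thesis
  proof (cases "s \<le> t")
    case True
    have "(\<Sum>i=1..n. max 0 (v i - t) - max 0 (v i - s)) \<ge> (\<Sum>i=1..n. - (t - s) * indicator {s<..} (v i))"
      using True by (intro sum_mono) (auto simp: indicator_def max_def)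
    moreover have "(\<Sum>i=1..n. max 0 (v i - t) - max 0 (v i - s)) \<le> (\<Sum>i=1..n. - (t - s) * indicator {t..} (v i))"
      using True by (intro sum_mono) (auto simp: indicator_def max_def)
    moreover have "(t - s) * (\<Sum>i=1..n. indicator {t..} (v i)) \<ge> (t - s) * real k"
      using True Nt' by (intro mult_left_mono) auto
    ultimately have "- ((t - s) * ?N s) \<le> (\<Sum>i=1..n. max 0 (v i - t) - max 0 (v i - s))"
      "(\<Sum>i=1..n. max 0 (v i - t) - max 0 (v i - s)) \<le> - ((t - s) * real k)"
      unfolding sum_distrib_left[symmetric] by (simp_all only: mult_minus_left)
    moreover have "(t - s) * (?N s - real k) \<le> \<bar>t - s\<bar> * \<bar>?N s - real k\<bar>"
      using True by (simp add: mult_left_mono)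
    ultimately show ?thesis unfolding diff abs_le_iff
      using mult_nonneg_nonneg[of "\<bar>t - s\<bar>" "\<bar>?N s - real k\<bar>"] by (simp add: algebra_simps)
  next
    case False
    have "(\<Sum>i=1..n. max 0 (v i - t) - max 0 (v i - s)) \<ge> (\<Sum>i=1..n. (s - t) * indicator {s<..} (v i))"
      using False by (intro sum_mono) (auto simp: indicator_def max_def)
    moreover have "(\<Sum>i=1..n. max 0 (v i - t) - max 0 (v i - s)) \<le> (\<Sum>i=1..n. (s - t) * indicator {t<..} (v i))"
      using False by (intro sum_mono) (auto simp: indicator_def max_def)
    moreover have "(s - t) * ?N t \<le> (s - t) * real k"
      using False Nt by (intro mult_left_mono) auto
    ultimately have "(s - t) * ?N s \<le> (\<Sum>i=1..n. max 0 (v i - t) - max 0 (v i - s))"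
      "(\<Sum>i=1..n. max 0 (v i - t) - max 0 (v i - s)) \<le> (s - t) * real k"
      unfolding sum_distrib_left[symmetric] by linarith+
    moreover have "(s - t) * (real k - ?N s) \<le> \<bar>t - s\<bar> * \<bar>?N s - real k\<bar>"
      using False by (simp add: mult_left_mono abs_if)
    ultimately show ?thesis unfolding diff abs_le_iff
      using mult_nonneg_nonneg[of "\<bar>t - s\<bar>" "\<bar>?N s - real k\<bar>"] by (simp add: algebra_simps)
  qed
qed

text \<open>An observation above both thresholds contributes \<open>G t - G s\<close> up to sign;
  one between them lies within \<open>\<bar>t - s\<bar>\<close> of \<open>s\<close>, so
  \<open>small\<close> applies to it too.\<close>

lemma remainder_sum_change:
  fixes v :: "nat \<Rightarrow> real" and G :: "real \<Rightarrow> real"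
  assumes k: "1 \<le> k" "k < n" and t: "t = order_stat v n (n - k)"
    and small: "\<And>y. \<bar>y - s\<bar> \<le> \<bar>t - s\<bar> \<Longrightarrow> \<bar>G y - G s\<bar> \<le> e"
  shows "\<bar>(\<Sum>i=1..n. (G (v i) - G t) * indicator {t<..} (v i)) - (\<Sum>i=1..n. (G (v i) - G s) * indicator {s<..} (v i))\<bar>
    \<le> e * (2 * real k + (\<Sum>i=1..n. indicator {s<..} (v i)))"
proof -
  let ?N = "\<lambda>c. (\<Sum>i=1..n. indicator {c<..} (v i)) :: real"
  have e: "e \<ge> 0" using small[of s] by simp
  have "?N t = real (card {l \<in> {1..n}. t < v l})"
    by (simp add: indicator_def sum.If_cases Int_def del: sum.cl_ivl_Suc)
  then have Nt: "?N t \<le> real k"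
    using card_exceed_order_stat[OF k, of v, folded t] by (simp only: of_nat_le_iff)
  have "\<bar>(G y - G t) * indicator {t<..} y - (G y - G s) * indicator {s<..} y\<bar>
      \<le> e * (2 * indicator {t<..} y + indicator {s<..} y)" for y
  proof -
    have 1: "\<bar>G t - G s\<bar> \<le> e" by (rule small) simp
    consider "y > t" "y > s" | "y > t" "y \<le> s" | "y \<le> t" "y > s" | "y \<le> t" "y \<le> s" by linarith
    then show ?thesis
    proof cases
      case 1
      then show ?thesis using \<open>\<bar>G t - G s\<bar> \<le> e\<close> e by (simp add: abs_minus_commute)
    next
      case 2
      then have "\<bar>G y - G s\<bar> \<le> e" by (intro small) auto
      then have "\<bar>G y - G t\<bar> \<le> 2 * e" using \<open>\<bar>G t - G s\<bar> \<le> e\<close> by linarith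
      then show ?thesis using 2 by simp
    next
      case 3
      then have "\<bar>G y - G s\<bar> \<le> e" by (intro small) auto
      then show ?thesis using 3 by simp
    qed simp
  qed
  then have "\<bar>\<Sum>i=1..n. (G (v i) - G t) * indicator {t<..} (v i) - (G (v i) - G s) * indicator {s<..} (v i)\<bar>
      \<le> (\<Sum>i=1..n. e * (2 * indicator {t<..} (v i) + indicator {s<..} (v i)))"
    by (intro order_trans[OF sum_abs] sum_mono)
  also have "\<dots> = e * (2 * ?N t + ?N s)" by (simp only: sum_distrib_left[symmetric] sum.distrib)
  also have "\<dots> \<le> e * (2 * real k + ?N s)" using Nt e by (intro mult_left_mono) auto
  finally show ?thesis by (simp add: sum_subtractf)
qed

lemma integrable_expo_centred_power: "integrable expo (\<lambda>x. (x - 1) ^ m)"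
proof -
  have "integrable expo (\<lambda>x. \<Sum>i\<le>m. of_nat (m choose i) * x ^ i * (- 1) ^ (m - i))"
    by (intro Bochner_Integration.integrable_sum integrable_mult_left integrable_mult_right integrable_expo_power)
  then show ?thesis using binomial_ring[of _ "- 1 :: real" m] by simp
qed

lemma integral_expo_centred: "(\<integral>x. x - 1 \<partial>expo) = 0"
  using integral_expo_power[of 1] integrable_expo_power[of 1] by (simp add: expo.prob_space[simplified])

lemma integral_expo_centred_square: "(\<integral>x. (x - 1)\<^sup>2 \<partial>expo) = 1"
proof -
  have "(x - 1)\<^sup>2 = x\<^sup>2 - 2 * x + 1" for x :: real by (simp add: power2_diff)
  then have "(\<integral>x. (x - 1)\<^sup>2 \<partial>expo) = (\<integral>x. x\<^sup>2 - 2 * x + 1 \<partial>expo)" by simp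
  also have "\<dots> = 1"
    using integral_expo_power[of 1] integrable_expo_power[of 1] by (simp add: expo.prob_space[simplified])
  finally show ?thesis .
qed

context expo_sample
begin

text \<open>By lack of memory an excess over \<open>T n\<close> has conditional mean one, so
  subtracting one centres the summands. The name refers to the case without remainder
  \<open>G\<close>, an exact Pareto tail.\<close>

definition pareto_sum :: "nat \<Rightarrow> 'a \<Rightarrow> real" where
  "pareto_sum n w = (\<Sum>i=1..N n. (W i w - T n - 1) * indicator {T n<..} (W i w)) / sqrt (real (k n))"

lemma tight_quantile: "tight_seq M (\<lambda>n w. sqrt (real (k n)) * (\<tau> n w - T n))"
  by (rule tight_seq_add_tendsto[OF tight_Wn bahadur])

lemma tight_pareto_sum: "tight_seq M (\<lambda>n w. c * pareto_sum n w)"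
proof -
  define f where "f n x = c / sqrt (real (k n)) * ((x - T n - 1) * indicator {T n<..} x)" for n x
  have [measurable]: "f n \<in> borel_measurable borel" for n unfolding f_def by measurable
  have f2: "(f n x)\<^sup>2 = c\<^sup>2 / real (k n) * ((x - T n - 1)\<^sup>2 * indicator {T n<..} x)" for n x
    by (simp add: f_def power_mult_distrib power_divide indicator_def)
  have tight: "tight_seq M (\<lambda>n w. (\<Sum>i=1..N n. f n (W i w)) - real (N n) * (\<integral>x. f n x \<partial>expo))"
  proof (rule sample_sum_tight[where C = "c\<^sup>2"])
    show "\<forall>\<^sub>F n in sequentially. integrable expo (\<lambda>x. (f n x)\<^sup>2) \<and> real (N n) * (\<integral>x. (f n x)\<^sup>2 \<partial>expo) \<le> c\<^sup>2"
      using N_exp_T T_pos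
    proof eventually_elim
      case (elim n)
      have 1: "integrable expo (\<lambda>x. (x - T n - 1)\<^sup>2 * indicator {T n<..} x)"
        using integrable_expo_shift[of "\<lambda>y. (y - 1)\<^sup>2" "T n"] elim by (simp add: integrable_expo_centred_power)
      have "real (N n) * (\<integral>x. (f n x)\<^sup>2 \<partial>expo) = real (N n) * exp (- T n) * (c\<^sup>2 / real (k n))"
        unfolding f2 using integral_expo_shift[of "\<lambda>y. (y - 1)\<^sup>2" "T n"] elim(2)
        by (simp add: integral_expo_centred_square)
      also have "\<dots> = c\<^sup>2" unfolding elim(1) using k_pos[of n] by simp
      finally show ?case using 1 unfolding f2 by simp
    qed
  qed measurable
  show ?thesis
  proof (rule tight_seq_add_tendsto[OF tight, where L = 0])
    have "\<forall>\<^sub>F n in sequentially. (\<integral>x. f n x \<partial>expo) = 0"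
      using T_pos
    proof eventually_elim
      case (elim n)
      then show ?case
        unfolding f_def using integral_expo_shift[of "\<lambda>y. y - 1" "T n"] by (simp add: integral_expo_centred)
    qed
    then have "\<forall>\<^sub>F n in sequentially. \<forall>w. c * pareto_sum n w - ((\<Sum>i=1..N n. f n (W i w)) - real (N n) * (\<integral>x. f n x \<partial>expo)) = 0"
    proof eventually_elim
      case (elim n)
      have "(\<Sum>i=1..N n. f n (W i w)) = c * pareto_sum n w" for w
        unfolding f_def pareto_sum_def sum_distrib_left[symmetric]
        by (simp only: times_divide_eq_left times_divide_eq_right)
      then show ?case unfolding elim by (simp only: mult_zero_right diff_zero diff_self) simp
    qed
    from eventually_whp_deterministic[OF this]
    show "((\<lambda>p. c * pareto_sum (fst p) (snd p) - ((\<Sum>i=1..N (fst p). f (fst p) (W i (snd p))) - real (N (fst p)) * (\<integral>x. f (fst p) x \<partial>expo))) \<longlongrightarrow> 0) (whp M)"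
      by (intro tendsto_eventually) (auto elim: eventually_mono)
  qed
qed

lemma inverse_sqrt_k: "(\<lambda>n. 1 / sqrt (real (k n))) \<longlonglongrightarrow> 0"
  using tendsto_divide_0[OF tendsto_const filterlim_at_top_imp_at_infinity[OF sqrt_k_lim]] .

lemma quantile_tendsto: "((\<lambda>p. \<tau> (fst p) (snd p) - T (fst p)) \<longlongrightarrow> 0) (whp M)"
proof -
  have "((\<lambda>p. 1 / sqrt (real (k (fst p))) * (sqrt (real (k (fst p))) * (\<tau> (fst p) (snd p) - T (fst p)))) \<longlongrightarrow> 0) (whp M)"
    using tendsto_whp_0_mult_tight[OF tight_quantile, of "\<lambda>n w. 1 / sqrt (real (k n))"]
      tendsto_whp_deterministic[OF inverse_sqrt_k] by simp
  moreover have "1 / sqrt (real (k n)) * (sqrt (real (k n)) * x) = x" for n x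
    using k_pos[of n] by simp
  ultimately show ?thesis by (simp only:)
qed

text \<open>The mean of the sum is \<open>sqrt k * a (T n)\<close> times a convergent integral,
  while its variance is of order \<open>(a (T n))\<^sup>2\<close>, which vanishes because
  \<open>sqrt k * a (T n)\<close> converges.\<close>

lemma remainder_mean:
  assumes [measurable]: "G \<in> borel_measurable borel" "a \<in> borel_measurable borel"
    and lim: "\<And>y. ((\<lambda>s. (G (s + y) - G s) / a s) \<longlongrightarrow> erv_limit \<rho> y) at_top"
    and nz: "\<forall>\<^sub>F s in at_top. a s \<noteq> 0" and \<rho>: "\<rho> \<le> 0"
    and lam: "(\<lambda>n. sqrt (real (k n)) * a (T n)) \<longlonglongrightarrow> lam"
  shows "((\<lambda>p. \<Sum>i=1..N (fst p). (G (W i (snd p)) - G (T (fst p))) * indicator {T (fst p)<..} (W i (snd p)) / sqrt (real (k (fst p))))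
    \<longlongrightarrow> lam / (1 - \<rho>)) (whp M)"
proof (rule sample_sum_tendsto[where f = "\<lambda>n x. (G x - G (T n)) * indicator {T n<..} x / sqrt (real (k n))"])
  obtain C where C: "\<forall>\<^sub>F s in at_top. integrable expo (\<lambda>y. (G (s + y) - G s)\<^sup>2) \<and>
          (\<integral>y. (G (s + y) - G s)\<^sup>2 \<partial>expo) \<le> C * (a s)\<^sup>2"
    using erv_square_integral[OF assms(1-5)] by blast
  note C' = eventually_compose_filterlim[OF C T_lim]
  note nz' = eventually_compose_filterlim[OF nz T_lim]
  define h where "h n y = G (T n + y) - G (T n)" for n y
  have [measurable]: "h n \<in> borel_measurable borel" for n unfolding h_def by measurable
  have f: "(G x - G (T n)) * indicator {T n<..} x / sqrt (real (k n)) =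
      1 / sqrt (real (k n)) * (h n (x - T n) * indicator {T n<..} x)" for n x
    by (simp add: h_def)
  have f2: "((G x - G (T n)) * indicator {T n<..} x / sqrt (real (k n)))\<^sup>2 =
      1 / real (k n) * ((h n (x - T n))\<^sup>2 * indicator {T n<..} x)" for n x
    by (simp add: h_def power_mult_distrib power_divide indicator_def)
  show "\<forall>\<^sub>F n in sequentially. integrable expo (\<lambda>x. ((G x - G (T n)) * indicator {T n<..} x / sqrt (real (k n)))\<^sup>2)"
    using C' T_pos
  proof eventually_elim
    case (elim n)
    then have "integrable expo (\<lambda>x. (h n (x - T n))\<^sup>2 * indicator {T n<..} x)"
      by (intro integrable_expo_shift[of "\<lambda>y. (h n y)\<^sup>2"]) (auto simp: h_def)
    then show ?case unfolding f2 by simp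
  qed
  have "(\<lambda>n. (sqrt (real (k n)) * a (T n)) * ((\<integral>y. h n y \<partial>expo) / a (T n))) \<longlonglongrightarrow> lam * (1 / (1 - \<rho>))"
    unfolding h_def by (intro tendsto_mult lam filterlim_compose[OF erv_integral[OF assms(1-5)] T_lim])
  then have "(\<lambda>n. (sqrt (real (k n)) * a (T n)) * ((\<integral>y. h n y \<partial>expo) / a (T n))) \<longlonglongrightarrow> lam / (1 - \<rho>)" by simp
  then show "(\<lambda>n. real (N n) * (\<integral>x. (G x - G (T n)) * indicator {T n<..} x / sqrt (real (k n)) \<partial>expo)) \<longlonglongrightarrow> lam / (1 - \<rho>)"
  proof (rule Lim_transform_eventually)
    show "\<forall>\<^sub>F n in sequentially. (sqrt (real (k n)) * a (T n)) * ((\<integral>y. h n y \<partial>expo) / a (T n)) =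
        real (N n) * (\<integral>x. (G x - G (T n)) * indicator {T n<..} x / sqrt (real (k n)) \<partial>expo)"
      using N_exp_T T_pos nz'
    proof eventually_elim
      case (elim n)
      have "real (N n) * (\<integral>x. (G x - G (T n)) * indicator {T n<..} x / sqrt (real (k n)) \<partial>expo) =
          real (N n) * exp (- T n) / sqrt (real (k n)) * (\<integral>y. h n y \<partial>expo)"
        unfolding f using elim(2) integral_expo_shift[of "h n" "T n"] by simp
      also have "\<dots> = sqrt (real (k n)) * (\<integral>y. h n y \<partial>expo)"
        unfolding elim(1) by (simp add: real_div_sqrt)
      finally show ?case using elim(3) by simp
    qed
  qed
  have "(\<lambda>n. \<bar>C\<bar> * (1 / sqrt (real (k n)) * (sqrt (real (k n)) * a (T n)))\<^sup>2) \<longlonglongrightarrow> \<bar>C\<bar> * (0 * lam)\<^sup>2"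
    by (intro tendsto_intros inverse_sqrt_k lam)
  then have bound0: "(\<lambda>n. \<bar>C\<bar> * (1 / sqrt (real (k n)) * (sqrt (real (k n)) * a (T n)))\<^sup>2) \<longlonglongrightarrow> 0" by simp
  show "(\<lambda>n. real (N n) * (\<integral>x. ((G x - G (T n)) * indicator {T n<..} x / sqrt (real (k n)))\<^sup>2 \<partial>expo)) \<longlonglongrightarrow> 0"
  proof (rule Lim_null_comparison[OF _ bound0])
    show "\<forall>\<^sub>F n in sequentially. norm (real (N n) * (\<integral>x. ((G x - G (T n)) * indicator {T n<..} x / sqrt (real (k n)))\<^sup>2 \<partial>expo))
        \<le> \<bar>C\<bar> * (1 / sqrt (real (k n)) * (sqrt (real (k n)) * a (T n)))\<^sup>2"
      using N_exp_T T_pos C'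
    proof eventually_elim
      case (elim n)
      have nn: "(\<integral>y. (h n y)\<^sup>2 \<partial>expo) \<ge> 0" by simp
      have "real (N n) * (\<integral>x. ((G x - G (T n)) * indicator {T n<..} x / sqrt (real (k n)))\<^sup>2 \<partial>expo) =
          real (N n) * exp (- T n) / real (k n) * (\<integral>y. (h n y)\<^sup>2 \<partial>expo)"
        unfolding f2 using elim(2) integral_expo_shift[of "\<lambda>y. (h n y)\<^sup>2" "T n"] by simp
      also have "\<dots> = (\<integral>y. (h n y)\<^sup>2 \<partial>expo)" unfolding elim(1) using k_pos[of n] by simp
      finally have eq: "real (N n) * (\<integral>x. ((G x - G (T n)) * indicator {T n<..} x / sqrt (real (k n)))\<^sup>2 \<partial>expo) = (\<integral>y. (h n y)\<^sup>2 \<partial>expo)" .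
      have "(\<integral>y. (h n y)\<^sup>2 \<partial>expo) \<le> C * (a (T n))\<^sup>2" using elim(3) by (simp add: h_def)
      also have "\<dots> \<le> \<bar>C\<bar> * (a (T n))\<^sup>2" by (intro mult_right_mono) auto
      also have "a (T n) = 1 / sqrt (real (k n)) * (sqrt (real (k n)) * a (T n))" using k_pos[of n] by simp
      finally show ?case unfolding eq using nn by simp
    qed
  qed
qed measurable

text \<open>The excess sum at the random threshold is smaller than the one at \<open>T n\<close> by
  about \<open>k n * (\<tau> - T n)\<close>. By the Bahadur expansion this is
  \<open>exceed - k n\<close> to first order, and subtracting it together with \<open>k n\<close>
  leaves exactly the centred sum. The remaining errors are a product of two tight terms over
  \<open>sqrt k\<close> and the change of \<open>G\<close>.\<close>

theorem hill_expansion: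
  assumes \<mu>: "real_distribution \<mu>" and so: "second_order_cond \<mu> \<gamma> \<rho> A"
    and X: "\<And>i. i \<ge> 1 \<Longrightarrow> AE w in M. X i w = tail_quantile \<mu> (exp (W i w))"
    and lam: "(\<lambda>n. sqrt (real (k n)) * A (real (N n) / real (k n))) \<longlonglongrightarrow> lam"
  shows "((\<lambda>p. sqrt (real (k (fst p))) * (hill (\<lambda>i. X i (snd p)) (N (fst p)) (k (fst p)) - \<gamma>)
      - \<gamma> * pareto_sum (fst p) (snd p)) \<longlongrightarrow> lam / (1 - \<rho>)) (whp M)"
proof -
  interpret \<mu>: real_distribution \<mu> by fact
  have \<rho>: "\<rho> \<le> 0" and \<gamma>: "\<gamma> > 0" using so by (auto simp: second_order_cond_def)
  obtain G a where G [measurable]: "G \<in> borel_measurable borel" and a [measurable]: "a \<in> borel_measurable borel"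
    and Upos: "\<forall>\<^sub>F s in at_top. tail_quantile \<mu> (exp s) > 0"
    and log: "\<And>s. s > 0 \<Longrightarrow> ln (tail_quantile \<mu> (exp s)) = \<gamma> * s + G s"
    and aA: "((\<lambda>s. a s / A (exp s)) \<longlongrightarrow> 1) at_top" and Anz: "\<forall>\<^sub>F s in at_top. A (exp s) \<noteq> 0"
    and anz: "\<forall>\<^sub>F s in at_top. a s \<noteq> 0"
    and erv: "\<And>y. ((\<lambda>s. (G (s + y) - G s) / a s) \<longlongrightarrow> erv_limit \<rho> y) at_top"
    by (rule \<mu>.second_order_expansion[OF so]) (rule that)
  \<comment> \<open>The rate is stated for \<open>A\<close> at \<open>N / k\<close>, which is
    \<open>exp (T n)\<close>; the equivalence of \<open>a\<close> and \<open>A\<close> transfers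
    it.\<close>
  have lam_a: "(\<lambda>n. sqrt (real (k n)) * a (T n)) \<longlonglongrightarrow> lam"
  proof -
    have "(\<lambda>n. (sqrt (real (k n)) * A (real (N n) / real (k n))) * (a (T n) / A (exp (T n)))) \<longlonglongrightarrow> lam * 1"
      by (intro tendsto_mult lam filterlim_compose[OF aA T_lim])
    then have "(\<lambda>n. (sqrt (real (k n)) * A (real (N n) / real (k n))) * (a (T n) / A (exp (T n)))) \<longlonglongrightarrow> lam" by simp
    then show ?thesis
    proof (rule Lim_transform_eventually)
      show "\<forall>\<^sub>F n in sequentially. (sqrt (real (k n)) * A (real (N n) / real (k n))) * (a (T n) / A (exp (T n)))
          = sqrt (real (k n)) * a (T n)"
        using eventually_compose_filterlim[OF Anz T_lim] N_pos
      proof eventually_elim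
        case (elim n)
        have "exp (T n) = real (N n) / real (k n)" using elim(2) k_pos[of n] by (simp add: T_def)
        then show ?case using elim(1) by simp
      qed
    qed
  qed
  define m where "m p = (\<Sum>i=1..N (fst p). (G (W i (snd p)) - G (T (fst p))) * indicator {T (fst p)<..} (W i (snd p)) / sqrt (real (k (fst p))))" for p
  define rem where "rem p = (\<Sum>i=1..N (fst p). (G (W i (snd p)) - G (\<tau> (fst p) (snd p))) * indicator {\<tau> (fst p) (snd p)<..} (W i (snd p)) / sqrt (real (k (fst p)))) - m p" for p
  define Z where "Z n w = sqrt (real (k n)) * (\<tau> n w - T n)" for n w
  have m: "(m \<longlongrightarrow> lam / (1 - \<rho>)) (whp M)"
    unfolding m_def by (rule remainder_mean[OF G a erv anz \<rho> lam_a])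
  have rem: "(rem \<longlongrightarrow> 0) (whp M)"
  proof (rule tendstoI)
    fix e :: real assume "e > 0"
    define l where "l = \<bar>lam\<bar> + 1"
    have l: "l > 0" by (simp add: l_def)
    \<comment> \<open>With at most \<open>2 * k n\<close> exceedances of \<open>T n\<close> the
      normalised change of the remainder is at most \<open>4 * \<epsilon> * l\<close>, which is half
      of \<open>e\<close>.\<close>
    define \<epsilon> where "\<epsilon> = e / (8 * l)"
    have \<epsilon>: "\<epsilon> > 0" using \<open>e > 0\<close> l by (simp add: \<epsilon>_def)
    obtain \<delta> where \<delta>: "\<delta> > 0" "\<forall>\<^sub>F s in at_top. \<forall>y. \<bar>y\<bar> \<le> \<delta> \<longrightarrow> \<bar>G (s + y) - G s\<bar> \<le> \<epsilon> * \<bar>a s\<bar>"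
      using erv_small_increments[OF G a erv anz \<rho> \<epsilon>] by blast
    have "\<forall>\<^sub>F n in sequentially. \<bar>sqrt (real (k n)) * a (T n)\<bar> < l"
      by (rule order_tendstoD(2)[OF tendsto_rabs[OF lam_a]]) (simp add: l_def)
    note det = eventually_whp_deterministic[OF this]
      eventually_whp_deterministic[OF eventually_compose_filterlim[OF \<delta>(2) T_lim]]
      eventually_whp_deterministic[OF k_less_N]
    have E: "\<forall>\<^sub>F p in whp M. exceed (fst p) (T (fst p)) (snd p) / real (k (fst p)) < 2"
      by (rule order_tendstoD(2)[OF exceed_T_ratio]) simp
    show "\<forall>\<^sub>F p in whp M. dist (rem p) 0 < e"
      using det E tendstoD[OF quantile_tendsto \<delta>(1)]
    proof eventually_elim
      case (elim p)
      obtain n w where p: "p = (n, w)" by (cases p)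
      have kn: "real (k n) > 0" "sqrt (real (k n)) > 0" using k_pos[of n] by auto
      have "\<bar>(\<Sum>i=1..N n. (G (W i w) - G (\<tau> n w)) * indicator {\<tau> n w<..} (W i w))
          - (\<Sum>i=1..N n. (G (W i w) - G (T n)) * indicator {T n<..} (W i w))\<bar>
        \<le> (\<epsilon> * \<bar>a (T n)\<bar>) * (2 * real (k n) + (\<Sum>i=1..N n. indicator {T n<..} (W i w)))"
      proof (rule remainder_sum_change[OF k_pos])
        show "k n < N n" using elim p by simp
        show "\<tau> n w = order_stat (\<lambda>i. W i w) (N n) (N n - k n)" by (simp add: \<tau>_def)
        fix y assume "\<bar>y - T n\<bar> \<le> \<bar>\<tau> n w - T n\<bar>"
        with elim(5) have "\<bar>y - T n\<bar> \<le> \<delta>" by (simp add: p)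
        with elim(2) have "\<bar>G (T n + (y - T n)) - G (T n)\<bar> \<le> \<epsilon> * \<bar>a (T n)\<bar>" unfolding p fst_conv by blast
        then show "\<bar>G y - G (T n)\<bar> \<le> \<epsilon> * \<bar>a (T n)\<bar>" by simp
      qed
      also have "\<dots> \<le> (\<epsilon> * \<bar>a (T n)\<bar>) * (4 * real (k n))"
        using elim(4) kn \<epsilon> by (intro mult_left_mono) (auto simp: p exceed_def divide_less_eq)
      finally have "\<bar>rem p\<bar> * sqrt (real (k n)) \<le> (\<epsilon> * \<bar>a (T n)\<bar>) * (4 * real (k n))"
        using kn by (simp add: rem_def m_def p sum_divide_distrib[symmetric] diff_divide_distrib[symmetric] abs_divide)
      also have "\<dots> = 4 * \<epsilon> * \<bar>sqrt (real (k n)) * a (T n)\<bar> * sqrt (real (k n))"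
        using kn by (simp add: abs_mult)
      finally have "\<bar>rem p\<bar> \<le> 4 * \<epsilon> * \<bar>sqrt (real (k n)) * a (T n)\<bar>"
        using kn by simp
      also have "\<dots> \<le> 4 * \<epsilon> * l" using elim(1) \<epsilon> by (intro mult_left_mono) (auto simp: p)
      also have "\<dots> = e / 2" using l by (simp add: \<epsilon>_def)
      finally show ?case using \<open>e > 0\<close> by simp
    qed
  qed
  have prod: "((\<lambda>p. 1 / sqrt (real (k (fst p))) * Wn (fst p) (snd p) * Z (fst p) (snd p)) \<longlongrightarrow> 0) (whp M)"
    unfolding Z_def
    by (intro tendsto_whp_0_mult_tight[OF tight_quantile, of "\<lambda>n w. 1 / sqrt (real (k n)) * Wn n w"]
        tendsto_whp_0_mult_tight[OF tight_Wn, of "\<lambda>n w. 1 / sqrt (real (k n))"]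
        tendsto_whp_deterministic[OF inverse_sqrt_k])
  define Y where "Y p = sqrt (real (k (fst p))) * (hill (\<lambda>i. X i (snd p)) (N (fst p)) (k (fst p)) - \<gamma>)
      - \<gamma> * pareto_sum (fst p) (snd p)" for p
  have bound: "\<forall>\<^sub>F p in whp M. norm (Y p - m p) \<le> \<gamma> * \<bar>1 / sqrt (real (k (fst p))) * Wn (fst p) (snd p) * Z (fst p) (snd p)\<bar>
      + \<gamma> * \<bar>Z (fst p) (snd p) - Wn (fst p) (snd p)\<bar> + \<bar>rem p\<bar>"
  proof -
    obtain s0 where s0: "\<And>s. s \<ge> s0 \<Longrightarrow> tail_quantile \<mu> (exp s) > 0"
      using Upos unfolding eventually_at_top_linorder by blast
    have "AE w in M. \<forall>i\<in>{1..N n}. W i w > 0 \<and> X i w = tail_quantile \<mu> (exp (W i w))" for n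
    proof (rule AE_finite_allI)
      fix i assume "i \<in> {1..N n}"
      then have "AE w in M. W i w > 0" "AE w in M. X i w = tail_quantile \<mu> (exp (W i w))"
        using AE_W_pos X by auto
      then show "AE w in M. W i w > 0 \<and> X i w = tail_quantile \<mu> (exp (W i w))" by eventually_elim simp
    qed simp
    note ae = eventually_whp_AE[of "\<lambda>n w. \<forall>i\<in>{1..N n}. W i w > 0 \<and> X i w = tail_quantile \<mu> (exp (W i w))", OF this]
    show ?thesis
      using ae eventually_whp_deterministic[OF k_less_N] tendstoD[OF quantile_tendsto zero_less_one]
        eventually_whp_deterministic[OF eventually_compose_filterlim[OF eventually_ge_at_top[of "s0 + 1"] T_lim]]
    proof eventually_elim
      case (elim p)
      obtain n w where p: "p = (n, w)" by (cases p)
      define q where "q = sqrt (real (k n))"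
      have kn: "q > 0" "real (k n) = q * q" using k_pos[of n] by (auto simp: q_def)
      define L where "L s = (\<Sum>i=1..N n. max 0 (W i w - s))" for s
      define D where "D s = (\<Sum>i=1..N n. (G (W i w) - G s) * indicator {s<..} (W i w))" for s
      define t where "t = \<tau> n w"
      have t: "t = order_stat (\<lambda>i. W i w) (N n) (N n - k n)" by (simp add: t_def \<tau>_def)
      have kN: "k n < N n" using elim(2) by (simp add: p)
      have "t \<ge> s0" using elim(3,4) by (simp add: p t_def dist_real_def)
      have hill: "real (k n) * hill (\<lambda>i. X i w) (N n) (k n) = \<gamma> * L t + D t"
        unfolding L_def D_def
        by (rule hill_decomposition[OF k_pos kN \<mu>.tail_quantile_mono log _ _ t s0[OF \<open>t \<ge> s0\<close>]])
           (use elim(1) in \<open>auto simp: p\<close>)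
      have change: "\<bar>L t - L (T n) + real (k n) * (t - T n)\<bar> \<le> \<bar>t - T n\<bar> * \<bar>exceed n (T n) w - real (k n)\<bar>"
        unfolding L_def exceed_def by (rule excess_sum_change[OF k_pos kN t])
      have ps: "pareto_sum n w = (L (T n) - exceed n (T n) w) / q"
      proof -
        have "(\<Sum>i=1..N n. (W i w - T n - 1) * indicator {T n<..} (W i w)) =
            (\<Sum>i=1..N n. max 0 (W i w - T n) - indicator {T n<..} (W i w))"
          by (intro sum.cong) (auto simp: indicator_def)
        then show ?thesis by (simp add: pareto_sum_def L_def exceed_def q_def sum_subtractf)
      qed
      have Wn: "exceed n (T n) w = q * Wn n w + q * q"
        using kn by (simp add: Wn_def q_def[symmetric])
      have Z: "t - T n = Z n w / q" using kn by (simp add: Z_def q_def[symmetric] t_def)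
      have rm: "rem p + m p = D t / q" "m p = D (T n) / q"
        unfolding rem_def m_def p D_def q_def t_def fst_conv snd_conv sum_divide_distrib by simp_all
      have hill': "q * hill (\<lambda>i. X i w) (N n) (k n) = (\<gamma> * L t + D t) / q"
        using hill kn by (simp add: field_simps)
      define d where "d = L t - L (T n) + real (k n) * (t - T n)"
      have "Y p - m p = (\<gamma> * L t + D t) / q - q * \<gamma> - \<gamma> * ((L (T n) - exceed n (T n) w) / q) - m p"
        using hill' by (simp add: Y_def p q_def[symmetric] ps right_diff_distrib)
      also have "\<dots> = \<gamma> * d / q - \<gamma> * (Z n w - Wn n w) + rem p"
      proof -
        have rem_eq: "rem p = D t / q - m p" using rm by simp
        have L_eq: "L t = d + L (T n) - q * Z n w" using kn Z by (simp add: d_def field_simps)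
        show ?thesis unfolding Wn rem_eq L_eq using kn(1) by (simp add: field_simps)
      qed
      finally have eq: "Y p - m p = \<gamma> * d / q - \<gamma> * (Z n w - Wn n w) + rem p" .
      have "\<bar>d\<bar> \<le> \<bar>Z n w\<bar> / q * (q * \<bar>Wn n w\<bar>)"
        using change kn unfolding d_def Z Wn by (simp add: abs_mult abs_divide)
      then have "\<bar>d\<bar> / q \<le> \<bar>1 / q * Wn n w * Z n w\<bar>"
        using kn by (simp add: abs_mult divide_right_mono mult.commute)
      then have "\<gamma> * (\<bar>d\<bar> / q) \<le> \<gamma> * \<bar>1 / q * Wn n w * Z n w\<bar>" using \<gamma> by (intro mult_left_mono) auto
      moreover have "\<bar>\<gamma> * d / q\<bar> = \<gamma> * (\<bar>d\<bar> / q)" using \<gamma> kn by (simp add: abs_mult abs_divide)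
      moreover have "\<bar>\<gamma> * (Z n w - Wn n w)\<bar> = \<gamma> * \<bar>Z n w - Wn n w\<bar>" using \<gamma> by (simp add: abs_mult)
      ultimately show ?case unfolding eq unfolding p fst_conv snd_conv q_def[symmetric] real_norm_def by linarith
    qed
  qed
  have "((\<lambda>p. \<gamma> * \<bar>1 / sqrt (real (k (fst p))) * Wn (fst p) (snd p) * Z (fst p) (snd p)\<bar>
      + \<gamma> * \<bar>Z (fst p) (snd p) - Wn (fst p) (snd p)\<bar> + \<bar>rem p\<bar>) \<longlongrightarrow> 0) (whp M)"
    using bahadur unfolding Z_def[symmetric]
    by (intro tendsto_add_zero tendsto_mult_right_zero tendsto_rabs_zero prod rem)
  from tendsto_add[OF Lim_null_comparison[OF bound this] m]
  show ?thesis unfolding Y_def by simp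
qed

end

section \<open>Limiting covariances of exceedances\<close>

text \<open>\<open>r x\<close> stands for the tail dependence function at \<open>(1, x)\<close>: a
  coordinate is at least \<open>ln (s / x)\<close> exactly when its survival value is at most
  \<open>x / s\<close>. Homogeneity will recover the other values from this slice.\<close>

locale expo_pair = prob_space +
  fixes U V :: "'a \<Rightarrow> real" and r :: "real \<Rightarrow> real"
  assumes U_meas [measurable]: "U \<in> borel_measurable M" and V_meas [measurable]: "V \<in> borel_measurable M"
    and distr_U: "distr M borel U = expo" and distr_V: "distr M borel V = expo"
    and tail_lim: "\<And>x. x > 0 \<Longrightarrow>
      ((\<lambda>s. s * prob {w \<in> space M. ln s \<le> U w \<and> ln (s / x) \<le> V w}) \<longlongrightarrow> r x) at_top"
begin

lemma prob_expo_atLeast: "s \<ge> 0 \<Longrightarrow> expo.prob {s..} = exp (- s)"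
proof -
  assume s: "s \<ge> 0"
  have "expo.prob {s<..} = exp (- s)"
    using s integral_expo_shift[of "\<lambda>_. 1" s] by (simp add: expo.prob_space[simplified])
  moreover have "expo.prob {s..} = expo.prob {s<..}"
  proof (rule measure_eq_AE)
    have "AE x in lborel. x \<noteq> s" by (rule AE_lborel_singleton)
    then have "AE x in expo. x \<noteq> s"
      unfolding expo_def by (subst AE_density) (auto elim: eventually_mono)
    then show "AE x in expo. x \<in> {s..} \<longleftrightarrow> x \<in> {s<..}" by eventually_elim auto
  qed auto
  ultimately show ?thesis by simp
qed

lemma prob_V: "s \<ge> 0 \<Longrightarrow> prob {w \<in> space M. s \<le> V w} = exp (- s)"
  using prob_expo_atLeast[of s] by (simp add: distr_V[symmetric] measure_distr vimage_def Int_def conj_commute)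

lemma prob_U: "s \<ge> 0 \<Longrightarrow> prob {w \<in> space M. s \<le> U w} = exp (- s)"
  using prob_expo_atLeast[of s] by (simp add: distr_U[symmetric] measure_distr vimage_def Int_def conj_commute)

lemma integrable_U_iff: "f \<in> borel_measurable borel \<Longrightarrow> integrable M (\<lambda>w. f (U w) :: real) \<longleftrightarrow> integrable expo f"
  by (simp add: distr_U[symmetric] integrable_distr_eq)

lemma integrable_V_iff: "f \<in> borel_measurable borel \<Longrightarrow> integrable M (\<lambda>w. f (V w) :: real) \<longleftrightarrow> integrable expo f"
  by (simp add: distr_V[symmetric] integrable_distr_eq)

text \<open>The joint tail probability relative to the marginal tail \<open>exp (- t)\<close> of
  \<open>U\<close>, hence bounded by one for nonnegative \<open>t\<close>.\<close>

definition Q :: "real \<Rightarrow> real \<Rightarrow> real" where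
  "Q t t' = exp t * prob {w \<in> space M. t \<le> U w \<and> t' \<le> V w}"

lemma prob_diff_V:
  assumes "a \<ge> 0" "b \<ge> 0"
  shows "\<bar>prob {w \<in> space M. t \<le> U w \<and> a \<le> V w} - prob {w \<in> space M. t \<le> U w \<and> b \<le> V w}\<bar> \<le> \<bar>exp (- a) - exp (- b)\<bar>"
proof -
  have *: "\<bar>prob {w \<in> space M. t \<le> U w \<and> a \<le> V w} - prob {w \<in> space M. t \<le> U w \<and> b \<le> V w}\<bar> \<le> \<bar>exp (- a) - exp (- b)\<bar>"
    if "a \<le> b" "a \<ge> 0" for a b
  proof -
    have "prob {w \<in> space M. t \<le> U w \<and> a \<le> V w} - prob {w \<in> space M. t \<le> U w \<and> b \<le> V w}
        = prob ({w \<in> space M. t \<le> U w \<and> a \<le> V w} - {w \<in> space M. t \<le> U w \<and> b \<le> V w})"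
      using that by (intro finite_measure_Diff[symmetric]) auto
    also have "\<dots> \<le> prob ({w \<in> space M. a \<le> V w} - {w \<in> space M. b \<le> V w})"
      by (intro finite_measure_mono) auto
    also have "\<dots> = prob {w \<in> space M. a \<le> V w} - prob {w \<in> space M. b \<le> V w}"
      using that by (intro finite_measure_Diff) auto
    also have "\<dots> = exp (- a) - exp (- b)" using that by (simp add: prob_V)
    finally have "prob {w \<in> space M. t \<le> U w \<and> a \<le> V w} - prob {w \<in> space M. t \<le> U w \<and> b \<le> V w} \<le> exp (- a) - exp (- b)" .
    moreover have "prob {w \<in> space M. t \<le> U w \<and> a \<le> V w} \<ge> prob {w \<in> space M. t \<le> U w \<and> b \<le> V w}"
      using that by (intro finite_measure_mono) auto
    ultimately show ?thesis by linarith
  qed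
  show ?thesis using *[of a b] *[of b a] assms by (cases "a \<le> b") (auto simp: abs_minus_commute)
qed

text \<open>\<open>tail_lim\<close> covers thresholds at a fixed distance. For a distance that
  merely converges, the error is at most the marginal mass between two thresholds of
  \<open>V\<close>, which is \<open>exp (- t n)\<close> times a vanishing factor.\<close>

lemma Q_tendsto:
  assumes t: "filterlim t at_top sequentially" and d: "(\<lambda>n. t' n - t n) \<longlonglongrightarrow> \<theta>"
  shows "(\<lambda>n. Q (t n) (t' n)) \<longlonglongrightarrow> r (exp (- \<theta>))"
proof -
  have t\<theta>: "filterlim (\<lambda>n. \<theta> + t n) at_top sequentially"
    by (rule filterlim_tendsto_add_at_top[OF tendsto_const t])
  have t': "filterlim t' at_top sequentially"
    using filterlim_tendsto_add_at_top[OF d t] by simp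
  have 1: "(\<lambda>n. exp (t n) * prob {w \<in> space M. t n \<le> U w \<and> t n + \<theta> \<le> V w}) \<longlonglongrightarrow> r (exp (- \<theta>))"
  proof -
    have "(\<lambda>n. exp (t n) * prob {w \<in> space M. ln (exp (t n)) \<le> U w \<and> ln (exp (t n) / exp (- \<theta>)) \<le> V w}) \<longlonglongrightarrow> r (exp (- \<theta>))"
      by (rule filterlim_compose[OF tail_lim filterlim_compose[OF exp_at_top t]]) simp
    moreover have "ln (exp a / exp (- \<theta>)) = a + \<theta>" for a by (simp add: ln_div)
    ultimately show ?thesis by simp
  qed
  have "(\<lambda>n. \<bar>exp (- (t' n - t n)) - exp (- \<theta>)\<bar>) \<longlonglongrightarrow> \<bar>exp (- \<theta>) - exp (- \<theta>)\<bar>"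
    by (intro tendsto_intros d)
  then have d0: "(\<lambda>n. \<bar>exp (- (t' n - t n)) - exp (- \<theta>)\<bar>) \<longlonglongrightarrow> 0" by simp
  have "(\<lambda>n. Q (t n) (t' n) - exp (t n) * prob {w \<in> space M. t n \<le> U w \<and> t n + \<theta> \<le> V w}) \<longlonglongrightarrow> 0"
  proof (rule Lim_null_comparison[OF _ d0])
    show "\<forall>\<^sub>F n in sequentially. norm (Q (t n) (t' n) - exp (t n) * prob {w \<in> space M. t n \<le> U w \<and> t n + \<theta> \<le> V w})
        \<le> \<bar>exp (- (t' n - t n)) - exp (- \<theta>)\<bar>"
      using eventually_compose_filterlim[OF eventually_ge_at_top[of 0] t']
        eventually_compose_filterlim[OF eventually_ge_at_top[of 0] t\<theta>]
    proof eventually_elim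
      case (elim n)
      have "norm (Q (t n) (t' n) - exp (t n) * prob {w \<in> space M. t n \<le> U w \<and> t n + \<theta> \<le> V w}) =
        exp (t n) * \<bar>prob {w \<in> space M. t n \<le> U w \<and> t' n \<le> V w} - prob {w \<in> space M. t n \<le> U w \<and> t n + \<theta> \<le> V w}\<bar>"
        by (simp add: Q_def right_diff_distrib[symmetric] abs_mult)
      also have "\<dots> \<le> exp (t n) * \<bar>exp (- t' n) - exp (- (t n + \<theta>))\<bar>"
        using elim by (intro mult_left_mono prob_diff_V) (auto simp: add.commute)
      also have "\<dots> = \<bar>exp (t n) * (exp (- t' n) - exp (- (t n + \<theta>)))\<bar>" by (simp add: abs_mult)
      also have "exp (t n) * (exp (- t' n) - exp (- (t n + \<theta>))) = exp (- (t' n - t n)) - exp (- \<theta>)"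
        by (simp add: right_diff_distrib exp_add[symmetric])
      finally show ?case .
    qed
  qed
  from tendsto_add[OF this 1] show ?thesis by simp
qed

text \<open>Tonelli's theorem, for writing moments of excesses as exponential mixtures of tail
  quantities. Since the mixing measure is a probability, bounded integrands are enough for passing
  to the limit.\<close>

lemma expectation_expo_swap:
  fixes f :: "'a \<Rightarrow> real \<Rightarrow> real"
  assumes [measurable]: "(\<lambda>(w, p). f w p) \<in> borel_measurable (M \<Otimes>\<^sub>M expo)"
    and meas [measurable]: "g \<in> borel_measurable M" "h \<in> borel_measurable borel"
    and nonneg: "\<And>w. g w \<ge> 0" "\<And>p. h p \<ge> 0"
    and g: "\<And>w. w \<in> space M \<Longrightarrow> (\<integral>\<^sup>+p. ennreal (f w p) \<partial>expo) = ennreal (g w)"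
    and h: "\<And>p. p > 0 \<Longrightarrow> (\<integral>\<^sup>+w. ennreal (f w p) \<partial>M) = ennreal (h p)"
  shows "expectation g = (\<integral>p. h p \<partial>expo)"
proof -
  interpret P: pair_prob_space M expo ..
  have "(\<integral>\<^sup>+w. ennreal (g w) \<partial>M) = (\<integral>\<^sup>+w. (\<integral>\<^sup>+p. ennreal (f w p) \<partial>expo) \<partial>M)"
    by (intro nn_integral_cong) (simp add: g)
  also have "\<dots> = (\<integral>\<^sup>+p. (\<integral>\<^sup>+w. ennreal (f w p) \<partial>M) \<partial>expo)"
    by (intro P.Fubini'[symmetric]) measurable
  also have "\<dots> = (\<integral>\<^sup>+p. ennreal (h p) \<partial>expo)"
    by (intro nn_integral_cong_AE) (use AE_expo_nonneg in \<open>eventually_elim, simp add: h\<close>)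
  finally show ?thesis
    using nonneg by (simp add: integral_eq_nn_integral)
qed

lemma nn_integral_expo_exp:
  assumes [measurable]: "f \<in> borel_measurable borel"
  shows "(\<integral>\<^sup>+p. ennreal (exp p) * f p \<partial>expo) = (\<integral>\<^sup>+p. f p * indicator {0..} p \<partial>lborel)"
proof -
  have "(\<integral>\<^sup>+p. ennreal (exp p) * f p \<partial>expo) = (\<integral>\<^sup>+p. ennreal (exponential_density 1 p) * (ennreal (exp p) * f p) \<partial>lborel)"
    unfolding expo_def by (subst nn_integral_density) auto
  also have "\<dots> = (\<integral>\<^sup>+p. f p * indicator {0..} p \<partial>lborel)"
    by (intro nn_integral_cong)
       (auto simp: exponential_density_def mult.assoc[symmetric] ennreal_mult[symmetric] exp_add[symmetric] split: split_indicator)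
  finally show ?thesis .
qed

text \<open>Intermediate between \<open>Q\<close> and the mixed moment: one coordinate keeps its
  excess, the other only its indicator.\<close>

definition K :: "real \<Rightarrow> real \<Rightarrow> real" where
  "K t t' = exp t * expectation (\<lambda>w. max 0 (U w - t) * indicator {t'..} (V w))"

lemma Q_measurable: "(\<lambda>p. Q (t + p) t') \<in> borel_measurable borel"
proof -
  have "(\<lambda>p. prob {w \<in> space M. t + p \<le> U w \<and> t' \<le> V w}) = (\<lambda>p. \<integral>w. indicator {w. t + p \<le> U w \<and> t' \<le> V w} w \<partial>M)"
    by (auto simp: fun_eq_iff Int_def conj_commute intro!: arg_cong[where f = prob])
  also have "\<dots> \<in> borel_measurable borel"
    by (intro borel_measurable_lebesgue_integral) (simp add: indicator_def, measurable)
  finally show ?thesis unfolding Q_def by measurable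
qed

lemma Q_bounds:
  assumes "t \<ge> 0"
  shows "0 \<le> Q t t'" "Q t t' \<le> 1"
proof -
  have "prob {w \<in> space M. t \<le> U w \<and> t' \<le> V w} \<le> prob {w \<in> space M. t \<le> U w}"
    by (intro finite_measure_mono) auto
  then have "exp t * prob {w \<in> space M. t \<le> U w \<and> t' \<le> V w} \<le> exp t * exp (- t)"
    using assms by (intro mult_left_mono) (auto simp: prob_U)
  then show "0 \<le> Q t t'" "Q t t' \<le> 1" by (auto simp: Q_def exp_minus)
qed

text \<open>The layer-cake formula for the excess of \<open>U\<close>. The factor
  \<open>exp p\<close> cancels the exponential density and at the same time renormalises the tail
  probability to the raised threshold, which produces \<open>Q\<close>.\<close>

lemma K_eq: "K t t' = (\<integral>p. Q (t + p) t' \<partial>expo)"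
proof -
  have "expectation (\<lambda>w. max 0 (U w - t) * indicator {t'..} (V w)) = (\<integral>p. exp p * prob {w \<in> space M. t + p \<le> U w \<and> t' \<le> V w} \<partial>expo)"
  proof (rule expectation_expo_swap[where f = "\<lambda>w p. exp p * (indicator {..U w - t} p * indicator {t'..} (V w))"])
    show "(\<lambda>(w, p). exp p * (indicator {..U w - t} p * indicator {t'..} (V w))) \<in> borel_measurable (M \<Otimes>\<^sub>M expo)"
      by (simp add: indicator_def split_beta') measurable
    show "(\<lambda>p. exp p * prob {w \<in> space M. t + p \<le> U w \<and> t' \<le> V w}) \<in> borel_measurable borel"
      using borel_measurable_times[OF Q_measurable[of t t'], of "\<lambda>p. exp (- t)"]
      by (simp add: Q_def exp_add exp_minus field_simps)
    fix w
    have "(\<integral>\<^sup>+p. ennreal (exp p * (indicator {..U w - t} p * indicator {t'..} (V w))) \<partial>expo)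
        = (\<integral>\<^sup>+p. ennreal (exp p) * (indicator {..U w - t} p * indicator {t'..} (V w)) \<partial>expo)"
      by (intro nn_integral_cong) (auto split: split_indicator)
    also have "\<dots> = (\<integral>\<^sup>+p. indicator {..U w - t} p * indicator {t'..} (V w) * indicator {0..} p \<partial>lborel)"
      by (rule nn_integral_expo_exp) measurable
    also have "\<dots> = (\<integral>\<^sup>+p. indicator {t'..} (V w) * indicator {0..U w - t} p \<partial>lborel)"
      by (intro nn_integral_cong) (auto split: split_indicator)
    also have "\<dots> = indicator {t'..} (V w) * emeasure lborel {0..U w - t}"
      by (simp add: nn_integral_cmult)
    also have "emeasure lborel {0..U w - t} = ennreal (max 0 (U w - t))"
      by (simp add: emeasure_lborel_Icc_eq max_def)
    also have "indicator {t'..} (V w) * ennreal (max 0 (U w - t)) = ennreal (max 0 (U w - t) * indicator {t'..} (V w))"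
      by (auto split: split_indicator)
    finally show "(\<integral>\<^sup>+p. ennreal (exp p * (indicator {..U w - t} p * indicator {t'..} (V w))) \<partial>expo)
        = ennreal (max 0 (U w - t) * indicator {t'..} (V w))" .
  next
    fix p :: real
    have "(\<integral>\<^sup>+w. ennreal (exp p * (indicator {..U w - t} p * indicator {t'..} (V w))) \<partial>M) =
        (\<integral>\<^sup>+w. ennreal (exp p) * indicator {w \<in> space M. t + p \<le> U w \<and> t' \<le> V w} w \<partial>M)"
      by (intro nn_integral_cong) (auto split: split_indicator simp: algebra_simps)
    also have "\<dots> = ennreal (exp p) * emeasure M {w \<in> space M. t + p \<le> U w \<and> t' \<le> V w}"
      by (subst nn_integral_cmult) auto
    finally show "(\<integral>\<^sup>+w. ennreal (exp p * (indicator {..U w - t} p * indicator {t'..} (V w))) \<partial>M) =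
        ennreal (exp p * prob {w \<in> space M. t + p \<le> U w \<and> t' \<le> V w})"
      by (simp add: emeasure_eq_measure ennreal_mult)
  qed (auto split: split_indicator)
  then have "K t t' = (\<integral>p. exp t * (exp p * prob {w \<in> space M. t + p \<le> U w \<and> t' \<le> V w}) \<partial>expo)"
    by (simp add: K_def)
  then show ?thesis by (simp add: Q_def exp_add mult.assoc)
qed

lemma K_bounds:
  assumes "t \<ge> 0"
  shows "0 \<le> K t t'" "K t t' \<le> 1"
proof -
  have int: "integrable expo (\<lambda>p. Q (t + p) t')"
  proof (rule expo.integrable_const_bound[of _ 1])
    show "AE p in expo. norm (Q (t + p) t') \<le> 1"
      using AE_expo_nonneg by eventually_elim (use Q_bounds assms in \<open>auto intro: order_trans\<close>)
  qed (use Q_measurable in simp)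
  have "(\<integral>p. Q (t + p) t' \<partial>expo) \<le> (\<integral>p. 1 \<partial>expo)"
  proof (rule integral_mono_AE[OF int])
    show "AE p in expo. Q (t + p) t' \<le> 1"
      using AE_expo_nonneg by eventually_elim (use Q_bounds assms in auto)
  qed simp
  then show "K t t' \<le> 1" by (simp add: K_eq expo.prob_space[simplified])
  show "0 \<le> K t t'" by (simp add: K_def)
qed

lemma K_tendsto:
  assumes t: "filterlim t at_top sequentially" and d: "(\<lambda>n. t' n - t n) \<longlonglongrightarrow> \<theta>"
  shows "(\<lambda>n. K (t n) (t' n)) \<longlonglongrightarrow> (\<integral>p. r (exp (p - \<theta>)) \<partial>expo)"
proof -
  have meas [measurable]: "(\<lambda>p. Q (t n + p) (t' n)) \<in> borel_measurable expo" for n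
    using Q_measurable by simp
  have lim: "(\<lambda>n. Q (t n + p) (t' n)) \<longlonglongrightarrow> r (exp (p - \<theta>))" for p
  proof -
    have 1: "filterlim (\<lambda>n. p + t n) at_top sequentially"
      by (rule filterlim_tendsto_add_at_top[OF tendsto_const t])
    have 2: "(\<lambda>n. t' n - (p + t n)) \<longlonglongrightarrow> \<theta> - p" using tendsto_diff[OF d tendsto_const[of p]] by (simp add: algebra_simps)
    from Q_tendsto[OF 1 2] show ?thesis by (simp add: add.commute)
  qed
  \<comment> \<open>The bound by one requires nonnegative thresholds, so the sequence is started at
    \<open>n0\<close>.\<close>
  from t obtain n0 where n0: "\<And>n. n \<ge> n0 \<Longrightarrow> t n \<ge> 0"
    unfolding filterlim_at_top eventually_sequentially by blast
  have "(\<lambda>n. K (t (n + n0)) (t' (n + n0))) \<longlonglongrightarrow> (\<integral>p. r (exp (p - \<theta>)) \<partial>expo)"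
    unfolding K_eq
  proof (rule integral_dominated_convergence[where w = "\<lambda>_. 1"])
    show "(\<lambda>p. r (exp (p - \<theta>))) \<in> borel_measurable expo"
      by (rule borel_measurable_LIMSEQ_real[OF lim meas])
    show "AE p in expo. (\<lambda>n. Q (t (n + n0) + p) (t' (n + n0))) \<longlonglongrightarrow> r (exp (p - \<theta>))"
      using lim by (intro AE_I2 LIMSEQ_ignore_initial_segment)
    show "AE p in expo. norm (Q (t (n + n0) + p) (t' (n + n0))) \<le> 1" for n
      using AE_expo_nonneg
    proof eventually_elim
      case (elim p)
      then have "t (n + n0) + p \<ge> 0" using n0[of "n + n0"] by simp
      from Q_bounds[OF this, of "t' (n + n0)"] show ?case by simp
    qed
  qed auto
  then show ?thesis by (rule LIMSEQ_offset)
qed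

end

text \<open>Differentiating
  \<open>(A - h)\<^sup>+ (B - h)\<^sup>+\<close> in \<open>h\<close> writes the mixed moment as an exponential mixture of the two
  one-sided moments at shifted thresholds, so these cancel in the limit.\<close>

lemma nn_integral_product_derivative:
  fixes A B :: real
  shows "(\<integral>\<^sup>+h. ennreal (max 0 (A - h) * indicator {..B} h + max 0 (B - h) * indicator {..A} h) * indicator {0..} h \<partial>lborel)
    = ennreal (max 0 A * max 0 B)"
proof (cases "A > 0 \<and> B > 0")
  case True
  define m where "m = min A B"
  have m: "0 \<le> m" using True by (simp add: m_def)
  have "(\<integral>\<^sup>+h. ennreal (max 0 (A - h) * indicator {..B} h + max 0 (B - h) * indicator {..A} h) * indicator {0..} h \<partial>lborel)
      = (\<integral>\<^sup>+h. ennreal ((A - h) + (B - h)) * indicator {0..m} h \<partial>lborel)"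
    by (intro nn_integral_cong) (auto simp: m_def max_def min_def simp del: ennreal_plus split: split_indicator)
  also have "\<dots> = ennreal (- ((A - m) * (B - m)) - - ((A - 0) * (B - 0)))"
    by (rule nn_integral_FTC_Icc) (use m in \<open>auto intro!: derivative_eq_intros simp: m_def algebra_simps\<close>)
  also have "- ((A - m) * (B - m)) - - ((A - 0) * (B - 0)) = max 0 A * max 0 B"
    using True by (auto simp: m_def min_def)
  finally show ?thesis .
next
  case False
  have "(\<integral>\<^sup>+h. ennreal (max 0 (A - h) * indicator {..B} h + max 0 (B - h) * indicator {..A} h) * indicator {0..} h \<partial>lborel)
      = (\<integral>\<^sup>+h. 0 \<partial>(lborel :: real measure))"
    by (intro nn_integral_cong_AE, rule eventually_mono[OF AE_lborel_singleton[of 0]])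
       (use False in \<open>auto simp: max_def split: split_indicator\<close>)
  then show ?thesis using False by (auto simp: max_def not_less)
qed


lemma (in prob_space) integrable_mult_square:
  fixes X Y :: "'a \<Rightarrow> real"
  assumes [measurable]: "X \<in> borel_measurable M" "Y \<in> borel_measurable M"
    and int: "integrable M (\<lambda>w. (X w)\<^sup>2)" "integrable M (\<lambda>w. (Y w)\<^sup>2)"
  shows "integrable M (\<lambda>w. X w * Y w)"
proof (rule Bochner_Integration.integrable_bound)
  show "integrable M (\<lambda>w. (X w)\<^sup>2 + (Y w)\<^sup>2)" using int by simp
  show "AE w in M. norm (X w * Y w) \<le> norm ((X w)\<^sup>2 + (Y w)\<^sup>2)"
  proof (rule AE_I2)
    fix w
    have "0 \<le> (\<bar>X w\<bar> - \<bar>Y w\<bar>)\<^sup>2" by simp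
    then have "2 * (\<bar>X w\<bar> * \<bar>Y w\<bar>) \<le> (X w)\<^sup>2 + (Y w)\<^sup>2" by (simp add: power2_diff)
    moreover have "0 \<le> \<bar>X w\<bar> * \<bar>Y w\<bar>" by simp
    ultimately show "norm (X w * Y w) \<le> norm ((X w)\<^sup>2 + (Y w)\<^sup>2)" 
      unfolding real_norm_def abs_mult using abs_ge_self[of "(X w)\<^sup>2 + (Y w)\<^sup>2"] by linarith
  qed
qed measurable

section \<open>Mixed moments of two excesses\<close>

context expo_pair
begin

lemma integrable_excess_square:
  "integrable M (\<lambda>w. (max 0 (U w - t))\<^sup>2)" "integrable M (\<lambda>w. (max 0 (V w - t))\<^sup>2)"
proof -
  have "integrable expo (\<lambda>x. (max 0 (x - t))\<^sup>2)"
  proof (rule Bochner_Integration.integrable_bound)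
    show "integrable expo (\<lambda>x. 2 * x\<^sup>2 + 2 * t\<^sup>2)" by simp
    show "AE x in expo. norm ((max 0 (x - t))\<^sup>2) \<le> norm (2 * x\<^sup>2 + 2 * t\<^sup>2)"
    proof (rule AE_I2)
      fix x :: real
      have "0 \<le> (x + t)\<^sup>2" by simp
      then have "(x - t)\<^sup>2 \<le> 2 * x\<^sup>2 + 2 * t\<^sup>2" by (simp add: power2_diff power2_sum)
      moreover have "(max 0 (x - t))\<^sup>2 \<le> (x - t)\<^sup>2" by (simp add: max_def)
      ultimately show "norm ((max 0 (x - t))\<^sup>2) \<le> norm (2 * x\<^sup>2 + 2 * t\<^sup>2)" by simp
    qed
  qed measurable
  then show "integrable M (\<lambda>w. (max 0 (U w - t))\<^sup>2)" "integrable M (\<lambda>w. (max 0 (V w - t))\<^sup>2)"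
    by (simp_all add: integrable_U_iff[of "\<lambda>x. (max 0 (x - t))\<^sup>2"] integrable_V_iff[of "\<lambda>x. (max 0 (x - t))\<^sup>2"])
qed

lemma integrable_excess_indicator:
  "integrable M (\<lambda>w. max 0 (U w - t) * indicator {t'..} (V w))"
proof (rule integrable_mult_square[OF _ _ integrable_excess_square(1)])
  show "integrable M (\<lambda>w. (indicator {t'..} (V w))\<^sup>2 :: real)"
    by (intro integrable_const_bound[of _ 1]) (auto split: split_indicator)
qed measurable

lemma K_measurable: "(\<lambda>h. K (t + h) (t' + h)) \<in> borel_measurable borel"
proof -
  have "(\<lambda>h. \<integral>w. max 0 (U w - (t + h)) * (if t' + h \<le> V w then 1 else 0) \<partial>M) \<in> borel_measurable borel"
    by (rule borel_measurable_lebesgue_integral) measurable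
  moreover have "indicator {c..} x = (if c \<le> x then 1 else 0 :: real)" for c x :: real by simp
  ultimately have "(\<lambda>h. expectation (\<lambda>w. max 0 (U w - (t + h)) * indicator {t' + h..} (V w))) \<in> borel_measurable borel"
    by (simp only:)
  then show ?thesis unfolding K_def by measurable
qed

end

text \<open>Both thresholds are raised by the same \<open>h\<close>, which leaves their difference
  unchanged. The factor \<open>exp (t - t')\<close> appears because the second one-sided moment is
  normalised by its own threshold \<open>t'\<close>.\<close>

lemma (in prob_space) excess_product_moment:
  assumes A: "expo_pair M U V r" and B: "expo_pair M V U r'"
  shows "exp t * expectation (\<lambda>w. max 0 (U w - t) * max 0 (V w - t')) =
    (\<integral>h. expo_pair.K M U V (t + h) (t' + h) + exp (t - t') * expo_pair.K M V U (t' + h) (t + h) \<partial>expo)"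
proof -
  interpret A: expo_pair M U V r by fact
  interpret B: expo_pair M V U r' by fact
  define X where "X = (\<lambda>h w. max 0 (U w - (t + h)) * indicator {t' + h..} (V w))"
  define Y where "Y = (\<lambda>h w. max 0 (V w - (t' + h)) * indicator {t + h..} (U w))"
  have XY [measurable]: "X h \<in> borel_measurable M" "Y h \<in> borel_measurable M" for h
    unfolding X_def Y_def by measurable
  have int: "integrable M (X h)" "integrable M (Y h)" for h
    unfolding X_def Y_def by (rule A.integrable_excess_indicator, rule B.integrable_excess_indicator)
  have nn: "X h w \<ge> 0" "Y h w \<ge> 0" for h w by (auto simp: X_def Y_def)
  have KX: "A.K (t + h) (t' + h) = exp (t + h) * expectation (X h)" for h by (simp add: A.K_def X_def)
  have KY: "B.K (t' + h) (t + h) = exp (t' + h) * expectation (Y h)" for h by (simp add: B.K_def Y_def)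
  have "expectation (\<lambda>w. max 0 (U w - t) * max 0 (V w - t')) = (\<integral>h. exp h * (expectation (X h) + expectation (Y h)) \<partial>expo)"
  proof (rule A.expectation_expo_swap[where f = "\<lambda>w h. exp h * (X h w + Y h w)"])
    have ind: "indicator {c..} x = (if c \<le> x then 1 else 0 :: real)" for c x :: real by simp
    show "(\<lambda>(w, h). exp h * (X h w + Y h w)) \<in> borel_measurable (M \<Otimes>\<^sub>M expo)"
      unfolding X_def Y_def split_beta' ind by measurable
    have "(\<lambda>h. exp (- t) * A.K (t + h) (t' + h) + exp (- t') * B.K (t' + h) (t + h)) \<in> borel_measurable borel"
      using A.K_measurable B.K_measurable by measurable
    moreover have "exp (- t) * A.K (t + h) (t' + h) + exp (- t') * B.K (t' + h) (t + h) = exp h * (expectation (X h) + expectation (Y h))" for h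
      unfolding KX KY by (simp add: mult.assoc[symmetric] exp_add[symmetric] distrib_left)
    ultimately show "(\<lambda>h. exp h * (expectation (X h) + expectation (Y h))) \<in> borel_measurable borel" by simp
    show "0 \<le> exp h * (expectation (X h) + expectation (Y h))" for h using nn by simp
  next
    fix w
    have "(\<integral>\<^sup>+h. ennreal (exp h * (X h w + Y h w)) \<partial>expo) = (\<integral>\<^sup>+h. ennreal (exp h) *
        ennreal (max 0 (U w - t - h) * indicator {..V w - t'} h + max 0 (V w - t' - h) * indicator {..U w - t} h) \<partial>expo)"
      by (intro nn_integral_cong) (auto simp: X_def Y_def ennreal_mult[symmetric] algebra_simps simp del: ennreal_plus split: split_indicator)
    also have "\<dots> = ennreal (max 0 (U w - t) * max 0 (V w - t'))"
      by (subst A.nn_integral_expo_exp) (measurable, rule nn_integral_product_derivative)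
    finally show "(\<integral>\<^sup>+h. ennreal (exp h * (X h w + Y h w)) \<partial>expo) = ennreal (max 0 (U w - t) * max 0 (V w - t'))" .
  next
    fix h :: real
    have "(\<integral>\<^sup>+w. ennreal (exp h * (X h w + Y h w)) \<partial>M) = ennreal (\<integral>w. exp h * (X h w + Y h w) \<partial>M)"
      using int nn by (intro nn_integral_eq_integral) auto
    then show "(\<integral>\<^sup>+w. ennreal (exp h * (X h w + Y h w)) \<partial>M) = ennreal (exp h * (expectation (X h) + expectation (Y h)))"
      using int by simp
  qed auto
  then have "exp t * expectation (\<lambda>w. max 0 (U w - t) * max 0 (V w - t')) =
      (\<integral>h. exp t * (exp h * (expectation (X h) + expectation (Y h))) \<partial>expo)"
    by simp
  also have "\<dots> = (\<integral>h. A.K (t + h) (t' + h) + exp (t - t') * B.K (t' + h) (t + h) \<partial>expo)"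
    unfolding KX KY by (intro Bochner_Integration.integral_cong refl) (simp add: exp_add exp_diff algebra_simps)
  finally show ?thesis .
qed

text \<open>Expanding the product gives the mixed moment, two one-sided moments and the joint tail.
  The limits of the one-sided moments depend on the thresholds only through \<open>\<theta>\<close>,
  hence not on the common shift \<open>h\<close>; the mixture has the limit
  \<open>I + exp (- \<theta>) * J\<close>, their sum, and just the joint tail remains.\<close>

lemma (in prob_space) excess_covariance_tendsto:
  assumes pairA: "expo_pair M U V r" and pairB: "expo_pair M V U r'"
    and t: "filterlim t at_top sequentially" and d: "(\<lambda>n. t' n - t n) \<longlonglongrightarrow> \<theta>"
  shows "(\<lambda>n. exp (t n) * expectation (\<lambda>w. ((U w - t n - 1) * indicator {t n<..} (U w)) * ((V w - t' n - 1) * indicator {t' n<..} (V w))))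
    \<longlonglongrightarrow> r (exp (- \<theta>))"
proof -
  interpret A: expo_pair M U V r by fact
  interpret B: expo_pair M V U r' by fact
  have t': "filterlim t' at_top sequentially"
    using filterlim_tendsto_add_at_top[OF d t] by simp
  have d': "(\<lambda>n. t n - t' n) \<longlonglongrightarrow> - \<theta>" using tendsto_minus[OF d] by simp
  define I where "I = (\<integral>p. r (exp (p - \<theta>)) \<partial>expo)"
  define J where "J = (\<integral>p. r' (exp (p - (- \<theta>))) \<partial>expo)"
  have shift: "filterlim (\<lambda>n. u n + h) at_top sequentially" if "filterlim u at_top sequentially" for u and h :: real
    using filterlim_tendsto_add_at_top[OF tendsto_const that, of h] by (simp add: add.commute)
  have KA: "(\<lambda>n. A.K (t n + h) (t' n + h)) \<longlonglongrightarrow> I" for h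
    unfolding I_def by (rule A.K_tendsto[OF shift[OF t]]) (use d in simp)
  have KB: "(\<lambda>n. exp (t n - t' n) * B.K (t' n + h) (t n + h)) \<longlonglongrightarrow> exp (- \<theta>) * J" for h
    unfolding J_def by (intro tendsto_mult tendsto_exp d' B.K_tendsto[OF shift[OF t']]) (use d' in simp)
  have mom: "(\<lambda>n. exp (t n) * expectation (\<lambda>w. max 0 (U w - t n) * max 0 (V w - t' n))) \<longlonglongrightarrow> I + exp (- \<theta>) * J"
  proof -
    have "\<forall>\<^sub>F n in sequentially. exp (t n - t' n) < exp (- \<theta>) + 1"
      by (rule order_tendstoD(2)[OF tendsto_exp[OF d']]) simp
    then have "\<forall>\<^sub>F n in sequentially. t n \<ge> 0 \<and> t' n \<ge> 0 \<and> exp (t n - t' n) < exp (- \<theta>) + 1"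
      using eventually_compose_filterlim[OF eventually_ge_at_top[of 0] t]
        eventually_compose_filterlim[OF eventually_ge_at_top[of 0] t']
      by eventually_elim simp
    then obtain n0 where n0: "\<And>n. n \<ge> n0 \<Longrightarrow> t n \<ge> 0 \<and> t' n \<ge> 0 \<and> exp (t n - t' n) < exp (- \<theta>) + 1"
      unfolding eventually_sequentially by blast
    let ?k = "\<lambda>n h. A.K (t n + h) (t' n + h) + exp (t n - t' n) * B.K (t' n + h) (t n + h)"
    have "(\<lambda>n. \<integral>h. ?k (n + n0) h \<partial>expo) \<longlonglongrightarrow> (\<integral>h. I + exp (- \<theta>) * J \<partial>expo)"
    proof (rule integral_dominated_convergence[where w = "\<lambda>_. 1 + (exp (- \<theta>) + 1)"])
      show "AE h in expo. (\<lambda>n. ?k (n + n0) h) \<longlonglongrightarrow> I + exp (- \<theta>) * J"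
        by (intro AE_I2 LIMSEQ_ignore_initial_segment[where f = "\<lambda>n. ?k n _"] tendsto_add KA KB)
      show "AE h in expo. norm (?k (n + n0) h) \<le> 1 + (exp (- \<theta>) + 1)" for n
        using AE_expo_nonneg
      proof eventually_elim
        case (elim h)
        let ?n = "n + n0"
        have nn: "t ?n + h \<ge> 0" "t' ?n + h \<ge> 0" "exp (t ?n - t' ?n) \<le> exp (- \<theta>) + 1"
          using n0[of ?n] elim by auto
        have "exp (t ?n - t' ?n) * B.K (t' ?n + h) (t ?n + h) \<le> (exp (- \<theta>) + 1) * 1"
          using nn(3) B.K_bounds[OF nn(2)] by (intro mult_mono) (auto simp: add_nonneg_nonneg)
        moreover have "exp (t ?n - t' ?n) * B.K (t' ?n + h) (t ?n + h) \<ge> 0"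
          using B.K_bounds[OF nn(2)] by simp
        ultimately show ?case using A.K_bounds[OF nn(1), of "t' ?n + h"] by simp
      qed
      show "(\<lambda>h. ?k (n + n0) h) \<in> borel_measurable expo" for n
        using A.K_measurable B.K_measurable by simp
    qed auto
    then have "(\<lambda>n. \<integral>h. ?k (n + n0) h \<partial>expo) \<longlonglongrightarrow> I + exp (- \<theta>) * J"
      by (simp add: expo.prob_space[simplified])
    from LIMSEQ_offset[OF this] show ?thesis
      by (simp add: excess_product_moment[OF pairA pairB])
  qed
  have "(\<lambda>n. exp (t n) * expectation (\<lambda>w. max 0 (U w - t n) * max 0 (V w - t' n))
        - A.K (t n) (t' n) - exp (t n - t' n) * B.K (t' n) (t n) + A.Q (t n) (t' n))
      \<longlonglongrightarrow> (I + exp (- \<theta>) * J) - I - exp (- \<theta>) * J + r (exp (- \<theta>))"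
    using KA[of 0] KB[of 0] by (intro tendsto_add tendsto_diff mom A.Q_tendsto[OF t d]) auto
  moreover have "exp (t n) * expectation (\<lambda>w. ((U w - t n - 1) * indicator {t n<..} (U w)) * ((V w - t' n - 1) * indicator {t' n<..} (V w))) =
      exp (t n) * expectation (\<lambda>w. max 0 (U w - t n) * max 0 (V w - t' n))
        - A.K (t n) (t' n) - exp (t n - t' n) * B.K (t' n) (t n) + A.Q (t n) (t' n)" for n
  proof -
    \<comment> \<open>Strict and weak exceedances agree almost surely, which reconciles the
      indicators here with those in \<open>K\<close> and \<open>Q\<close>.\<close>
    have ne: "AE w in M. U w \<noteq> t n" "AE w in M. V w \<noteq> t' n"
    proof -
      have ae: "AE x in expo. x \<noteq> c" for c
        unfolding expo_def by (subst AE_density) (use AE_lborel_singleton[of c] in \<open>auto elim: eventually_mono\<close>)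
      show "AE w in M. U w \<noteq> t n"
        using ae[of "t n"] unfolding A.distr_U[symmetric] by (subst (asm) AE_distr_iff) auto
      show "AE w in M. V w \<noteq> t' n"
        using ae[of "t' n"] unfolding A.distr_V[symmetric] by (subst (asm) AE_distr_iff) auto
    qed
    let ?S = "{w \<in> space M. t n \<le> U w \<and> t' n \<le> V w}"
    have int: "integrable M (\<lambda>w. max 0 (U w - t n) * max 0 (V w - t' n))"
      by (intro integrable_mult_square A.integrable_excess_square) measurable
    have "expectation (\<lambda>w. ((U w - t n - 1) * indicator {t n<..} (U w)) * ((V w - t' n - 1) * indicator {t' n<..} (V w))) =
      expectation (\<lambda>w. max 0 (U w - t n) * max 0 (V w - t' n) - max 0 (U w - t n) * indicator {t' n..} (V w)
         - max 0 (V w - t' n) * indicator {t n..} (U w) + indicator ?S w)"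
    proof (rule integral_cong_AE)
      show "AE w in M. ((U w - t n - 1) * indicator {t n<..} (U w)) * ((V w - t' n - 1) * indicator {t' n<..} (V w)) =
        max 0 (U w - t n) * max 0 (V w - t' n) - max 0 (U w - t n) * indicator {t' n..} (V w)
         - max 0 (V w - t' n) * indicator {t n..} (U w) + indicator ?S w"
        using ne AE_space by eventually_elim (auto simp: max_def algebra_simps split: split_indicator)
    qed measurable
    also have "\<dots> = expectation (\<lambda>w. max 0 (U w - t n) * max 0 (V w - t' n)) - expectation (\<lambda>w. max 0 (U w - t n) * indicator {t' n..} (V w))
         - expectation (\<lambda>w. max 0 (V w - t' n) * indicator {t n..} (U w)) + prob ?S"
      using int A.integrable_excess_indicator B.integrable_excess_indicator
      by (simp add: emeasure_eq_measure)
    finally have eq: "expectation (\<lambda>w. ((U w - t n - 1) * indicator {t n<..} (U w)) * ((V w - t' n - 1) * indicator {t' n<..} (V w))) = \<dots>" .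
    show ?thesis
      unfolding eq A.K_def B.K_def A.Q_def by (simp add: exp_diff algebra_simps)
  qed
  ultimately show ?thesis by simp
qed

section \<open>Pooling the Hill estimators\<close>

lemma measurable_component [measurable]:
  fixes f :: "'a \<Rightarrow> real ^ 'n"
  assumes "f \<in> borel_measurable M"
  shows "(\<lambda>w. f w $ j) \<in> borel_measurable M"
  by (rule measurable_compose[OF assms]) (intro borel_measurable_continuous_onI continuous_intros)

locale hill_samples = prob_space M for M :: "'a measure" +
  fixes X :: "'a \<Rightarrow> real ^ ('m::{finite,linorder})"
    and Xs :: "nat \<Rightarrow> 'a \<Rightarrow> real ^ ('m::{finite,linorder})"
    and \<gamma> \<rho> lam b c :: "real ^ ('m::{finite,linorder})"
    and A :: "'m \<Rightarrow> real \<Rightarrow> real"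
    and R :: "'m \<Rightarrow> 'm \<Rightarrow> ennreal \<Rightarrow> ennreal \<Rightarrow> real"
    and N k :: "nat \<Rightarrow> 'm \<Rightarrow> nat"
  assumes X_measurable [measurable]: "X \<in> borel_measurable M"
    and indep_Xs: "indep_vars (\<lambda>_. borel) Xs {1..}"
    and distr_Xs: "\<And>i. i \<ge> 1 \<Longrightarrow> distr M borel (Xs i) = distr M borel X"
    and cont_margin: "\<And>j. continuous_on UNIV (cdf (margin M X j))"
    and second_order: "\<And>j. second_order_cond (margin M X j) (\<gamma> $ j) (\<rho> $ j) (A j)"
    and tail_dep: "tail_dependence_cond M X R"
    and sum_N: "\<And>n. (\<Sum>j\<in>UNIV. N n j) = n"
    and lim_N: "\<And>j. filterlim (\<lambda>n. N n j) at_top sequentially"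
    and mono_N: "\<And>n. mono (N n)"
    and pos_k: "\<And>n j. k n j \<ge> 1"
    and lim_k: "\<And>j. filterlim (\<lambda>n. k n j) at_top sequentially"
    and lim_kN: "\<And>j. (\<lambda>n. real (k n j) / real (N n j)) \<longlonglongrightarrow> 0"
    and lim_b: "\<And>j. (\<lambda>n. real (N n (Min UNIV)) / real (N n j)) \<longlonglongrightarrow> b $ j"
    and pos_b: "\<And>j. 0 < b $ j"
    and lim_c: "\<And>j. (\<lambda>n. real (k n (Min UNIV)) / real (k n j)) \<longlonglongrightarrow> c $ j"
    and pos_c: "\<And>j. 0 < c $ j"
    and lim_lam: "\<And>j. (\<lambda>n. sqrt (real (k n j)) * A j (real (N n j) / real (k n j))) \<longlonglongrightarrow> lam $ j"
begin

definition E where "E j x = - ln (1 - cdf (margin M X j) (x $ j))"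

lemma real_distribution_margin: "real_distribution (margin M X j)"
  unfolding margin_def by (rule real_distribution_distr) measurable

sublocale margin: real_distribution "margin M X j" for j
  by (rule real_distribution_margin)

lemma E_measurable [measurable]: "E j \<in> borel_measurable borel"
  unfolding E_def by measurable

lemma Xs_measurable [measurable]: "i \<ge> 1 \<Longrightarrow> Xs i \<in> borel_measurable M"
  using indep_Xs unfolding indep_vars_def2 by auto

lemma distr_E_X: "distr M borel (\<lambda>w. E j (X w)) = expo"
proof -
  have "distr M borel (\<lambda>w. E j (X w)) =
      distr (distr M borel (\<lambda>w. X w $ j)) borel (\<lambda>x. - ln (1 - cdf (margin M X j) x))"
    by (subst distr_distr) (auto simp: comp_def E_def)
  also have "\<dots> = distr (margin M X j) borel (\<lambda>x. - ln (1 - cdf (margin M X j) x))"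
    by (simp only: margin_def)
  also have "\<dots> = expo"
    unfolding expo_def by (rule margin.distr_neg_ln_survival[OF cont_margin])
  finally show ?thesis .
qed

lemma
  assumes [measurable]: "f \<in> borel_measurable borel" and i: "i \<ge> 1"
  shows expectation_Xs: "expectation (\<lambda>w. f (Xs i w) :: real) = expectation (\<lambda>w. f (X w))"
    and integrable_Xs: "integrable M (\<lambda>w. f (Xs i w) :: real) \<longleftrightarrow> integrable M (\<lambda>w. f (X w))"
proof -
  have "expectation (\<lambda>w. f (Xs i w)) = (\<integral>x. f x \<partial>distr M borel (Xs i))"
    using i by (subst integral_distr) auto
  also have "\<dots> = expectation (\<lambda>w. f (X w))"
    unfolding distr_Xs[OF i] by (subst integral_distr) auto
  finally show "expectation (\<lambda>w. f (Xs i w)) = expectation (\<lambda>w. f (X w))" .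
  have "integrable M (\<lambda>w. f (Xs i w)) \<longleftrightarrow> integrable (distr M borel (Xs i)) f"
    using i by (subst integrable_distr_eq) auto
  also have "\<dots> \<longleftrightarrow> integrable M (\<lambda>w. f (X w))"
    unfolding distr_Xs[OF i] by (subst integrable_distr_eq) auto
  finally show "integrable M (\<lambda>w. f (Xs i w)) \<longleftrightarrow> integrable M (\<lambda>w. f (X w))" .
qed

lemma distr_E_Xs: "i \<ge> 1 \<Longrightarrow> distr M borel (\<lambda>w. E j (Xs i w)) = expo"
  using distr_distr[of "E j" borel borel "Xs i" M] distr_distr[of "E j" borel borel X M] distr_Xs[of i] distr_E_X[of j]
  by (simp add: comp_def)

sublocale S: expo_sample M "\<lambda>i w. E j (Xs i w)" "\<lambda>n. N n j" "\<lambda>n. k n j" for j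
proof
  show "indep_vars (\<lambda>_. borel) (\<lambda>i w. E j (Xs i w)) {1..}"
    by (rule indep_vars_compose2[OF indep_Xs]) measurable
qed (use distr_E_Xs lim_N pos_k lim_k lim_kN in auto)

lemma AE_X:
  assumes "i \<ge> 1"
  shows "AE w in M. 0 < cdf (margin M X j) (Xs i w $ j) \<and> cdf (margin M X j) (Xs i w $ j) < 1
    \<and> Xs i w $ j = tail_quantile (margin M X j) (exp (E j (Xs i w)))"
proof -
  have eq: "distr M borel (\<lambda>w. Xs i w $ j) = margin M X j"
    using distr_distr[of "\<lambda>x. x $ j" borel borel "Xs i" M] distr_distr[of "\<lambda>x. x $ j" borel borel X M] distr_Xs[of i] assms
    by (simp add: comp_def margin_def)
  have "AE x in distr M borel (\<lambda>w. Xs i w $ j). 0 < cdf (margin M X j) x \<and> cdf (margin M X j) x < 1 \<and>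
      tail_quantile (margin M X j) (exp (- ln (1 - cdf (margin M X j) x))) = x"
    by (subst eq) (rule margin.AE_tail_quantile_cdf[OF cont_margin])
  from AE_distrD[OF _ this] assms show ?thesis by (simp add: E_def eq_commute)
qed

end

section \<open>Limiting covariances between margins\<close>

context hill_samples
begin

lemma AE_cdf_X: "AE w in M. 0 < cdf (margin M X j) (X w $ j) \<and> cdf (margin M X j) (X w $ j) < 1"
proof -
  have "AE x in distr M borel (\<lambda>w. X w $ j). 0 < cdf (margin M X j) x \<and> cdf (margin M X j) x < 1 \<and>
      tail_quantile (margin M X j) (exp (- ln (1 - cdf (margin M X j) x))) = x"
    using margin.AE_tail_quantile_cdf[OF cont_margin, of j] unfolding margin_def[of M X j, symmetric] .
  from AE_distrD[OF _ this] show ?thesis by simp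
qed

text \<open>The two events are equal only almost surely: where the distribution function is one, the
  value of \<open>ln\<close> at zero is a mere default and the equivalence breaks down, but these
  points are null.\<close>

lemma survival_copula_eq:
  assumes s: "s > 0" and xy: "x > 0" "y > 0"
  shows "survival_copula M X p q (ennreal x / ennreal s) (ennreal y / ennreal s) =
    prob {w \<in> space M. ln (s / x) \<le> E p (X w) \<and> ln (s / y) \<le> E q (X w)}"
  unfolding survival_copula_def
proof (rule measure_eq_AE)
  have iff: "ennreal (1 - F) \<le> ennreal z / ennreal s \<longleftrightarrow> ln (s / z) \<le> - ln (1 - F)" if "F < 1" "z > 0" for F z
  proof -
    have "ennreal (1 - F) \<le> ennreal z / ennreal s \<longleftrightarrow> 1 - F \<le> z / s"
      using that s by (simp add: divide_ennreal)
    also have "\<dots> \<longleftrightarrow> ln (1 - F) \<le> ln (z / s)"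
      using that s by (subst ln_le_cancel_iff) auto
    also have "ln (z / s) = - ln (s / z)" using that s by (simp add: ln_div)
    finally show ?thesis by auto
  qed
  show "AE w in M. w \<in> {w \<in> space M. ennreal (1 - cdf (margin M X p) (X w $ p)) \<le> ennreal x / ennreal s \<and>
        ennreal (1 - cdf (margin M X q) (X w $ q)) \<le> ennreal y / ennreal s} \<longleftrightarrow>
      w \<in> {w \<in> space M. ln (s / x) \<le> E p (X w) \<and> ln (s / y) \<le> E q (X w)}"
    using AE_cdf_X[of p] AE_cdf_X[of q]
    by eventually_elim (use iff xy in \<open>auto simp: E_def\<close>)
  have [measurable]: "cdf (margin M X j) \<in> borel_measurable borel" for j by (rule margin.cdf_measurable)
  show "{w \<in> space M. ennreal (1 - cdf (margin M X p) (X w $ p)) \<le> ennreal x / ennreal s \<and>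
        ennreal (1 - cdf (margin M X q) (X w $ q)) \<le> ennreal y / ennreal s} \<in> events"
    by measurable
qed measurable

lemma expo_pair_X:
  assumes "p \<noteq> q"
  shows "expo_pair M (\<lambda>w. E p (X w)) (\<lambda>w. E q (X w)) (\<lambda>x. R p q 1 (ennreal x))"
proof
  fix x :: real assume x: "x > 0"
  have "((\<lambda>s. s * survival_copula M X p q (1 / ennreal s) (ennreal x / ennreal s)) \<longlongrightarrow> R p q 1 (ennreal x)) at_top"
    using tail_dep assms unfolding tail_dependence_cond_def by auto
  then show "((\<lambda>s. s * prob {w \<in> space M. ln s \<le> E p (X w) \<and> ln (s / x) \<le> E q (X w)}) \<longlongrightarrow> R p q 1 (ennreal x)) at_top"
  proof (rule Lim_transform_eventually)
    show "\<forall>\<^sub>F s in at_top. s * survival_copula M X p q (1 / ennreal s) (ennreal x / ennreal s) =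
        s * prob {w \<in> space M. ln s \<le> E p (X w) \<and> ln (s / x) \<le> E q (X w)}"
      using eventually_gt_at_top[of 0]
    proof eventually_elim
      case (elim s)
      from survival_copula_eq[OF elim zero_less_one x, of p q] show ?case by simp
    qed
  qed
qed (use distr_E_X in auto)

text \<open>Substitute \<open>s / a\<close> for \<open>s\<close> in the defining limit. The
  covariance limit will appear as \<open>R p q 1 (ennreal \<kappa>)\<close> and is moved to the
  arguments used in the matrix in this way.\<close>

lemma R_homogeneous:
  assumes "p \<noteq> q" and pos: "a > 0" "x > 0" "y > 0"
  shows "R p q (ennreal (a * x)) (ennreal (a * y)) = a * R p q (ennreal x) (ennreal y)"
proof (rule tendsto_unique[OF trivial_limit_at_top_linorder])
  show "((\<lambda>s. s * survival_copula M X p q (ennreal (a * x) / ennreal s) (ennreal (a * y) / ennreal s))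
      \<longlongrightarrow> R p q (ennreal (a * x)) (ennreal (a * y))) at_top"
    using tail_dep assms unfolding tail_dependence_cond_def by auto
  have "filterlim (\<lambda>s. (1 / a) * s) at_top at_top"
    by (rule filterlim_tendsto_pos_mult_at_top[OF tendsto_const _ filterlim_ident]) (use pos in simp)
  moreover have "((\<lambda>s. s * survival_copula M X p q (ennreal x / ennreal s) (ennreal y / ennreal s))
      \<longlongrightarrow> R p q (ennreal x) (ennreal y)) at_top"
    using tail_dep assms unfolding tail_dependence_cond_def by auto
  ultimately have "((\<lambda>s. ((1 / a) * s) * survival_copula M X p q (ennreal x / ennreal ((1 / a) * s)) (ennreal y / ennreal ((1 / a) * s)))
      \<longlongrightarrow> R p q (ennreal x) (ennreal y)) at_top"
    by (rule filterlim_compose[rotated])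
  from tendsto_mult[OF tendsto_const[of a] this]
  show "((\<lambda>s. s * survival_copula M X p q (ennreal (a * x) / ennreal s) (ennreal (a * y) / ennreal s))
      \<longlongrightarrow> a * R p q (ennreal x) (ennreal y)) at_top"
  proof (rule Lim_transform_eventually)
    show "\<forall>\<^sub>F s in at_top. a * (((1 / a) * s) * survival_copula M X p q (ennreal x / ennreal ((1 / a) * s)) (ennreal y / ennreal ((1 / a) * s)))
      = s * survival_copula M X p q (ennreal (a * x) / ennreal s) (ennreal (a * y) / ennreal s)"
      using eventually_gt_at_top[of 0]
    proof eventually_elim
      case (elim s)
      have "ennreal z / ennreal ((1 / a) * s) = ennreal (a * z) / ennreal s" if "z > 0" for z
        using that pos elim by (simp add: divide_ennreal mult.commute)
      then show ?case using pos by simp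
    qed
  qed
qed

definition \<xi> where "\<xi> j n x = (E j x - S.T j n - 1) * indicator {S.T j n<..} (E j x)"

lemma \<xi>_measurable [measurable]: "\<xi> j n \<in> borel_measurable borel"
  unfolding \<xi>_def by measurable

lemma
  assumes T: "S.T j n \<ge> 0" and m: "m > 0"
  shows integrable_\<xi>_power: "integrable M (\<lambda>w. (\<xi> j n (X w)) ^ m)"
    and expectation_\<xi>_power: "expectation (\<lambda>w. (\<xi> j n (X w)) ^ m) = exp (- S.T j n) * (\<integral>x. (x - 1) ^ m \<partial>expo)"
proof -
  let ?f = "\<lambda>x. (x - S.T j n - 1) ^ m * indicator {S.T j n<..} x"
  have eq: "(\<xi> j n (X w)) ^ m = ?f (E j (X w))" for w
    using m by (auto simp: \<xi>_def power_mult_distrib indicator_def)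
  have [measurable]: "(\<lambda>w. E j (X w)) \<in> borel_measurable M" by measurable
  have "integrable expo ?f"
    using integrable_expo_shift[of "\<lambda>x. (x - 1) ^ m", OF _ T integrable_expo_centred_power] by simp
  then have "integrable (distr M borel (\<lambda>w. E j (X w))) ?f" by (simp add: distr_E_X)
  then show "integrable M (\<lambda>w. (\<xi> j n (X w)) ^ m)"
    unfolding eq by (subst (asm) integrable_distr_eq) auto
  have "expectation (\<lambda>w. ?f (E j (X w))) = (\<integral>x. ?f x \<partial>distr M borel (\<lambda>w. E j (X w)))"
    by (subst integral_distr) auto
  also have "\<dots> = exp (- S.T j n) * (\<integral>x. (x - 1) ^ m \<partial>expo)"
    unfolding distr_E_X using integral_expo_shift[of "\<lambda>x. (x - 1) ^ m", OF _ T] by simp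
  finally show "expectation (\<lambda>w. (\<xi> j n (X w)) ^ m) = exp (- S.T j n) * (\<integral>x. (x - 1) ^ m \<partial>expo)"
    unfolding eq .
qed

lemma ratio_k: "(\<lambda>n. real (k n p) / real (k n q)) \<longlonglongrightarrow> c $ q / c $ p"
proof -
  have "(\<lambda>n. (real (k n (Min UNIV)) / real (k n q)) / (real (k n (Min UNIV)) / real (k n p))) \<longlonglongrightarrow> c $ q / c $ p"
    using pos_c[of p] by (intro tendsto_divide lim_c) auto
  moreover have "(real (k n (Min UNIV)) / real (k n q)) / (real (k n (Min UNIV)) / real (k n p)) = real (k n p) / real (k n q)" for n
    using pos_k[of n "Min UNIV"] pos_k[of n p] by simp
  ultimately show ?thesis by simp
qed

lemma ratio_N: "(\<lambda>n. real (N n q) / real (N n p)) \<longlonglongrightarrow> b $ p / b $ q"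
proof -
  have "(\<lambda>n. (real (N n (Min UNIV)) / real (N n p)) / (real (N n (Min UNIV)) / real (N n q))) \<longlonglongrightarrow> b $ p / b $ q"
    using pos_b[of q] by (intro tendsto_divide lim_b) auto
  then show ?thesis
  proof (rule Lim_transform_eventually)
    show "\<forall>\<^sub>F n in sequentially. (real (N n (Min UNIV)) / real (N n p)) / (real (N n (Min UNIV)) / real (N n q)) = real (N n q) / real (N n p)"
      using S.N_pos[of "Min UNIV"] S.N_pos[of p] by eventually_elim simp
  qed
qed

lemma threshold_difference:
  "(\<lambda>n. S.T q n - S.T p n) \<longlonglongrightarrow> ln (b $ p / b $ q * (c $ q / c $ p))"
proof -
  have "(\<lambda>n. ln (real (N n q) / real (N n p) * (real (k n p) / real (k n q)))) \<longlonglongrightarrow> ln (b $ p / b $ q * (c $ q / c $ p))"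
    using pos_b[of p] pos_b[of q] pos_c[of p] pos_c[of q] by (intro tendsto_ln tendsto_mult ratio_N ratio_k) auto
  then show ?thesis
  proof (rule Lim_transform_eventually)
    show "\<forall>\<^sub>F n in sequentially. ln (real (N n q) / real (N n p) * (real (k n p) / real (k n q))) = S.T q n - S.T p n"
      using S.N_pos[of p] S.N_pos[of q]
    proof eventually_elim
      case (elim n)
      then show ?case using pos_k[of n p] pos_k[of n q] by (simp add: S.T_def ln_div ln_mult)
    qed
  qed
qed

definition V where "V = cov_mat \<gamma> b c R"

text \<open>For large \<open>n\<close>, the covariance of the leading terms of margins
  \<open>j\<close> and \<open>l\<close>: the first \<open>min (N n j) (N n l)\<close> observations
  are common to both samples, and pairs with different indices are independent.\<close>

definition cv where
  "cv n j l = \<gamma> $ j * \<gamma> $ l / (sqrt (real (k n j)) * sqrt (real (k n l))) *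
     real (min (N n j) (N n l)) * expectation (\<lambda>w. \<xi> j n (X w) * \<xi> l n (X w))"

lemma cv_commute: "cv n j l = cv n l j"
  by (simp add: cv_def min.commute mult.commute)

lemma V_commute: "V $ j $ l = V $ l $ j"
  by (simp add: V_def cov_mat_def min.commute max.commute)

lemma transpose_V: "transpose V = V"
  by (simp add: transpose_def vec_eq_iff V_commute)

text \<open>Sample sizes increase with the index, so for \<open>p < q\<close> the common part is the
  sample of margin \<open>p\<close>. Its size is \<open>k n p\<close> times the exponential of its
  threshold, which is the normalisation under which the covariance of centred excesses
  converges.\<close>

lemma cv_tendsto: "(\<lambda>n. cv n j l) \<longlonglongrightarrow> V $ j $ l"
proof -
  have diag: "(\<lambda>n. cv n j j) \<longlonglongrightarrow> V $ j $ j" for j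
  proof (rule tendsto_eventually)
    show "\<forall>\<^sub>F n in sequentially. cv n j j = V $ j $ j"
      using S.N_exp_T[of j] S.T_pos[of j]
    proof eventually_elim
      case (elim n)
      have "expectation (\<lambda>w. \<xi> j n (X w) * \<xi> j n (X w)) = exp (- S.T j n)"
        using expectation_\<xi>_power[of j n 2] elim by (simp add: power2_eq_square[symmetric] integral_expo_centred_square)
      then have "cv n j j = \<gamma> $ j * \<gamma> $ j / real (k n j) * (real (N n j) * exp (- S.T j n))"
        by (simp add: cv_def)
      also have "\<dots> = (\<gamma> $ j)\<^sup>2" unfolding elim(1) using pos_k[of n j] by (simp add: power2_eq_square)
      finally show ?case by (simp add: V_def cov_mat_def)
    qed
  qed
  have upper: "(\<lambda>n. cv n p q) \<longlonglongrightarrow> V $ p $ q" if pq: "p < q" for p q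
  proof -
    have ne: "p \<noteq> q" "q \<noteq> p" using pq by auto
    define \<theta> where "\<theta> = ln (b $ p / b $ q * (c $ q / c $ p))"
    define \<kappa> where "\<kappa> = b $ q / b $ p * (c $ p / c $ q)"
    have exp_\<theta>: "exp (- \<theta>) = \<kappa>"
      using pos_b[of p] pos_b[of q] pos_c[of p] pos_c[of q] by (simp add: \<theta>_def \<kappa>_def exp_minus field_simps)
    have \<kappa>: "\<kappa> > 0" using pos_b[of p] pos_b[of q] pos_c[of p] pos_c[of q] by (simp add: \<kappa>_def)
    have "(\<lambda>n. exp (S.T p n) * expectation (\<lambda>w. \<xi> p n (X w) * \<xi> q n (X w))) \<longlonglongrightarrow> R p q 1 (ennreal \<kappa>)"
      using excess_covariance_tendsto[OF expo_pair_X[OF ne(1)] expo_pair_X[OF ne(2)] S.T_lim[of p]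
          threshold_difference[of q p, folded \<theta>_def]]
      unfolding exp_\<theta> by (simp add: \<xi>_def)
    then have "(\<lambda>n. \<gamma> $ p * \<gamma> $ q * sqrt (real (k n p) / real (k n q)) * (exp (S.T p n) * expectation (\<lambda>w. \<xi> p n (X w) * \<xi> q n (X w))))
      \<longlonglongrightarrow> \<gamma> $ p * \<gamma> $ q * sqrt (c $ q / c $ p) * R p q 1 (ennreal \<kappa>)"
      by (intro tendsto_mult tendsto_const tendsto_real_sqrt ratio_k)
    moreover have "\<forall>\<^sub>F n in sequentially. \<gamma> $ p * \<gamma> $ q * sqrt (real (k n p) / real (k n q)) * (exp (S.T p n) * expectation (\<lambda>w. \<xi> p n (X w) * \<xi> q n (X w))) = cv n p q"
      using S.N_pos[of p]
    proof eventually_elim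
      case (elim n)
      have "N n p \<le> N n q" using mono_N[of n] pq by (auto dest: monoD less_imp_le)
      then have min: "min (N n p) (N n q) = N n p" by simp
      have kp: "sqrt (real (k n p)) * sqrt (real (k n p)) = real (k n p)" "sqrt (real (k n p)) > 0" "sqrt (real (k n q)) > 0"
        using pos_k[of n p] pos_k[of n q] by auto
      have "exp (S.T p n) = real (N n p) / real (k n p)" using elim pos_k[of n p] by (simp add: S.T_def)
      also have "\<dots> = real (N n p) / (sqrt (real (k n p)) * sqrt (real (k n p)))" by simp
      finally have eT: "exp (S.T p n) = real (N n p) / (sqrt (real (k n p)) * sqrt (real (k n p)))" .
      show ?case unfolding cv_def min eT real_sqrt_divide using kp(2,3) by (simp add: field_simps)
    qed
    ultimately have "(\<lambda>n. cv n p q) \<longlonglongrightarrow> \<gamma> $ p * \<gamma> $ q * sqrt (c $ q / c $ p) * R p q 1 (ennreal \<kappa>)"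
      by (rule Lim_transform_eventually)
    also have "\<gamma> $ p * \<gamma> $ q * sqrt (c $ q / c $ p) * R p q 1 (ennreal \<kappa>) = V $ p $ q"
    proof -
      \<comment> \<open>Homogeneity with factor \<open>u\<close> turns the arguments
        \<open>1\<close> and \<open>\<kappa>\<close> into those of the matrix, and
        \<open>sqrt (c $ p / c $ q) * u = sqrt u\<close> matches the prefactors.\<close>
      define u where "u = c $ q / c $ p"
      have u: "u > 0" using pos_c[of p] pos_c[of q] by (simp add: u_def)
      have u\<kappa>: "u * \<kappa> = b $ q / b $ p" using pos_c[of p] pos_c[of q] by (simp add: u_def \<kappa>_def)
      have "R p q (ennreal u) (ennreal (b $ q / b $ p)) = u * R p q 1 (ennreal \<kappa>)"
        using R_homogeneous[OF ne(1) u zero_less_one \<kappa>] by (simp add: u\<kappa>)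
      moreover have "sqrt (c $ p / c $ q) = inverse (sqrt u)"
        by (simp add: u_def real_sqrt_divide)
      moreover have "inverse (sqrt u) * u = sqrt u"
        using u by (simp add: field_simps)
      ultimately have "sqrt (c $ p / c $ q) * R p q (ennreal u) (ennreal (b $ q / b $ p)) = sqrt u * R p q 1 (ennreal \<kappa>)"
        by (metis mult.assoc)
      then show ?thesis
        using ne min.absorb3[OF pq] max.absorb4[OF pq]
        by (simp add: V_def cov_mat_def u_def[symmetric] Let_def mult.assoc)
    qed
    finally show ?thesis .
  qed
  consider "j = l" | "j < l" | "l < j" by (rule linorder_cases)
  then show ?thesis
  proof cases
    case 1
    then show ?thesis using diag by simp
  next
    case 2
    then show ?thesis by (rule upper)
  next
    case 3
    show ?thesis unfolding cv_commute[of _ j l] V_commute[of j l] by (rule upper[OF 3])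
  qed
qed

end

section \<open>Asymptotic normality of linear combinations\<close>

lemma sum_power4_le:
  fixes x :: "'i \<Rightarrow> real"
  assumes "finite J"
  shows "(\<Sum>j\<in>J. x j) ^ 4 \<le> real (card J) ^ 3 * (\<Sum>j\<in>J. x j ^ 4)"
proof -
  have "(\<Sum>j\<in>J. x j) ^ 4 = ((\<Sum>j\<in>J. x j)\<^sup>2)\<^sup>2" by simp
  also have "\<dots> \<le> ((\<Sum>j\<in>J. (x j)\<^sup>2) * real (card J))\<^sup>2"
    by (intro power_mono sum_squared_le_sum_of_squares) auto
  also have "\<dots> = (\<Sum>j\<in>J. (x j)\<^sup>2)\<^sup>2 * (real (card J))\<^sup>2" by (simp add: power_mult_distrib)
  also have "\<dots> \<le> ((\<Sum>j\<in>J. ((x j)\<^sup>2)\<^sup>2) * real (card J)) * (real (card J))\<^sup>2"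
    by (intro mult_right_mono sum_squared_le_sum_of_squares) auto
  also have "\<dots> = real (card J) ^ 3 * (\<Sum>j\<in>J. x j ^ 4)"
    by (simp add: power3_eq_cube power2_eq_square[of "real (card J)"] mult_ac flip: power_mult)
  finally show ?thesis .
qed

lemma char_add_const:
  assumes "prob_space M" and [measurable]: "Y \<in> borel_measurable M"
  shows "char (distr M borel (\<lambda>w. c + Y w)) t = iexp (t * c) * char (distr M borel Y) t"
proof -
  have "char (distr M borel (\<lambda>w. c + Y w)) t = (\<integral>w. iexp (t * c) * iexp (t * Y w) \<partial>M)"
    unfolding char_def by (subst integral_distr) (auto simp: exp_add[symmetric] algebra_simps)
  also have "\<dots> = iexp (t * c) * char (distr M borel Y) t"
    unfolding char_def by (subst integral_distr) auto
  finally show ?thesis .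
qed

context hill_samples
begin

lemma
  fixes f :: "'a \<Rightarrow> real"
  shows integral_if: "expectation (\<lambda>w. if P then f w else 0) = (if P then expectation f else 0)"
    and integrable_if: "integrable M f \<Longrightarrow> integrable M (\<lambda>w. if P then f w else 0)"
  by (cases P; simp)+

text \<open>Grouping by observation instead of by margin makes the summands independent.\<close>

lemma clt:
  fixes \<alpha> :: "nat \<Rightarrow> 'm \<Rightarrow> real"
  assumes \<alpha>: "\<And>j. (\<lambda>n. \<alpha> n j) \<longlonglongrightarrow> a j"
  defines "v \<equiv> (\<Sum>j\<in>UNIV. \<Sum>l\<in>UNIV. a j * a l * V $ j $ l)"
  shows "v \<ge> 0"
    and "(\<lambda>n. char (distr M borel (\<lambda>w. \<Sum>j\<in>UNIV. \<alpha> n j * (\<gamma> $ j * S.pareto_sum j n w))) t)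
      \<longlonglongrightarrow> of_real (exp (- (v * t\<^sup>2 / 2)))"
proof -
  have "\<forall>\<^sub>F n in sequentially. \<forall>j. S.T j n > 0"
    by (intro eventually_all_finite S.T_pos)
  then obtain n0 where n0: "\<And>n j. n \<ge> n0 \<Longrightarrow> S.T j n \<ge> 0"
    unfolding eventually_sequentially by (meson less_imp_le)
  define d where "d n j = \<alpha> n j * \<gamma> $ j / sqrt (real (k n j))" for n j
  \<comment> \<open>Observation \<open>i\<close> contributes to margin \<open>j\<close> only if it
    belongs to that sample, so a row consists of \<open>n\<close> independent terms of varying
    composition.\<close>
  define g where "g n i x = (\<Sum>j\<in>UNIV. d n j * (if i \<le> N n j then \<xi> j n x else 0))" for n i x
  have [measurable]: "g n i \<in> borel_measurable borel" for n i unfolding g_def by measurable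
  \<comment> \<open>Sample sizes add up to \<open>n\<close>, so the index range from
    \<open>1\<close> to \<open>n\<close> contains every sample.\<close>
  have N_le: "N n j \<le> n" for n j
    using member_le_sum[of j UNIV "N n"] sum_N[of n] by simp
  have sum_if: "(\<Sum>i=1..n. if i \<le> m then f i else 0) = (\<Sum>i=1..m. f i)" if "m \<le> n" for m n and f :: "nat \<Rightarrow> real"
    using that by (intro sum.mono_neutral_cong_right) auto
  have g_sum: "(\<Sum>i=1..n. g n i (Xs i w)) = (\<Sum>j\<in>UNIV. \<alpha> n j * (\<gamma> $ j * S.pareto_sum j n w))" for n w
  proof -
    have "(\<Sum>i=1..n. g n i (Xs i w)) = (\<Sum>j\<in>UNIV. \<Sum>i=1..n. d n j * (if i \<le> N n j then \<xi> j n (Xs i w) else 0))"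
      unfolding g_def by (rule sum.swap)
    also have "\<dots> = (\<Sum>j\<in>UNIV. d n j * (\<Sum>i=1..N n j. \<xi> j n (Xs i w)))"
      by (simp only: sum_distrib_left[symmetric] sum_if[OF N_le])
    also have "\<dots> = (\<Sum>j\<in>UNIV. \<alpha> n j * (\<gamma> $ j * S.pareto_sum j n w))"
      by (simp only: d_def S.pareto_sum_def \<xi>_def times_divide_eq_left times_divide_eq_right mult.assoc)
    finally show ?thesis .
  qed
  note int\<xi> = integrable_\<xi>_power[OF n0] and E\<xi> = expectation_\<xi>_power[OF n0]
  have int2: "integrable M (\<lambda>w. \<xi> j n (X w) * \<xi> l n (X w))" if "n \<ge> n0" for j l n
    by (rule integrable_mult_square) (use int\<xi>[OF that, of 2] in auto)
  have mean: "expectation (\<lambda>w. g n i (Xs i w)) = 0" if "n \<ge> n0" "i \<ge> 1" for n i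
  proof -
    have "integrable M (\<lambda>w. \<xi> j n (X w))" for j using int\<xi>[OF that(1), of 1 j] by simp
    moreover have "expectation (\<lambda>w. \<xi> j n (X w)) = 0" for j
      using E\<xi>[OF that(1), of 1 j] by (simp add: integral_expo_centred)
    ultimately have "integrable M (\<lambda>w. d n j * (if i \<le> N n j then \<xi> j n (X w) else 0)) \<and>
        expectation (\<lambda>w. d n j * (if i \<le> N n j then \<xi> j n (X w) else 0)) = 0" for j
      by (cases "i \<le> N n j") auto
    then have "expectation (\<lambda>w. g n i (X w)) = 0"
      unfolding g_def by (subst Bochner_Integration.integral_sum) (auto simp del: integral_mult_right_zero integrable_mult_right_iff intro!: sum.neutral)
    then show ?thesis using that by (subst expectation_Xs) auto
  qed
  have sq: "expectation (\<lambda>w. (g n i (Xs i w))\<^sup>2) = (\<Sum>j\<in>UNIV. \<Sum>l\<in>UNIV. d n j * d n l *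
      (if i \<le> min (N n j) (N n l) then expectation (\<lambda>w. \<xi> j n (X w) * \<xi> l n (X w)) else 0))" if "n \<ge> n0" "i \<ge> 1" for n i
  proof -
    have "expectation (\<lambda>w. (g n i (Xs i w))\<^sup>2) = expectation (\<lambda>w. (g n i (X w))\<^sup>2)"
      using that by (intro expectation_Xs[of "\<lambda>x. (g n i x)\<^sup>2"]) auto
    also have "\<dots> = expectation (\<lambda>w. \<Sum>j\<in>UNIV. \<Sum>l\<in>UNIV. d n j * d n l *
      (if i \<le> min (N n j) (N n l) then \<xi> j n (X w) * \<xi> l n (X w) else 0))"
      unfolding g_def power2_eq_square sum_product
      by (intro Bochner_Integration.integral_cong refl sum.cong) auto
    also have "\<dots> = (\<Sum>j\<in>UNIV. \<Sum>l\<in>UNIV. expectation (\<lambda>w. d n j * d n l *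
      (if i \<le> min (N n j) (N n l) then \<xi> j n (X w) * \<xi> l n (X w) else 0)))"
      by (simp only: Bochner_Integration.integral_sum Bochner_Integration.integrable_sum
          integrable_mult_right integrable_if int2[OF that(1)])
    also have "\<dots> = (\<Sum>j\<in>UNIV. \<Sum>l\<in>UNIV. d n j * d n l *
      (if i \<le> min (N n j) (N n l) then expectation (\<lambda>w. \<xi> j n (X w) * \<xi> l n (X w)) else 0))"
      by (simp only: integral_mult_right_zero integral_if)
    finally show ?thesis .
  qed
  have var: "(\<Sum>i=1..n. expectation (\<lambda>w. (g n i (Xs i w))\<^sup>2)) = (\<Sum>j\<in>UNIV. \<Sum>l\<in>UNIV. \<alpha> n j * \<alpha> n l * cv n j l)"
    if "n \<ge> n0" for n
  proof -
    let ?e = "\<lambda>j l. expectation (\<lambda>w. \<xi> j n (X w) * \<xi> l n (X w))"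
    have "(\<Sum>i=1..n. expectation (\<lambda>w. (g n i (Xs i w))\<^sup>2)) =
      (\<Sum>i=1..n. \<Sum>j\<in>UNIV. \<Sum>l\<in>UNIV. d n j * d n l * (if i \<le> min (N n j) (N n l) then ?e j l else 0))"
      by (intro sum.cong refl sq[OF that]) simp
    also have "\<dots> = (\<Sum>j\<in>UNIV. \<Sum>l\<in>UNIV. \<Sum>i=1..n. d n j * d n l * (if i \<le> min (N n j) (N n l) then ?e j l else 0))"
      by (subst sum.swap, intro sum.cong refl sum.swap)
    also have "\<dots> = (\<Sum>j\<in>UNIV. \<Sum>l\<in>UNIV. d n j * d n l * (\<Sum>i=1..min (N n j) (N n l). ?e j l))"
      using N_le by (intro sum.cong refl) (simp only: sum_distrib_left[symmetric] sum_if min.coboundedI1)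
    also have "\<dots> = (\<Sum>j\<in>UNIV. \<Sum>l\<in>UNIV. \<alpha> n j * \<alpha> n l * cv n j l)"
      by (intro sum.cong refl) (simp add: d_def cv_def)
    finally show ?thesis .
  qed
  have var_lim: "(\<lambda>n. \<Sum>j\<in>UNIV. \<Sum>l\<in>UNIV. \<alpha> n j * \<alpha> n l * cv n j l) \<longlonglongrightarrow> v"
    unfolding v_def by (intro tendsto_sum tendsto_mult \<alpha> cv_tendsto)
  show "v \<ge> 0"
  proof (rule tendsto_lowerbound[OF var_lim])
    show "\<forall>\<^sub>F n in sequentially. 0 \<le> (\<Sum>j\<in>UNIV. \<Sum>l\<in>UNIV. \<alpha> n j * \<alpha> n l * cv n j l)"
      unfolding eventually_sequentially
    proof (intro exI[of _ n0] allI impI)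
      fix n assume "n0 \<le> n"
      show "0 \<le> (\<Sum>j\<in>UNIV. \<Sum>l\<in>UNIV. \<alpha> n j * \<alpha> n l * cv n j l)"
        unfolding var[OF \<open>n0 \<le> n\<close>, symmetric] by (intro sum_nonneg) simp
    qed
  qed simp
  define C where "C = real CARD('m) ^ 3"
  define \<kappa> where "\<kappa> = (\<integral>x. (x - 1) ^ 4 \<partial>expo)"
  have g4_le: "(g n i x) ^ 4 \<le> C * (\<Sum>j\<in>UNIV. d n j ^ 4 * (if i \<le> N n j then \<xi> j n x ^ 4 else 0))" for n i x
  proof -
    have "(g n i x) ^ 4 \<le> C * (\<Sum>j\<in>UNIV. (d n j * (if i \<le> N n j then \<xi> j n x else 0)) ^ 4)"
      unfolding g_def C_def by (rule sum_power4_le) simp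
    also have "\<dots> = C * (\<Sum>j\<in>UNIV. d n j ^ 4 * (if i \<le> N n j then \<xi> j n x ^ 4 else 0))"
      by (intro arg_cong[where f = "\<lambda>y. C * y"] sum.cong refl) (simp add: power_mult_distrib)
    finally show ?thesis .
  qed
  have C: "C \<ge> 0" by (simp add: C_def)
  have int_bd: "integrable M (\<lambda>w. C * (\<Sum>j\<in>UNIV. d n j ^ 4 * (if i \<le> N n j then \<xi> j n (X w) ^ 4 else 0)))" if "n \<ge> n0" for n i
    using int\<xi>[OF that, of 4] by (intro integrable_mult_right Bochner_Integration.integrable_sum integrable_if) auto
  have int4: "integrable M (\<lambda>w. (g n i (X w)) ^ 4)" if "n \<ge> n0" for n i
  proof (rule Bochner_Integration.integrable_bound[OF int_bd[OF that, of i]])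
    show "AE w in M. norm ((g n i (X w)) ^ 4) \<le> norm (C * (\<Sum>j\<in>UNIV. d n j ^ 4 * (if i \<le> N n j then \<xi> j n (X w) ^ 4 else 0)))"
      using g4_le[of n i] by (intro AE_I2) (auto intro: order_trans[OF _ abs_ge_self])
  qed measurable
  \<comment> \<open>The weights carry \<open>1 / k\<^sup>2\<close>, while
    \<open>N * exp (- T)\<close> equals \<open>k\<close> for large \<open>n\<close>, so each margin
    contributes order \<open>1 / k\<close>.\<close>
  have four: "(\<Sum>i=1..n. expectation (\<lambda>w. (g n i (Xs i w)) ^ 4)) \<le> C * (\<Sum>j\<in>UNIV. (\<alpha> n j * \<gamma> $ j) ^ 4 * (1 / real (k n j)) * (real (N n j) * exp (- S.T j n) / real (k n j) * \<kappa>))"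
    if "n \<ge> n0" for n
  proof -
    have "(\<Sum>i=1..n. expectation (\<lambda>w. (g n i (Xs i w)) ^ 4)) \<le>
        (\<Sum>i=1..n. C * (\<Sum>j\<in>UNIV. d n j ^ 4 * (if i \<le> N n j then exp (- S.T j n) * \<kappa> else 0)))"
    proof (rule sum_mono)
      fix i assume i: "i \<in> {1..n}"
      have "expectation (\<lambda>w. (g n i (Xs i w)) ^ 4) = expectation (\<lambda>w. (g n i (X w)) ^ 4)"
        using i by (intro expectation_Xs[of "\<lambda>x. (g n i x) ^ 4"]) auto
      also have "\<dots> \<le> expectation (\<lambda>w. C * (\<Sum>j\<in>UNIV. d n j ^ 4 * (if i \<le> N n j then \<xi> j n (X w) ^ 4 else 0)))"
        by (intro integral_mono int4 int_bd g4_le that)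
      also have "\<dots> = C * (\<Sum>j\<in>UNIV. expectation (\<lambda>w. d n j ^ 4 * (if i \<le> N n j then \<xi> j n (X w) ^ 4 else 0)))"
        using int\<xi>[OF that, of 4]
        by (subst integral_mult_right_zero, subst Bochner_Integration.integral_sum)
           (auto intro!: integrable_mult_right integrable_if)
      also have "\<dots> = C * (\<Sum>j\<in>UNIV. d n j ^ 4 * (if i \<le> N n j then exp (- S.T j n) * \<kappa> else 0))"
        by (simp only: integral_mult_right_zero integral_if E\<xi>[OF that zero_less_numeral] \<kappa>_def)
      finally show "expectation (\<lambda>w. (g n i (Xs i w)) ^ 4) \<le> \<dots>" .
    qed
    also have "\<dots> = C * (\<Sum>j\<in>UNIV. \<Sum>i=1..n. d n j ^ 4 * (if i \<le> N n j then exp (- S.T j n) * \<kappa> else 0))"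
      unfolding sum_distrib_left[of C, symmetric] by (subst sum.swap) (rule refl)
    also have "\<dots> = C * (\<Sum>j\<in>UNIV. d n j ^ 4 * (real (N n j) * (exp (- S.T j n) * \<kappa>)))"
      by (simp only: sum_distrib_left[symmetric] sum_if[OF N_le] sum_constant card_atLeastAtMost) (simp add: mult_ac)
    also have "\<dots> = C * (\<Sum>j\<in>UNIV. (\<alpha> n j * \<gamma> $ j) ^ 4 * (1 / real (k n j)) * (real (N n j) * exp (- S.T j n) / real (k n j) * \<kappa>))"
    proof -
      have "sqrt (real m) ^ 4 = real m * real m" for m
        using power_mult[of "sqrt (real m)" 2 2] by (simp add: power2_eq_square)
      then show ?thesis by (simp add: d_def power_divide mult.assoc)
    qed
    finally show ?thesis .
  qed
  have four_lim: "(\<lambda>n. C * (\<Sum>j\<in>UNIV. (\<alpha> n j * \<gamma> $ j) ^ 4 * (1 / real (k n j)) * (real (N n j) * exp (- S.T j n) / real (k n j) * \<kappa>))) \<longlonglongrightarrow> 0"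
  proof -
    have one: "(\<lambda>n. real (N n j) * exp (- S.T j n) / real (k n j)) \<longlonglongrightarrow> 1" for j
    proof (rule tendsto_eventually)
      show "\<forall>\<^sub>F n in sequentially. real (N n j) * exp (- S.T j n) / real (k n j) = 1"
        using S.N_exp_T[of j] by eventually_elim (use pos_k in \<open>auto simp: Suc_le_eq\<close>)
    qed
    have inv: "(\<lambda>n. 1 / real (k n j)) \<longlonglongrightarrow> 0" for j
      using tendsto_divide_0[OF tendsto_const filterlim_at_top_imp_at_infinity[OF S.real_k_lim[of j]]] .
    have "(\<lambda>n. C * (\<Sum>j\<in>UNIV. (\<alpha> n j * \<gamma> $ j) ^ 4 * (1 / real (k n j)) * (real (N n j) * exp (- S.T j n) / real (k n j) * \<kappa>)))
      \<longlonglongrightarrow> C * (\<Sum>j\<in>UNIV. (a j * \<gamma> $ j) ^ 4 * 0 * (1 * \<kappa>))"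
      by (intro tendsto_mult tendsto_const tendsto_sum tendsto_power \<alpha> one inv)
    then show ?thesis by simp
  qed
  \<comment> \<open>The moment formulas start at \<open>n0\<close>; the array is shifted so that
    they hold in every row.\<close>
  have "(\<lambda>m. char (distr M borel (\<lambda>w. \<Sum>i\<in>{1..m + n0}. g (m + n0) i (Xs i w))) t) \<longlonglongrightarrow> of_real (exp (- (v * t\<^sup>2 / 2)))"
  proof (rule lyapunov_char_tendsto)
    show "indep_vars (\<lambda>_. borel) (\<lambda>i w. g (m + n0) i (Xs i w)) {1..m + n0}" for m
      by (rule indep_vars_compose2[OF indep_vars_subset[OF indep_Xs]]) auto
    show "expectation (\<lambda>w. g (m + n0) i (Xs i w)) = 0" if "i \<in> {1..m + n0}" for m i
      using that by (intro mean) auto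
    show "integrable M (\<lambda>w. g (m + n0) i (Xs i w) ^ 4)" if "i \<in> {1..m + n0}" for m i
      using that int4[of "m + n0" i] by (subst integrable_Xs[of "\<lambda>x. g (m + n0) i x ^ 4"]) auto
    show "(\<lambda>m. \<Sum>i\<in>{1..m + n0}. expectation (\<lambda>w. (g (m + n0) i (Xs i w))\<^sup>2)) \<longlonglongrightarrow> v"
      using LIMSEQ_ignore_initial_segment[OF var_lim, of n0] by (simp only: var le_add2)
    show "(\<lambda>m. \<Sum>i\<in>{1..m + n0}. expectation (\<lambda>w. g (m + n0) i (Xs i w) ^ 4)) \<longlonglongrightarrow> 0"
    proof (rule Lim_null_comparison[OF always_eventually LIMSEQ_ignore_initial_segment[OF four_lim, of n0]], rule allI)
      fix m
      have "(\<Sum>i\<in>{1..m + n0}. expectation (\<lambda>w. g (m + n0) i (Xs i w) ^ 4)) \<ge> 0" by (intro sum_nonneg) simp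
      then show "norm (\<Sum>i\<in>{1..m + n0}. expectation (\<lambda>w. g (m + n0) i (Xs i w) ^ 4)) \<le>
        C * (\<Sum>j\<in>UNIV. (\<alpha> (m + n0) j * \<gamma> $ j) ^ 4 * (1 / real (k (m + n0) j)) *
          (real (N (m + n0) j) * exp (- S.T j (m + n0)) / real (k (m + n0) j) * \<kappa>))"
        using four[of "m + n0"] by simp
    qed
  qed auto
  then have "(\<lambda>m. char (distr M borel (\<lambda>w. \<Sum>j\<in>UNIV. \<alpha> (m + n0) j * (\<gamma> $ j * S.pareto_sum j (m + n0) w))) t) \<longlonglongrightarrow> of_real (exp (- (v * t\<^sup>2 / 2)))"
    by (simp only: g_sum)
  from LIMSEQ_offset[OF this]
  show "(\<lambda>n. char (distr M borel (\<lambda>w. \<Sum>j\<in>UNIV. \<alpha> n j * (\<gamma> $ j * S.pareto_sum j n w))) t)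
      \<longlonglongrightarrow> of_real (exp (- (v * t\<^sup>2 / 2)))" .
qed

end

section \<open>Joint and pooled limit laws\<close>

lemma inner_one_vec: "w \<bullet> (1 :: real ^ 'n) = (\<Sum>j\<in>UNIV. w $ j)"
  by (simp add: inner_vec_def)

lemma quadratic_form_eq_sum:
  fixes S :: "real ^ 'n ^ 'n"
  shows "a \<bullet> (S *v a) = (\<Sum>j\<in>UNIV. \<Sum>l\<in>UNIV. a $ j * a $ l * S $ j $ l)"
  by (simp add: inner_vec_def matrix_vector_mult_def sum_distrib_left mult_ac)

lemma borel_measurable_vec_lambda_components:
  fixes f :: "'n::finite \<Rightarrow> 'a \<Rightarrow> real"
  assumes "\<And>j. f j \<in> borel_measurable M"
  shows "(\<lambda>w. \<chi> j. f j w) \<in> borel_measurable M"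
  using assms by (subst borel_measurable_euclidean_space) (auto simp: Basis_vec_def inner_axis)

context hill_samples
begin

definition B where "B = bias_vec \<rho> lam"

definition Z where "Z n w = (\<chi> j. sqrt (real (k n j)) * (hill_vec Xs (N n) (k n) w $ j - \<gamma> $ j))"

lemma hill_vec_measurable [measurable]: "(\<lambda>w. hill_vec Xs (N n) (k n) w $ j) \<in> borel_measurable M"
  unfolding hill_vec_def vec_lambda_beta by measurable

lemma Z_measurable [measurable]: "Z n \<in> borel_measurable M"
  unfolding Z_def by (rule borel_measurable_vec_lambda_components) measurable

lemma pareto_sum_measurable [measurable]: "S.pareto_sum j n \<in> borel_measurable M"
  unfolding S.pareto_sum_def by measurable auto

lemma Z_expansion:
  "((\<lambda>p. Z (fst p) (snd p) $ j - \<gamma> $ j * S.pareto_sum j (fst p) (snd p)) \<longlongrightarrow> B $ j) (whp M)"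
proof -
  have "AE w in M. Xs i w $ j = tail_quantile (margin M X j) (exp (E j (Xs i w)))" if "i \<ge> 1" for i
    using AE_X[OF that, of j] by eventually_elim simp
  from S.hill_expansion[OF real_distribution_margin second_order this lim_lam]
  show ?thesis by (simp add: Z_def hill_vec_def B_def bias_vec_def)
qed

lemma tight_Z: "tight_seq M (\<lambda>n w. Z n w $ j)"
  by (rule tight_seq_add_tendsto[OF S.tight_pareto_sum Z_expansion])

text \<open>Nonnegativity is inherited from the sums of second moments whose limit the form
  is.\<close>

lemma psd_V: "a \<bullet> (V *v a) \<ge> 0"
  unfolding quadratic_form_eq_sum by (rule clt(1)[of "\<lambda>_ j. a $ j"]) (rule tendsto_const)

text \<open>The weights may depend on \<open>n\<close>: constant ones serve the Cramer-Wold device,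
  while the pooled estimator carries the factors
  \<open>sqrt (ktot n / real (k n j))\<close>.\<close>

lemma char_linear_combination:
  assumes \<alpha>: "\<And>j. (\<lambda>n. \<alpha> n j) \<longlonglongrightarrow> a $ j"
  shows "(\<lambda>n. char (distr M borel (\<lambda>w. \<Sum>j\<in>UNIV. \<alpha> n j * Z n w $ j)) t) \<longlonglongrightarrow>
    char (normal_law (a \<bullet> B) (a \<bullet> (V *v a))) t"
proof (rule char_tendsto_whp)
  let ?Y = "\<lambda>n w. a \<bullet> B + (\<Sum>j\<in>UNIV. \<alpha> n j * (\<gamma> $ j * S.pareto_sum j n w))"
  have "((\<lambda>p. (\<Sum>j\<in>UNIV. \<alpha> (fst p) j * (Z (fst p) (snd p) $ j - \<gamma> $ j * S.pareto_sum j (fst p) (snd p))) - a \<bullet> B)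
    \<longlongrightarrow> (\<Sum>j\<in>UNIV. a $ j * B $ j) - a \<bullet> B) (whp M)"
    by (intro tendsto_diff tendsto_sum tendsto_mult Z_expansion tendsto_const tendsto_whp_deterministic \<alpha>)
  then show "((\<lambda>p. (\<Sum>j\<in>UNIV. \<alpha> (fst p) j * Z (fst p) (snd p) $ j) - ?Y (fst p) (snd p)) \<longlongrightarrow> 0) (whp M)"
    by (simp add: right_diff_distrib sum_subtractf inner_vec_def algebra_simps)
  have "(\<lambda>n. iexp (t * (a \<bullet> B)) * char (distr M borel (\<lambda>w. \<Sum>j\<in>UNIV. \<alpha> n j * (\<gamma> $ j * S.pareto_sum j n w))) t)
    \<longlonglongrightarrow> iexp (t * (a \<bullet> B)) * of_real (exp (- ((a \<bullet> (V *v a)) * t\<^sup>2 / 2)))"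
    unfolding quadratic_form_eq_sum by (intro tendsto_mult tendsto_const clt(2) \<alpha>)
  then show "(\<lambda>n. char (distr M borel (?Y n)) t) \<longlonglongrightarrow> char (normal_law (a \<bullet> B) (a \<bullet> (V *v a))) t"
    by (simp add: char_add_const[OF prob_space_axioms] char_normal_law[OF psd_V])
qed measurable

lemma weak_conv_linear_combination:
  assumes "\<And>j. (\<lambda>n. \<alpha> n j) \<longlonglongrightarrow> a $ j"
  shows "weak_conv_m (\<lambda>n. distr M borel (\<lambda>w. \<Sum>j\<in>UNIV. \<alpha> n j * Z n w $ j))
    (normal_law (a \<bullet> B) (a \<bullet> (V *v a)))"
  by (rule levy_continuity)
     (use char_linear_combination[OF assms] in \<open>auto intro!: real_distribution_distr real_distribution_normal_law psd_V\<close>)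

lemma weak_conv_Z: "\<exists>Q. is_multivariate_normal Q B V \<and> weak_conv_vec (\<lambda>n. distr M borel (Z n)) Q"
proof -
  obtain Q where Q: "is_multivariate_normal Q B V"
    using exists_multivariate_normal[OF transpose_V psd_V] by blast
  have "weak_conv_vec (\<lambda>n. distr M borel (Z n)) Q"
  proof (rule cramer_wold[OF Z_measurable _ _ _ tight_Z])
    show "(\<lambda>n. char (distr M borel (\<lambda>w. a \<bullet> Z n w)) 1) \<longlonglongrightarrow> char (distr Q borel (\<lambda>x. a \<bullet> x)) 1" for a
      using char_linear_combination[of "\<lambda>_ j. a $ j" a 1] Q
      by (simp add: is_multivariate_normal_def inner_vec_def)
  qed (use Q in \<open>auto simp: is_multivariate_normal_def\<close>)
  with Q show ?thesis by blast
qed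

definition ktot where "ktot n = real (\<Sum>j\<in>UNIV. k n j)"

text \<open>The limit of \<open>sqrt (ktot n / real (k n j))\<close>, which converts the rate of one
  estimator into that of the pooled one.\<close>

definition d where "d = (\<chi> j. sqrt ((\<Sum>i\<in>UNIV. inverse (c $ i)) * c $ j))"

lemma sum_inverse_c_pos: "(\<Sum>i\<in>UNIV. inverse (c $ i)) > 0"
  using pos_c by (intro sum_pos) auto

lemma d_pos: "d $ j > 0"
  using sum_inverse_c_pos pos_c by (simp add: d_def)

lemma ktot_ratio: "(\<lambda>n. sqrt (ktot n / real (k n j))) \<longlonglongrightarrow> d $ j"
proof -
  have "(\<lambda>n. \<Sum>i\<in>UNIV. real (k n i) / real (k n j)) \<longlonglongrightarrow> (\<Sum>i\<in>UNIV. c $ j / c $ i)"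
    by (intro tendsto_sum ratio_k)
  moreover have "(\<Sum>i\<in>UNIV. real (k n i) / real (k n j)) = ktot n / real (k n j)" for n
    by (simp add: ktot_def sum_divide_distrib)
  moreover have "(\<Sum>i\<in>UNIV. c $ j / c $ i) = (\<Sum>i\<in>UNIV. inverse (c $ i)) * c $ j"
    by (simp add: sum_distrib_left divide_inverse mult.commute)
  ultimately show ?thesis by (auto simp: d_def intro: tendsto_real_sqrt)
qed

lemma pooled_bias_inner: "w \<bullet> pooled_bias_vec \<rho> lam c = (\<chi> j. d $ j * w $ j) \<bullet> B"
  using sum_inverse_c_pos
  by (auto simp: inner_vec_def pooled_bias_vec_def B_def bias_vec_def d_def real_sqrt_mult mult_ac intro!: sum.cong)

lemma pooled_cov_entry:
  assumes "\<gamma> = g *\<^sub>R 1"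
  shows "pooled_cov_mat g b c R $ j $ l = d $ j * d $ l * V $ j $ l"
proof -
  have \<gamma>: "\<gamma> $ j = g" for j by (simp add: assms)
  have off: "pooled_cov_mat g b c R $ p $ q = d $ p * d $ q * V $ p $ q" if "p < q" for p q
  proof -
    define S where "S = (\<Sum>i\<in>UNIV. inverse (c $ i))"
    have S: "sqrt S * sqrt S = S" using sum_inverse_c_pos by (simp add: S_def)
    have cp: "sqrt (c $ p) * sqrt (c $ p) = c $ p" "sqrt (c $ q) \<noteq> 0"
      using pos_c[of p] pos_c[of q] by auto
    \<comment> \<open>The factors \<open>sqrt (c $ q)\<close> cancel, which is why
      \<open>c $ p\<close> alone stands before \<open>R\<close> in the pooled matrix.\<close>
    have "d $ p * d $ q * sqrt (c $ p / c $ q) =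
        (sqrt S * sqrt S) * (sqrt (c $ p) * sqrt (c $ p)) * (sqrt (c $ q) / sqrt (c $ q))"
      by (simp only: d_def vec_lambda_beta S_def[symmetric] real_sqrt_mult real_sqrt_divide
          times_divide_eq_right times_divide_eq_left mult_ac)
    also have "\<dots> = S * c $ p" using pos_c[of q] by (simp only: S cp) simp
    finally have e: "d $ p * d $ q * sqrt (c $ p / c $ q) = S * c $ p" .
    define r where "r = R p q (ennreal (c $ q / c $ p)) (ennreal (b $ q / b $ p))"
    have "pooled_cov_mat g b c R $ p $ q = (S * c $ p) * (g\<^sup>2 * r)"
      using that min.absorb3[OF that] max.absorb4[OF that]
      by (simp add: pooled_cov_mat_def S_def r_def Let_def)
    also have "\<dots> = d $ p * d $ q * (g * g * sqrt (c $ p / c $ q) * r)"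
      unfolding e[symmetric] by (simp add: power2_eq_square)
    also have "g * g * sqrt (c $ p / c $ q) * r = V $ p $ q"
      using that min.absorb3[OF that] max.absorb4[OF that]
      by (simp add: V_def cov_mat_def r_def Let_def \<gamma> less_imp_neq[OF that])
    finally show ?thesis .
  qed
  have sym: "pooled_cov_mat g b c R $ j $ l = pooled_cov_mat g b c R $ l $ j"
    by (simp add: pooled_cov_mat_def min.commute max.commute)
  consider "j = l" | "j < l" | "l < j" by (rule linorder_cases)
  then show ?thesis
  proof cases
    case 1
    have "sqrt x * sqrt x = x" if "x > 0" for x :: real using that by simp
    from this[OF mult_pos_pos[OF sum_inverse_c_pos pos_c]] have "d $ l * d $ l = (\<Sum>i\<in>UNIV. inverse (c $ i)) * c $ l"
      unfolding d_def vec_lambda_beta .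
    then show ?thesis using 1 by (simp add: pooled_cov_mat_def V_def cov_mat_def \<gamma>)
  next
    case 2
    then show ?thesis by (rule off)
  next
    case 3
    show ?thesis unfolding sym V_commute[of j l] mult.commute[of "d $ j"] by (rule off[OF 3])
  qed
qed

lemma pooled_hill_measurable [measurable]:
  assumes [measurable]: "f \<in> borel_measurable M"
  shows "(\<lambda>w. pooled_hill Xs (N n) (k n) (f w) w) \<in> borel_measurable M"
  unfolding pooled_hill_def by measurable

text \<open>With \<open>(w \<bullet> 1) * g\<close> as centre the identity is linear in the weights;
  it is used both for fixed weights and for realisations of random ones.\<close>

lemma pooled_hill_eq:
  assumes "\<gamma> = g *\<^sub>R 1"
  shows "sqrt (ktot n) * (pooled_hill Xs (N n) (k n) w x - (w \<bullet> 1) * g) =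
    (\<Sum>j\<in>UNIV. (sqrt (ktot n / real (k n j)) * w $ j) * Z n x $ j)"
proof -
  have "pooled_hill Xs (N n) (k n) w x - (w \<bullet> 1) * g = (\<Sum>j\<in>UNIV. w $ j * (hill_vec Xs (N n) (k n) x $ j - g))"
    by (simp add: pooled_hill_def inner_one_vec right_diff_distrib sum_subtractf sum_distrib_right)
  moreover have "sqrt (ktot n) * (w $ j * (hill_vec Xs (N n) (k n) x $ j - g)) =
      (sqrt (ktot n / real (k n j)) * w $ j) * Z n x $ j" for j
  proof -
    have "sqrt (real (k n j)) > 0" using pos_k[of n j] by simp
    moreover have "\<gamma> $ j = g" by (simp add: assms)
    ultimately show ?thesis by (simp add: Z_def real_sqrt_divide)
  qed
  ultimately show ?thesis by (simp only: sum_distrib_left)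
qed

lemma weak_conv_pooled:
  assumes g: "\<gamma> = g *\<^sub>R 1" and w: "w \<bullet> 1 = 1"
  shows "weak_conv_m (\<lambda>n. distr M borel (\<lambda>x. sqrt (ktot n) * (pooled_hill Xs (N n) (k n) w x - g)))
    (normal_law (w \<bullet> pooled_bias_vec \<rho> lam c) (w \<bullet> (pooled_cov_mat g b c R *v w)))"
proof -
  define a where "a = (\<chi> j. d $ j * w $ j)"
  have "(\<lambda>n. sqrt (ktot n / real (k n j)) * w $ j) \<longlonglongrightarrow> a $ j" for j
    unfolding a_def vec_lambda_beta by (intro tendsto_mult ktot_ratio tendsto_const)
  from weak_conv_linear_combination[OF this] pooled_hill_eq[OF g, of _ w] show ?thesis
    by (simp add: w a_def pooled_bias_inner quadratic_form_rescale[OF pooled_cov_entry[OF g]])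
qed

lemma pos_def_V_iff: "\<gamma> = g *\<^sub>R 1 \<Longrightarrow> pos_def_mat V \<longleftrightarrow> pos_def_mat (pooled_cov_mat g b c R)"
  by (rule pos_def_mat_rescale_iff[OF pooled_cov_entry d_pos])

text \<open>Both weight vectors sum to one, so the centres cancel and the difference is a
  combination of the tight coordinates of \<open>Z\<close> whose coefficients vanish in
  probability.\<close>

lemma random_weights:
  assumes g: "\<gamma> = g *\<^sub>R 1" and w: "w \<bullet> 1 = 1"
    and [measurable]: "\<And>n. what n \<in> borel_measurable M"
    and what: "\<And>n. AE x in M. what n x \<bullet> 1 = 1" and lim: "conv_in_prob M what w"
  shows "conv_in_prob M (\<lambda>n x. sqrt (ktot n) *
    (pooled_hill Xs (N n) (k n) (what n x) x - pooled_hill Xs (N n) (k n) w x)) 0"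
proof -
  have "((\<lambda>p. what (fst p) (snd p)) \<longlongrightarrow> w) (whp M)"
    using lim by (subst (asm) conv_in_prob_iff_whp) auto
  then have "((\<lambda>p. what (fst p) (snd p) $ j - w $ j) \<longlongrightarrow> w $ j - w $ j) (whp M)" for j
    by (intro tendsto_diff tendsto_vec_nth tendsto_const)
  then have "((\<lambda>p. sqrt (ktot (fst p) / real (k (fst p) j)) * (what (fst p) (snd p) $ j - w $ j))
      \<longlongrightarrow> d $ j * (w $ j - w $ j)) (whp M)" for j
    by (intro tendsto_mult tendsto_whp_deterministic[OF ktot_ratio])
  then have "((\<lambda>p. (sqrt (ktot (fst p) / real (k (fst p) j)) * (what (fst p) (snd p) $ j - w $ j)) * Z (fst p) (snd p) $ j)
      \<longlongrightarrow> 0) (whp M)" for j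
    by (intro tendsto_whp_0_mult_tight[OF tight_Z]) simp
  then have "((\<lambda>p. \<Sum>j\<in>UNIV. (sqrt (ktot (fst p) / real (k (fst p) j)) * (what (fst p) (snd p) $ j - w $ j)) * Z (fst p) (snd p) $ j)
      \<longlongrightarrow> 0) (whp M)"
    by (intro tendsto_null_sum)
  moreover have "\<forall>\<^sub>F p in whp M. (\<Sum>j\<in>UNIV. (sqrt (ktot (fst p) / real (k (fst p) j)) * (what (fst p) (snd p) $ j - w $ j)) * Z (fst p) (snd p) $ j)
      = sqrt (ktot (fst p)) * (pooled_hill Xs (N (fst p)) (k (fst p)) (what (fst p) (snd p)) (snd p) -
          pooled_hill Xs (N (fst p)) (k (fst p)) w (snd p))"
    using eventually_whp_AE[of "\<lambda>n x. what n x \<bullet> 1 = 1", OF what]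
  proof eventually_elim
    case (elim p)
    show ?case
      using pooled_hill_eq[OF g, of "fst p" "what (fst p) (snd p)" "snd p"] pooled_hill_eq[OF g, of "fst p" w "snd p"] elim w
      by (simp add: right_diff_distrib left_diff_distrib sum_subtractf)
  qed
  ultimately have "((\<lambda>p. sqrt (ktot (fst p)) * (pooled_hill Xs (N (fst p)) (k (fst p)) (what (fst p) (snd p)) (snd p) -
          pooled_hill Xs (N (fst p)) (k (fst p)) w (snd p))) \<longlongrightarrow> 0) (whp M)"
    by (rule Lim_transform_eventually)
  then show ?thesis by (subst conv_in_prob_iff_whp) auto
qed

end

theorem theorem1:
  fixes M :: "'a measure"
    and X :: "'a \<Rightarrow> real ^ ('m::{finite,linorder})"
    and Xs :: "nat \<Rightarrow> 'a \<Rightarrow> real ^ ('m::{finite,linorder})"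
    and \<gamma> \<rho> lam b c \<omega> :: "real ^ ('m::{finite,linorder})"
    and A :: "'m \<Rightarrow> real \<Rightarrow> real"
    and R :: "'m \<Rightarrow> 'm \<Rightarrow> ennreal \<Rightarrow> ennreal \<Rightarrow> real"
    and N k :: "nat \<Rightarrow> 'm \<Rightarrow> nat"
  assumes "prob_space M"
    and "X \<in> borel_measurable M"
    and "prob_space.indep_vars M (\<lambda>_. borel) Xs {1..}"
    and "\<And>i. i \<ge> 1 \<Longrightarrow> distr M borel (Xs i) = distr M borel X"
    and "\<And>j. continuous_on UNIV (cdf (margin M X j))"
    and "\<And>j. second_order_cond (margin M X j) (\<gamma> $ j) (\<rho> $ j) (A j)"
    and "tail_dependence_cond M X R"
    and "\<And>n. (\<Sum>j\<in>UNIV. N n j) = n"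
    and "\<And>j. filterlim (\<lambda>n. N n j) at_top sequentially"
    and "\<And>n. mono (N n)"
    and "\<And>n j. k n j \<ge> 1"
    and "\<And>j. filterlim (\<lambda>n. k n j) at_top sequentially"
    and "\<And>j. (\<lambda>n. real (k n j) / real (N n j)) \<longlonglongrightarrow> 0"
    and "\<And>j. (\<lambda>n. real (N n (Min UNIV)) / real (N n j)) \<longlonglongrightarrow> b $ j"
    and "\<And>j. 0 < b $ j \<and> b $ j \<le> 1"
    and "\<And>j. (\<lambda>n. real (k n (Min UNIV)) / real (k n j)) \<longlonglongrightarrow> c $ j"
    and "\<And>j. 0 < c $ j"
    and "c $ Min UNIV = 1" and "b $ Min UNIV = 1" and "antimono (\<lambda>j. b $ j)"
    and "\<And>j. (\<lambda>n. sqrt (real (k n j)) * A j (real (N n j) / real (k n j))) \<longlonglongrightarrow> lam $ j"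
    and "\<omega> \<bullet> 1 = 1"
  defines "B \<equiv> bias_vec \<rho> lam"
    and "V \<equiv> cov_mat \<gamma> b c R"
    and "Bc \<equiv> pooled_bias_vec \<rho> lam c"
    and "Vc \<equiv> \<lambda>g. pooled_cov_mat g b c R"
    and "ktot \<equiv> \<lambda>n. real (\<Sum>j\<in>UNIV. k n j)"
    and "est \<equiv> \<lambda>n w. pooled_hill Xs (N n) (k n) w"
  shows
    "(\<exists>Q. is_multivariate_normal Q B V \<and>
          weak_conv_vec (\<lambda>n. distr M borel
             (\<lambda>x. \<chi> j. sqrt (real (k n j)) * (hill_vec Xs (N n) (k n) x $ j - \<gamma> $ j))) Q)
     \<and> (\<forall>g. \<gamma> = g *\<^sub>R 1 \<longrightarrow>
          weak_conv_m (\<lambda>n. distr M borel (\<lambda>x. sqrt (ktot n) * (est n \<omega> x - g)))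
            (normal_law (\<omega> \<bullet> Bc) (\<omega> \<bullet> (Vc g *v \<omega>)))
        \<and> (pos_def_mat V \<longleftrightarrow> pos_def_mat (Vc g))
        \<and> (pos_def_mat V \<longrightarrow>
             (\<forall>w. is_arg_min (\<lambda>w. w \<bullet> (Vc g *v w)) (\<lambda>w. w \<bullet> 1 = 1) w
                    \<longleftrightarrow> w = var_weights (Vc g))
           \<and> weak_conv_m
               (\<lambda>n. distr M borel (\<lambda>x. sqrt (ktot n) * (est n (var_weights (Vc g)) x - g)))
               (normal_law
                  ((1 \<bullet> (matrix_inv (Vc g) *v Bc)) / (1 \<bullet> (matrix_inv (Vc g) *v 1)))
                  (1 / (1 \<bullet> (matrix_inv (Vc g) *v 1))))
           \<and> (\<forall>w. is_arg_min (AMSE Bc (Vc g)) (\<lambda>w. w \<bullet> 1 = 1) w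
                    \<longleftrightarrow> w = amse_weights Bc (Vc g))
           \<and> AMSE Bc (Vc g) (amse_weights Bc (Vc g)) =
               (1 + Bc \<bullet> (matrix_inv (Vc g) *v Bc)) /
               ((1 + Bc \<bullet> (matrix_inv (Vc g) *v Bc)) * (1 \<bullet> (matrix_inv (Vc g) *v 1))
                  - (1 \<bullet> (matrix_inv (Vc g) *v Bc))\<^sup>2))
        \<and> (\<forall>what.
             (\<forall>n. what n \<in> borel_measurable M) \<longrightarrow>
             (\<forall>n. AE x in M. what n x \<bullet> 1 = 1) \<longrightarrow>
             conv_in_prob M what \<omega> \<longrightarrow>
             conv_in_prob M (\<lambda>n x. sqrt (ktot n) * (est n (what n x) x - est n \<omega> x)) 0))"
proof -
  have "hill_samples M X Xs \<gamma> \<rho> lam b c A R N k"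
    by (intro hill_samples.intro hill_samples_axioms.intro) (use assms in auto)
  then interpret H: hill_samples M X Xs \<gamma> \<rho> lam b c A R N k .
  have pooled: "weak_conv_m (\<lambda>n. distr M borel (\<lambda>x. sqrt (ktot n) * (est n w x - g)))
      (normal_law (w \<bullet> Bc) (w \<bullet> (Vc g *v w)))" if "\<gamma> = g *\<^sub>R 1" "w \<bullet> 1 = 1" for g w
    using H.weak_conv_pooled[OF that] by (simp add: Bc_def Vc_def ktot_def est_def H.ktot_def)
  have pos_def: "pos_def_mat V \<longleftrightarrow> pos_def_mat (Vc g)" if "\<gamma> = g *\<^sub>R 1" for g
    using H.pos_def_V_iff[OF that] by (simp add: V_def Vc_def H.V_def)
  have equivalent: "conv_in_prob M (\<lambda>n x. sqrt (ktot n) * (est n (what n x) x - est n \<omega> x)) 0"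
    if "\<gamma> = g *\<^sub>R 1" "\<forall>n. what n \<in> borel_measurable M" "\<forall>n. AE x in M. what n x \<bullet> 1 = 1"
      "conv_in_prob M what \<omega>" for g what
    using H.random_weights[OF that(1) \<open>\<omega> \<bullet> 1 = 1\<close> _ _ that(4)] that(2,3)
    by (simp add: ktot_def est_def H.ktot_def)
  have var: "weak_conv_m (\<lambda>n. distr M borel (\<lambda>x. sqrt (ktot n) * (est n (var_weights (Vc g)) x - g)))
      (normal_law ((1 \<bullet> (matrix_inv (Vc g) *v Bc)) / (1 \<bullet> (matrix_inv (Vc g) *v 1)))
        (1 / (1 \<bullet> (matrix_inv (Vc g) *v 1))))" if "\<gamma> = g *\<^sub>R 1" "pos_def_mat V" for g
  proof -
    \<comment> \<open>Positive definiteness is assumed of \<open>V\<close> and passed on to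
      \<open>Vc g\<close>, whose inverse defines the weights.\<close>
    have S: "pos_def_mat (Vc g)" using that pos_def by simp
    show ?thesis
      by (rule pooled[OF that(1) var_weights_sum[OF S],
          unfolded var_weights_variance[OF S], unfolded var_weights_inner[OF S]])
  qed
  have "\<exists>Q. is_multivariate_normal Q B V \<and>
      weak_conv_vec (\<lambda>n. distr M borel
        (\<lambda>x. \<chi> j. sqrt (real (k n j)) * (hill_vec Xs (N n) (k n) x $ j - \<gamma> $ j))) Q"
    using H.weak_conv_Z unfolding H.Z_def[abs_def] H.B_def H.V_def B_def V_def .
  moreover have "is_arg_min (\<lambda>w. w \<bullet> (Vc g *v w)) (\<lambda>w. w \<bullet> 1 = 1) w \<longleftrightarrow> w = var_weights (Vc g)"
      "is_arg_min (AMSE Bc (Vc g)) (\<lambda>w. w \<bullet> 1 = 1) w \<longleftrightarrow> w = amse_weights Bc (Vc g)"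
    if "\<gamma> = g *\<^sub>R 1" "pos_def_mat V" for g w
    using that pos_def by (simp_all add: var_weights_arg_min amse_weights_arg_min)
  moreover have "AMSE Bc (Vc g) (amse_weights Bc (Vc g)) =
      (1 + Bc \<bullet> (matrix_inv (Vc g) *v Bc)) /
      ((1 + Bc \<bullet> (matrix_inv (Vc g) *v Bc)) * (1 \<bullet> (matrix_inv (Vc g) *v 1))
         - (1 \<bullet> (matrix_inv (Vc g) *v Bc))\<^sup>2)" if "\<gamma> = g *\<^sub>R 1" "pos_def_mat V" for g
    using that pos_def by (intro AMSE_amse_weights) simp
  ultimately show ?thesis
    using pooled[OF _ \<open>\<omega> \<bullet> 1 = 1\<close>] pos_def var equivalent
    by (intro conjI allI impI; assumption?) blast+
qed

end
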